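(* Let $\mathcal{X}=(X_1,X_2,\dots)$ be a stationary sequence of real random variables that is max-root summable and satisfies $\sum_{k=1}^{\infty}\rho_{\mathcal{X}}(k)<\infty$. Assume further that the marginal distribution function $F$ of the $X_i$ is continuous. Let $f=\sum_{l=1}^m a_l\mathbf{1}_{R_l}$ with $a_l\in\mathbb{R}$ and $R_l\in\mathcal{R}$ for $l=1,\dots,m$, and suppose that the corners $(s,t)$ of the rectangles $R_1,\dots,R_m$ satisfy $F(s)>0$ and $F(t)<1$. Then \[ n^{-1/2}\big(\xi_{0,n}(f)-\mathbb{E}[\xi_{0,n}(f)]\big)\Rightarrow N(0,I_f),\qquad n\to\infty, \] and, if each of the coordinates of $R_l$ lies in $\mathbb{R}$ for $l=1,\dots,m$, then \[ n^{-1/2}\big(\tilde\xi_{0,n}(f)-\mathbb{E}[\tilde\xi_{0,n}(f)]\big)\Rightarrow N(0,I_f),\qquad n\to\infty, \] where $I_f$ is a nonnegative constant depending on $f$.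
   Context: Stationary means strictly stationary. $\Rightarrow$ is convergence in distribution; $N(0,0)$ is the point mass at $0$. $\mu(f)=\int f\,d\mu$. Convention: $F(\infty)=1$. Max-root summable: for all $t$ with $F(t)<1$, $\sum_{i=1}^\infty i\sqrt{\mathbb{P}(X_1\le t,\dots,X_i\le t)}<\infty$. $\rho$-mixing coefficients: for sub-$\sigma$-algebras $\mathcal{A},\mathcal{B}$, $\rho(\mathcal{A},\mathcal{B})=\sup|\mathrm{Corr}(X,Y)|$ over square-integrable (non-degenerate) $X$ $\mathcal{A}$-measurable and $Y$ $\mathcal{B}$-measurable; and $\rho_{\mathcal{X}}(k)=\sup_{m\in\mathbb{N}}\rho\big(\sigma(X_1,\dots,X_m),\sigma(X_{m+k},X_{m+k+1},\dots)\big)$. $\Delta=\{(x,y)\in[-\infty,\infty]^2:-\infty<x<y\le\infty\}$, $\tilde\Delta=\Delta\cap\mathbb{R}^2$, and $\mathcal{R}=\{(s_1,s_2]\times(t_1,t_2]:-\infty<s_1\le s_2\le t_1\le t_2\le\infty\}$. For such a rectangle, $s_1,s_2,t_1,t_2$ are its coordinates and its corners are the points $(s_a,t_b)$, $a,b\in\{1,2\}$. Let $K$ be the graph (simplicial complex) with vertices $v_0,v_1,v_2,\dots$ and edges $\{v_i,v_{i+1}\}$, $i\ge 0$. For $n\ge1$ put $X_{k,n}=X_k$ for $1\le k\le n$, and $X_{k,n}=\infty$ for $k=0$ and for $k>n$. For $t\in\mathbb{R}$ let $K_n(t)=\{\sigma\in K:\max_{v_i\in\sigma}X_{i,n}\le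 t\}$. Homology is with $\mathbb{Z}_2$ coefficients. The persistence module $\big(H_0(K_n(t))\big)_{t\in\mathbb R}$ with maps induced by inclusions is isomorphic to $\bigoplus_{(b,d)\in PD_0}I(b,d)$ for a unique multiset $PD_0$ of points of $\Delta$ (the $0$-th persistence diagram), where $I(b,d)$ equals $\mathbb{Z}_2$ at $t$ when $b\le t<d$ and $0$ otherwise, with identity maps between nonzero spaces. Set $\xi_{0,n}=\sum_{(b,d)\in PD_0}\delta_{(b,d)}$ (with multiplicity) and let $\tilde\xi_{0,n}$ be its restriction to the Borel sets of $\tilde\Delta$. *)

theory Defs
  imports
    "HOL-Probability.Probability"
    "HOL-Algebra.Coset"
    "HOL-Algebra.Product_Groups"
    "HOL-Library.Z2"
    "HOL-Library.Multiset"
begin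

text \<open>Sequences are indexed by the positive integers: the value of \<open>X\<close> at index \<open>0\<close> is never used.\<close>

definition strictly_stationary :: "'a measure \<Rightarrow> (nat \<Rightarrow> 'a \<Rightarrow> real) \<Rightarrow> bool" where
  "strictly_stationary M X \<longleftrightarrow>
     (\<forall>m h. distr M (\<Pi>\<^sub>M i\<in>{1..m}. borel) (\<lambda>\<omega>. \<lambda>i\<in>{1..m}. X (i + h) \<omega>)
          = distr M (\<Pi>\<^sub>M i\<in>{1..m}. borel) (\<lambda>\<omega>. \<lambda>i\<in>{1..m}. X i \<omega>))"

definition marginal_cdf :: "'a measure \<Rightarrow> (nat \<Rightarrow> 'a \<Rightarrow> real) \<Rightarrow> real \<Rightarrow> real" where
  "marginal_cdf M X = cdf (distr M borel (X 1))"

definition marginal_cdf_ext :: "'a measure \<Rightarrow> (nat \<Rightarrow> 'a \<Rightarrow> real) \<Rightarrow> ereal \<Rightarrow> real" where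
  "marginal_cdf_ext M X x =
     (if x = \<infinity> then 1 else if x = -\<infinity> then 0 else marginal_cdf M X (real_of_ereal x))"

definition max_root_summable :: "'a measure \<Rightarrow> (nat \<Rightarrow> 'a \<Rightarrow> real) \<Rightarrow> bool" where
  "max_root_summable M X \<longleftrightarrow>
     (\<forall>t. marginal_cdf M X t < 1 \<longrightarrow>
        summable (\<lambda>i. real i * sqrt (measure M {\<omega> \<in> space M. \<forall>j\<in>{1..i}. X j \<omega> \<le> t})))"

definition variance_rv :: "'a measure \<Rightarrow> ('a \<Rightarrow> real) \<Rightarrow> real" where
  "variance_rv M U = (\<integral>\<omega>. (U \<omega> - (\<integral>\<omega>'. U \<omega>' \<partial>M))\<^sup>2 \<partial>M)"

definition covariance_rv :: "'a measure \<Rightarrow> ('a \<Rightarrow> real) \<Rightarrow> ('a \<Rightarrow> real) \<Rightarrow> real" where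
  "covariance_rv M U V =
     (\<integral>\<omega>. (U \<omega> - (\<integral>\<omega>'. U \<omega>' \<partial>M)) * (V \<omega> - (\<integral>\<omega>'. V \<omega>' \<partial>M)) \<partial>M)"

definition correlation :: "'a measure \<Rightarrow> ('a \<Rightarrow> real) \<Rightarrow> ('a \<Rightarrow> real) \<Rightarrow> real" where
  "correlation M U V = covariance_rv M U V / sqrt (variance_rv M U * variance_rv M V)"

text \<open>A sub-\<open>\<sigma>\<close>-algebra of \<open>M\<close> is given as a measure space with the same underlying set,
  of which only the \<open>\<sigma>\<close>-algebra matters.\<close>

definition nondegenerate_L2 :: "'a measure \<Rightarrow> 'a measure \<Rightarrow> ('a \<Rightarrow> real) set" where
  "nondegenerate_L2 M A =
     {U \<in> borel_measurable A. integrable M (\<lambda>\<omega>. (U \<omega>)\<^sup>2) \<and> variance_rv M U \<noteq> 0}"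

text \<open>The supremum is taken in the extended nonnegative reals, where the supremum of the
  empty set (no nondegenerate variables) is \<open>0\<close>.\<close>

definition rho_coeff :: "'a measure \<Rightarrow> 'a measure \<Rightarrow> 'a measure \<Rightarrow> ennreal" where
  "rho_coeff M A B =
     (SUP U \<in> nondegenerate_L2 M A. SUP V \<in> nondegenerate_L2 M B. ennreal \<bar>correlation M U V\<bar>)"

definition sigma_gen :: "'a measure \<Rightarrow> (nat \<Rightarrow> 'a \<Rightarrow> real) \<Rightarrow> nat set \<Rightarrow> 'a measure" where
  "sigma_gen M X I = sigma (space M) {X i -` B \<inter> space M | i B. i \<in> I \<and> B \<in> sets borel}"

definition rho_mixing :: "'a measure \<Rightarrow> (nat \<Rightarrow> 'a \<Rightarrow> real) \<Rightarrow> nat \<Rightarrow> ennreal" where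
  "rho_mixing M X k = (SUP m \<in> {1..}. rho_coeff M (sigma_gen M X {1..m}) (sigma_gen M X {m + k..}))"

definition normal_law :: "real \<Rightarrow> real \<Rightarrow> real measure" where
  "normal_law \<mu> v =
     (if v = 0 then return borel \<mu> else density lborel (\<lambda>x. ennreal (normal_density \<mu> (sqrt v) x)))"

text \<open>A simplicial complex is a set of finite nonempty vertex sets.  A \<open>\<int>\<^sub>2\<close>-vector space is an
  abelian group of exponent 2, and the \<open>\<int>\<^sub>2\<close>-linear maps are exactly the group homomorphisms;
  \<open>\<int>\<^sub>2\<close>-vector spaces are therefore represented as groups.\<close>

definition chain_group :: "'v set set \<Rightarrow> nat \<Rightarrow> ('v set \<Rightarrow> bit) monoid" where
  "chain_group K p =
     \<lparr>carrier = {c. finite {\<sigma>. c \<sigma> \<noteq> 0} \<and> {\<sigma>. c \<sigma> \<noteq> 0} \<subseteq> {\<sigma> \<in> K. card \<sigma> = Suc p}},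
      monoid.mult = (\<lambda>c d \<sigma>. c \<sigma> + d \<sigma>),
      one = (\<lambda>_. 0)\<rparr>"

text \<open>The condition \<open>\<tau> \<noteq> {}\<close> makes the boundary of a \<open>0\<close>-chain zero (unreduced homology).\<close>

definition boundary_map :: "('v set \<Rightarrow> bit) \<Rightarrow> ('v set \<Rightarrow> bit)" where
  "boundary_map c =
     (\<lambda>\<tau>. if \<tau> = {} then 0
          else (\<Sum>\<sigma> | c \<sigma> \<noteq> 0 \<and> \<tau> \<subseteq> \<sigma> \<and> card \<sigma> = Suc (card \<tau>). c \<sigma>))"

definition cycles :: "'v set set \<Rightarrow> nat \<Rightarrow> ('v set \<Rightarrow> bit) set" where
  "cycles K p = {c \<in> carrier (chain_group K p). boundary_map c = (\<lambda>_. 0)}"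

definition boundaries :: "'v set set \<Rightarrow> nat \<Rightarrow> ('v set \<Rightarrow> bit) set" where
  "boundaries K p = boundary_map ` carrier (chain_group K (Suc p))"

definition homology :: "nat \<Rightarrow> 'v set set \<Rightarrow> ('v set \<Rightarrow> bit) set monoid" where
  "homology p K = (chain_group K p)\<lparr>carrier := cycles K p\<rparr> Mod boundaries K p"

text \<open>Induced map of an inclusion into \<open>L\<close>: the class of a cycle \<open>z\<close> goes to the class of \<open>z\<close> in \<open>L\<close>,
  which does not depend on \<open>z \<in> C\<close>, so that all members of the union coincide.\<close>

definition homology_inclusion ::
    "nat \<Rightarrow> 'v set set \<Rightarrow> ('v set \<Rightarrow> bit) set \<Rightarrow> ('v set \<Rightarrow> bit) set" where
  "homology_inclusion p L C = (\<Union>z\<in>C. boundaries L p #>\<^bsub>chain_group L p\<^esub> z)"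

text \<open>\<open>transition P s t\<close> is only meaningful for \<open>s \<le> t\<close>.\<close>

record 'b persistence_module =
  space_at :: "real \<Rightarrow> 'b monoid"
  transition :: "real \<Rightarrow> real \<Rightarrow> 'b \<Rightarrow> 'b"

definition pm_isomorphic :: "'b persistence_module \<Rightarrow> 'c persistence_module \<Rightarrow> bool" where
  "pm_isomorphic P Q \<longleftrightarrow>
     (\<exists>h. (\<forall>t. h t \<in> iso (space_at P t) (space_at Q t)) \<and>
          (\<forall>s t. s \<le> t \<longrightarrow> (\<forall>x \<in> carrier (space_at P s).
             h t (transition P s t x) = transition Q s t (h s x))))"

definition interval_module :: "ereal \<times> ereal \<Rightarrow> bit persistence_module" where
  "interval_module bd =
     (let alive = (\<lambda>t. fst bd \<le> ereal t \<and> ereal t < snd bd) in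
      \<lparr>space_at = (\<lambda>t. \<lparr>carrier = (if alive t then UNIV else {0}), monoid.mult = (+), one = 0\<rparr>),
       transition = (\<lambda>s t x. if alive s \<and> alive t then x else 0)\<rparr>)"

definition pm_direct_sum ::
    "'i set \<Rightarrow> ('i \<Rightarrow> 'b persistence_module) \<Rightarrow> ('i \<Rightarrow> 'b) persistence_module" where
  "pm_direct_sum I P =
     \<lparr>space_at = (\<lambda>t. sum_group I (\<lambda>i. space_at (P i) t)),
      transition = (\<lambda>s t x. \<lambda>i\<in>I. transition (P i) s t (x i))\<rparr>"

text \<open>The index \<open>((b,d), j)\<close> stands for the \<open>j\<close>-th copy of \<open>(b,d)\<close> in the multiset.\<close>

definition interval_sum :: "(ereal \<times> ereal) multiset \<Rightarrow> ((ereal \<times> ereal) \<times> nat \<Rightarrow> bit) persistence_module" where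
  "interval_sum D =
     pm_direct_sum {(bd, j). j < count D bd} (\<lambda>(bd, j). interval_module bd)"

definition Delta :: "(ereal \<times> ereal) set" where
  "Delta = {(x, y). -\<infinity> < x \<and> x < y \<and> y \<le> \<infinity>}"

definition Delta_finite :: "(ereal \<times> ereal) set" where
  "Delta_finite = Delta \<inter> (range ereal \<times> range ereal)"

definition is_persistence_diagram :: "'b persistence_module \<Rightarrow> (ereal \<times> ereal) multiset \<Rightarrow> bool" where
  "is_persistence_diagram P D \<longleftrightarrow> set_mset D \<subseteq> Delta \<and> pm_isomorphic P (interval_sum D)"

definition persistence_diagram :: "'b persistence_module \<Rightarrow> (ereal \<times> ereal) multiset" where
  "persistence_diagram P = (THE D. is_persistence_diagram P D)"

definition homology_module :: "nat \<Rightarrow> (real \<Rightarrow> 'v set set) \<Rightarrow> ('v set \<Rightarrow> bit) set persistence_module" where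
  "homology_module p K =
     \<lparr>space_at = (\<lambda>t. homology p (K t)),
      transition = (\<lambda>s t. homology_inclusion p (K t))\<rparr>"

text \<open>The vertex \<open>v\<^sub>i\<close> is represented by the natural number \<open>i\<close>.\<close>

definition half_line_complex :: "nat set set" where
  "half_line_complex = {{i} | i. True} \<union> {{i, Suc i} | i. True}"

definition padded :: "nat \<Rightarrow> (nat \<Rightarrow> real) \<Rightarrow> nat \<Rightarrow> ereal" where
  "padded n x k = (if 1 \<le> k \<and> k \<le> n then ereal (x k) else \<infinity>)"

definition sublevel_complex :: "nat \<Rightarrow> (nat \<Rightarrow> real) \<Rightarrow> real \<Rightarrow> nat set set" where
  "sublevel_complex n x t = {\<sigma> \<in> half_line_complex. Max (padded n x ` \<sigma>) \<le> ereal t}"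

definition PD0 :: "nat \<Rightarrow> (nat \<Rightarrow> real) \<Rightarrow> (ereal \<times> ereal) multiset" where
  "PD0 n x = persistence_diagram (homology_module 0 (sublevel_complex n x))"

definition dirac_sum :: "(ereal \<times> ereal) multiset \<Rightarrow> (ereal \<times> ereal) measure" where
  "dirac_sum D = measure_of UNIV (sets borel) (\<lambda>A. \<Sum>p\<in>#D. emeasure (return borel p) A)"

definition xi0 :: "nat \<Rightarrow> (nat \<Rightarrow> real) \<Rightarrow> (ereal \<times> ereal) measure" where
  "xi0 n x = dirac_sum (PD0 n x)"

definition xi0_finite :: "nat \<Rightarrow> (nat \<Rightarrow> real) \<Rightarrow> (ereal \<times> ereal) measure" where
  "xi0_finite n x = restrict_space (xi0 n x) Delta_finite"

definition normalized :: "'a measure \<Rightarrow> (nat \<Rightarrow> 'a \<Rightarrow> real) \<Rightarrow> nat \<Rightarrow> 'a \<Rightarrow> real" where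
  "normalized M Y n \<omega> = (Y n \<omega> - (\<integral>\<omega>'. Y n \<omega>' \<partial>M)) / sqrt (real n)"

definition converges_in_distribution ::
    "'a measure \<Rightarrow> (nat \<Rightarrow> 'a \<Rightarrow> real) \<Rightarrow> real measure \<Rightarrow> bool" where
  "converges_in_distribution M Y \<mu> \<longleftrightarrow> weak_conv_m (\<lambda>n. distr M borel (Y n)) \<mu>"

end

theory Submission
  imports Defs
begin

text \<open>Two facts are combined. The first is about homology: all values of the measure \<open>\<xi>\<^sub>0\<close> on the
rectangles in question are alternating sums of persistent Betti numbers
\<open>\<beta>(s, t) = #{(b, d). b \<le> s, t < d}\<close>, and \<open>\<beta>(s, t)\<close> is the number of connected components of the
sublevel set at \<open>t\<close> that contain a vertex of value at most \<open>s\<close>. Such a component is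
recognised at its last vertex of value at most \<open>s\<close>: from there the path stays in \<open>(s, t]\<close> until it
first exceeds \<open>t\<close>. Up to one component, which may run into the right end of the path, \<open>\<beta>(s, t)\<close> is
therefore a sum over \<open>j\<close> and \<open>i\<close> of the indicators that the path, observed from time \<open>j\<close>, starts at
most at \<open>s\<close> and makes its exit above \<open>t\<close> exactly \<open>i\<close> steps later.

The diagram is only given by a definite description, so it has to be constructed and shown to be unique.
The construction is the elder rule. Vertex \<open>i\<close> is born at its own value and dies at the lowest level at
which it is joined to an older vertex, its parent (\<open>death\<close>, \<open>parent\<close>). The chains
``vertex plus parent'' form a basis in which the inclusion maps are diagonal, which
gives \<open>pm_isomorphic_elder_diagram\<close>. Uniqueness holds because the ranks of the
transition maps determine the multiset of bars (\<open>multiset_eq_if_same_ranks\<close>).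

The second fact is a central limit theorem. Indicators whose exit time is at most \<open>K\<close> depend
on blocks of length \<open>K + 1\<close>, so their sums are partial sums of a bounded stationary sequence whose
mixing coefficients are at most those of \<open>X\<close>, shifted by \<open>K\<close>, and hence still summable. For such
sequences \<open>chf_psum_tendsto\<close> is proved by blocking: the characteristic function of a sum is nearly
multiplicative, because partial sums are almost independent once a bounded gap is cut out; a second order
expansion in each of a fixed number \<open>r\<close> of blocks, with a remainder controlled by a fourth moment bound, leaves an
error of order \<open>r\<^sup>-\<^sup>1\<^sup>/\<^sup>2\<close>.

The remainder of the sum, with exit times \<open>i > K\<close>, is negligible: the event for \<open>i\<close> forces a run of
\<open>i\<close> values not exceeding \<open>t\<close>, so by the mixing variance bound the \<open>L\<^sup>2\<close> norm of its contribution is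
at most a constant times \<open>n\<^sup>1\<^sup>/\<^sup>2 i (P(X\<^sub>1 \<le> t, ..., X\<^sub>i \<le> t))\<^sup>1\<^sup>/\<^sup>2\<close>, that is \<open>n\<^sup>1\<^sup>/\<^sup>2\<close> times the general term
of the series in the definition of max-root summability. Letting \<open>K\<close> grow (\<open>chf_limit_by_approximation\<close>) and applying
the continuity theorem of Levy gives the result. Since \<open>F(t) < 1\<close> excludes \<open>t = \<infinity>\<close>, all corners are
finite, so \<open>f\<close> vanishes outside the finite part of the diagram and both versions of the statement concern
the same random variables.\<close>

section \<open>Elder rule on a path\<close>

text \<open>The lowest level at which \<open>i\<close> and \<open>j\<close> lie in one component of the sublevel set.\<close>

definition pass_height :: "(nat \<Rightarrow> real) \<Rightarrow> nat \<Rightarrow> nat \<Rightarrow> real" where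
  "pass_height x i j = Max (x ` {min i j..max i j})"

lemma pass_height_le_iff: "pass_height x i j \<le> t \<longleftrightarrow> (\<forall>k\<in>{min i j..max i j}. x k \<le> t)"
  unfolding pass_height_def by (subst Max_le_iff) auto

lemma pass_height_commute: "pass_height x i j = pass_height x j i"
  by (simp add: pass_height_def min.commute max.commute)

lemma pass_height_self [simp]: "pass_height x i i = x i"
  by (simp add: pass_height_def)

lemma le_pass_height: "x i \<le> pass_height x i j" "x j \<le> pass_height x i j"
  using pass_height_le_iff[of x i j "pass_height x i j"] by auto

lemma pass_height_trans:
  assumes "pass_height x i j \<le> t" "pass_height x j k \<le> t"
  shows "pass_height x i k \<le> t"
  unfolding pass_height_le_iff
proof
  fix l assume "l \<in> {min i k..max i k}"
  then have "l \<in> {min i j..max i j} \<or> l \<in> {min j k..max j k}" by auto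
  then show "x l \<le> t" using assms unfolding pass_height_le_iff by blast
qed

text \<open>Ties of the values are broken by the index, so that being older is a strict linear order on the
vertices.\<close>

definition elders :: "nat \<Rightarrow> (nat \<Rightarrow> real) \<Rightarrow> nat \<Rightarrow> nat set" where
  "elders n x i = {j \<in> {1..n}. x j < x i \<or> x j = x i \<and> j < i}"

text \<open>Among the elders the parent is one that \<open>i\<close> meets first. At its death \<open>i\<close> is thus in
the same component as its parent, and the parent is present whenever \<open>i\<close> is.\<close>

definition parent :: "nat \<Rightarrow> (nat \<Rightarrow> real) \<Rightarrow> nat \<Rightarrow> nat" where
  "parent n x i = arg_min_on (pass_height x i) (elders n x i)"

definition death :: "nat \<Rightarrow> (nat \<Rightarrow> real) \<Rightarrow> nat \<Rightarrow> ereal" where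
  "death n x i = (if elders n x i = {} then \<infinity> else ereal (pass_height x i (parent n x i)))"

lemma finite_elders [simp]: "finite (elders n x i)"
  by (simp add: elders_def)

lemma elders_linear:
  "i \<in> {1..n} \<Longrightarrow> j \<in> {1..n} \<Longrightarrow> i \<noteq> j \<Longrightarrow> i \<in> elders n x j \<or> j \<in> elders n x i"
  by (auto simp: elders_def)

lemma elders_irrefl: "i \<notin> elders n x i"
  by (auto simp: elders_def)

lemma elders_mono: "j \<in> elders n x i \<Longrightarrow> elders n x j \<subseteq> elders n x i"
  by (auto simp: elders_def)

lemma card_elders_less: "j \<in> elders n x i \<Longrightarrow> card (elders n x j) < card (elders n x i)"
  by (metis elders_irrefl elders_mono finite_elders psubsetI psubset_card_mono)

lemma parent_elder: "elders n x i \<noteq> {} \<Longrightarrow> parent n x i \<in> elders n x i"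
  by (simp add: parent_def arg_min_if_finite)

lemma elder_in: "j \<in> elders n x i \<Longrightarrow> j \<in> {1..n}"
  by (auto simp: elders_def)

lemma elder_le: "j \<in> elders n x i \<Longrightarrow> x j \<le> x i"
  by (auto simp: elders_def)

lemma death_le_elder:
  assumes "j \<in> elders n x i" shows "death n x i \<le> ereal (pass_height x i j)"
proof -
  have "pass_height x i (parent n x i) \<le> pass_height x i j"
    unfolding parent_def using assms by (intro arg_min_least) auto
  then show ?thesis using assms by (auto simp: death_def)
qed

lemma death_leD:
  assumes "death n x i \<le> ereal t"
  shows "elders n x i \<noteq> {}" "parent n x i \<in> elders n x i" "pass_height x i (parent n x i) \<le> t"
  using assms parent_elder by (auto simp: death_def split: if_splits)

text \<open>At every level a component has exactly one vertex that is still alive, its oldest one: of two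
joined vertices the younger has met an elder and is dead.\<close>

lemma alive_joined_eq:
  assumes "i \<in> {1..n}" "j \<in> {1..n}" "pass_height x i j \<le> t"
    and "ereal t < death n x i" "ereal t < death n x j"
  shows "i = j"
proof (rule ccontr)
  assume "i \<noteq> j"
  then consider "i \<in> elders n x j" | "j \<in> elders n x i"
    using assms elders_linear by blast
  then show False
  proof cases
    case 1 with death_le_elder[OF 1] assms show False
      by (metis ereal_less_eq(3) leD order_trans pass_height_commute)
  next
    case 2 with death_le_elder[OF 2] assms show False
      by (metis ereal_less_eq(3) leD order_trans)
  qed
qed

definition ancestor_step :: "nat \<Rightarrow> (nat \<Rightarrow> real) \<Rightarrow> (nat \<times> nat) set" where
  "ancestor_step n x = {(v, parent n x v) | v. elders n x v \<noteq> {}}"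

text \<open>These sets express a vertex in the basis of chains ``vertex plus parent'': \<open>v\<close> is the sum of
the basis elements of its ancestors, itself included.\<close>

definition ancestors :: "nat \<Rightarrow> (nat \<Rightarrow> real) \<Rightarrow> nat \<Rightarrow> nat set" where
  "ancestors n x v = (ancestor_step n x)\<^sup>* `` {v}"

lemma ancestors_unfold:
  "ancestors n x v = insert v (if elders n x v = {} then {} else ancestors n x (parent n x v))"
proof -
  have "u \<in> ancestors n x v \<longleftrightarrow> u = v \<or> (elders n x v \<noteq> {} \<and> u \<in> ancestors n x (parent n x v))" for u
  proof -
    have "u \<in> ancestors n x v \<longleftrightarrow> (v, u) \<in> (ancestor_step n x)\<^sup>*" by (auto simp: ancestors_def)
    also have "\<dots> \<longleftrightarrow> v = u \<or> (\<exists>y. (v, y) \<in> ancestor_step n x \<and> (y, u) \<in> (ancestor_step n x)\<^sup>*)"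
      by (meson converse_rtranclE converse_rtrancl_into_rtrancl rtrancl.rtrancl_refl)
    finally show ?thesis by (auto simp: ancestors_def ancestor_step_def)
  qed
  then show ?thesis by auto
qed

lemma elder_induct [case_names step]:
  assumes "\<And>v. (\<And>u. u \<in> elders n x v \<Longrightarrow> P u) \<Longrightarrow> P v"
  shows "P v"
proof (induction "card (elders n x v)" arbitrary: v rule: less_induct)
  case less
  show ?case by (rule assms) (use less card_elders_less in blast)
qed

lemma ancestors_subset: "ancestors n x v \<subseteq> insert v (elders n x v)"
proof (induction v rule: elder_induct[of n x])
  case (step v)
  show ?case
  proof (cases "elders n x v = {}")
    case True then show ?thesis by (subst ancestors_unfold) auto
  next
    case False
    have p: "parent n x v \<in> elders n x v" by (rule parent_elder[OF False])
    have "ancestors n x (parent n x v) \<subseteq> insert (parent n x v) (elders n x (parent n x v))"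
      by (rule step[OF p])
    also have "\<dots> \<subseteq> elders n x v" using p elders_mono[OF p] by auto
    finally show ?thesis using False by (subst ancestors_unfold) auto
  qed
qed

lemma ancestor_le: "u \<in> ancestors n x v \<Longrightarrow> x u \<le> x v"
  using ancestors_subset elder_le by fastforce

lemma self_notin_ancestors_parent:
  assumes "elders n x i \<noteq> {}" shows "i \<notin> ancestors n x (parent n x i)"
  using ancestors_subset[of n x "parent n x i"] parent_elder[OF assms] elders_irrefl elders_mono
  by fastforce

text \<open>Going from parent to parent leaves the component only after its oldest vertex has been
reached, and no vertex that is passed on the way is alive at level \<open>t\<close>.\<close>

lemma alive_representative:
  "v \<in> {1..n} \<Longrightarrow> x v \<le> t \<Longrightarrow> \<exists>e. e \<in> {1..n} \<and> ereal t < death n x e \<and> pass_height x v e \<le> t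
     \<and> (\<forall>i. ereal t < death n x i \<longrightarrow> (i \<in> ancestors n x v \<longleftrightarrow> i \<in> ancestors n x e))"
proof -
  have "v \<in> {1..n} \<longrightarrow> x v \<le> t \<longrightarrow> (\<exists>e. e \<in> {1..n} \<and> ereal t < death n x e \<and> pass_height x v e \<le> t
     \<and> (\<forall>i. ereal t < death n x i \<longrightarrow> (i \<in> ancestors n x v \<longleftrightarrow> i \<in> ancestors n x e)))"
  proof (induction v rule: elder_induct[of n x])
    case (step v)
    show ?case
    proof (intro impI)
      assume v: "v \<in> {1..n}" "x v \<le> t"
      show "\<exists>e. e \<in> {1..n} \<and> ereal t < death n x e \<and> pass_height x v e \<le> t
     \<and> (\<forall>i. ereal t < death n x i \<longrightarrow> (i \<in> ancestors n x v \<longleftrightarrow> i \<in> ancestors n x e))"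
      proof (cases "ereal t < death n x v")
        case True
        then show ?thesis using v by (intro exI[of _ v]) auto
      next
        case False
        then have d: "death n x v \<le> ereal t" by simp
        note p = death_leD[OF d]
        have "x (parent n x v) \<le> t" using elder_le[OF p(2)] v by simp
        then obtain e where e: "e \<in> {1..n}" "ereal t < death n x e"
          "pass_height x (parent n x v) e \<le> t"
          "\<forall>i. ereal t < death n x i \<longrightarrow> (i \<in> ancestors n x (parent n x v) \<longleftrightarrow> i \<in> ancestors n x e)"
          using step[OF p(2)] elder_in[OF p(2)] by blast
        have "\<forall>i. ereal t < death n x i \<longrightarrow> (i \<in> ancestors n x v \<longleftrightarrow> i \<in> ancestors n x e)"
          using e(4) p(1) False by (subst ancestors_unfold) auto
        then show ?thesis using e pass_height_trans[OF p(3) e(3)] by blast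
      qed
    qed
  qed
  then show "v \<in> {1..n} \<Longrightarrow> x v \<le> t \<Longrightarrow> \<exists>e. e \<in> {1..n} \<and> ereal t < death n x e \<and> pass_height x v e \<le> t
     \<and> (\<forall>i. ereal t < death n x i \<longrightarrow> (i \<in> ancestors n x v \<longleftrightarrow> i \<in> ancestors n x e))" by blast
qed

text \<open>This invariance is what makes the coordinates of a chain vanish on boundaries: both ends of an
edge have the same living ancestors.\<close>

lemma ancestors_joined:
  assumes "v \<in> {1..n}" "u \<in> {1..n}" "pass_height x v u \<le> t" "ereal t < death n x i"
  shows "i \<in> ancestors n x v \<longleftrightarrow> i \<in> ancestors n x u"
proof -
  have "x v \<le> t" "x u \<le> t"
    using assms(3) le_pass_height[of x v u] le_pass_height(2)[of x u v] by linarith+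
  obtain e where e: "e \<in> {1..n}" "ereal t < death n x e" "pass_height x v e \<le> t"
    "i \<in> ancestors n x v \<longleftrightarrow> i \<in> ancestors n x e"
    using alive_representative[of v n x t] assms(1,4) \<open>x v \<le> t\<close> by blast
  obtain e' where e': "e' \<in> {1..n}" "ereal t < death n x e'" "pass_height x u e' \<le> t"
    "i \<in> ancestors n x u \<longleftrightarrow> i \<in> ancestors n x e'"
    using alive_representative[of u n x t] assms(2,4) \<open>x u \<le> t\<close> by blast
  have "pass_height x e e' \<le> t"
    using e(3) e'(3) assms(3) by (metis pass_height_commute pass_height_trans)
  then have "e = e'" using alive_joined_eq e e' by blast
  then show ?thesis using e e' by simp
qed

section \<open>Zeroth homology of a complex\<close>

text \<open>The default rules turn addition of bits into Boolean expressions, where the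
linear algebra below would get lost.\<close>

declare add_bit_eq_xor [simp del] mult_bit_eq_and [simp del]
  bit_not_zero_iff [simp del] bit_not_one_iff [simp del]

lemma chain_group_simps:
  "c \<in> carrier (chain_group K p) \<longleftrightarrow> finite {\<sigma>. c \<sigma> \<noteq> 0} \<and> (\<forall>\<sigma>. c \<sigma> \<noteq> 0 \<longrightarrow> \<sigma> \<in> K \<and> card \<sigma> = Suc p)"
  "c \<otimes>\<^bsub>chain_group K p\<^esub> d = (\<lambda>\<sigma>. c \<sigma> + d \<sigma>)"
  "\<one>\<^bsub>chain_group K p\<^esub> = (\<lambda>_. 0)"
  by (auto simp: chain_group_def)

lemma bit_add_self [simp]: "(b::bit) + b = 0"
  by (cases b) (auto simp: one_add_one)

lemma bit_add_left_self [simp]: "(b::bit) + (b + c) = c"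
  by (simp flip: add.assoc)

lemma comm_group_chain_group: "comm_group (chain_group K p)"
proof (rule comm_groupI)
  fix c d assume cd: "c \<in> carrier (chain_group K p)" "d \<in> carrier (chain_group K p)"
  have "finite {\<sigma>. c \<sigma> + d \<sigma> \<noteq> 0}"
    by (rule finite_subset[of _ "{\<sigma>. c \<sigma> \<noteq> 0} \<union> {\<sigma>. d \<sigma> \<noteq> 0}"])
      (use cd in \<open>auto simp: chain_group_simps\<close>)
  moreover have "\<sigma> \<in> K \<and> card \<sigma> = Suc p" if "c \<sigma> + d \<sigma> \<noteq> 0" for \<sigma>
    using that cd by (cases "c \<sigma> = 0") (auto simp: chain_group_simps)
  ultimately show "c \<otimes>\<^bsub>chain_group K p\<^esub> d \<in> carrier (chain_group K p)"
    by (simp add: chain_group_simps)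
next
  fix c assume c: "c \<in> carrier (chain_group K p)"
  show "\<exists>y\<in>carrier (chain_group K p). y \<otimes>\<^bsub>chain_group K p\<^esub> c = \<one>\<^bsub>chain_group K p\<^esub>"
    by (rule bexI[OF _ c]) (auto simp: chain_group_simps)
qed (auto simp: chain_group_simps add.assoc add.commute)

lemma chain_group_mono:
  "K \<subseteq> L \<Longrightarrow> c \<in> carrier (chain_group K p) \<Longrightarrow> c \<in> carrier (chain_group L p)"
  by (auto simp: chain_group_simps)

lemma boundary_map_eq_sum:
  assumes "finite S" "{\<sigma>. c \<sigma> \<noteq> 0} \<subseteq> S" "\<tau> \<noteq> {}"
  shows "boundary_map c \<tau> = (\<Sum>\<sigma> | \<sigma> \<in> S \<and> \<tau> \<subseteq> \<sigma> \<and> card \<sigma> = Suc (card \<tau>). c \<sigma>)"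
  unfolding boundary_map_def using assms by (auto intro!: sum.mono_neutral_left)

lemma boundary_map_add:
  assumes "finite {\<sigma>. c \<sigma> \<noteq> 0}" "finite {\<sigma>. d \<sigma> \<noteq> 0}"
  shows "boundary_map (\<lambda>\<sigma>. c \<sigma> + d \<sigma>) = (\<lambda>\<tau>. boundary_map c \<tau> + boundary_map d \<tau>)"
proof
  fix \<tau> :: "'a set"
  let ?S = "{\<sigma>. c \<sigma> \<noteq> 0} \<union> {\<sigma>. d \<sigma> \<noteq> 0}"
  have S: "finite ?S" using assms by simp
  show "boundary_map (\<lambda>\<sigma>. c \<sigma> + d \<sigma>) \<tau> = boundary_map c \<tau> + boundary_map d \<tau>"
  proof (cases "\<tau> = {}")
    case True then show ?thesis by (simp add: boundary_map_def)
  next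
    case False
    have sub: "{\<sigma>. c \<sigma> + d \<sigma> \<noteq> 0} \<subseteq> ?S" by auto
    show ?thesis
      unfolding boundary_map_eq_sum[OF S sub False] boundary_map_eq_sum[OF S Un_upper1 False]
        boundary_map_eq_sum[OF S Un_upper2 False]
      by (rule sum.distrib)
  qed
qed

lemma boundary_map_zero: "boundary_map (\<lambda>_. 0) = (\<lambda>_. 0)"
  by (auto simp: boundary_map_def)

text \<open>Unreduced homology: in degree \<open>0\<close> there is no condition on cycles, and \<open>H\<^sub>0\<close> is a plain quotient of
the group of \<open>0\<close>-chains.\<close>

lemma cycles_0: "cycles K 0 = carrier (chain_group K 0)"
proof -
  have "boundary_map c \<tau> = 0" if c: "c \<in> carrier (chain_group K 0)" for c and \<tau> :: "'a set"
  proof (cases "\<tau> = {}")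
    case False
    have "\<not> (c \<sigma> \<noteq> 0 \<and> \<tau> \<subseteq> \<sigma> \<and> card \<sigma> = Suc (card \<tau>))" for \<sigma>
    proof
      assume \<sigma>: "c \<sigma> \<noteq> 0 \<and> \<tau> \<subseteq> \<sigma> \<and> card \<sigma> = Suc (card \<tau>)"
      then have 1: "card \<sigma> = Suc 0" using c unfolding chain_group_simps(1) by blast
      then have "finite \<sigma>" by (intro card_ge_0_finite) simp
      then have "finite \<tau>" using \<sigma> finite_subset by blast
      then show False using False 1 \<sigma> by simp
    qed
    then have "{\<sigma>. c \<sigma> \<noteq> 0 \<and> \<tau> \<subseteq> \<sigma> \<and> card \<sigma> = Suc (card \<tau>)} = {}" by blast
    then show ?thesis unfolding boundary_map_def by (simp only: sum.empty if_cancel)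
  qed (simp add: boundary_map_def)
  then show ?thesis unfolding cycles_def by blast
qed

lemma homology_0: "homology 0 K = chain_group K 0 Mod boundaries K 0"
  by (simp add: homology_def cycles_0)

lemma boundaries_mono: "K \<subseteq> L \<Longrightarrow> boundaries K p \<subseteq> boundaries L p"
  unfolding boundaries_def by (intro image_mono subsetI) (rule chain_group_mono)

lemma boundaries_add:
  assumes "b \<in> boundaries K p" "b' \<in> boundaries K p"
  shows "(\<lambda>\<sigma>. b \<sigma> + b' \<sigma>) \<in> boundaries K p"
proof -
  interpret comm_group "chain_group K (Suc p)" by (rule comm_group_chain_group)
  obtain c c' where c: "c \<in> carrier (chain_group K (Suc p))" "c' \<in> carrier (chain_group K (Suc p))"
    "b = boundary_map c" "b' = boundary_map c'"
    using assms by (auto simp: boundaries_def)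
  have "boundary_map (\<lambda>\<sigma>. c \<sigma> + c' \<sigma>) = (\<lambda>\<sigma>. b \<sigma> + b' \<sigma>)"
    using c by (subst boundary_map_add) (auto simp: chain_group_simps)
  moreover have "(\<lambda>\<sigma>. c \<sigma> + c' \<sigma>) \<in> carrier (chain_group K (Suc p))"
    using m_closed[OF c(1,2)] unfolding chain_group_simps(2) .
  ultimately show ?thesis unfolding boundaries_def by (intro image_eqI) (rule sym)
qed

lemma boundaries_zero: "(\<lambda>_. 0) \<in> boundaries K p"
  unfolding boundaries_def
  by (rule image_eqI[of _ _ "\<lambda>_. 0"]) (simp_all add: boundary_map_zero chain_group_simps)

lemma boundaries_sum:
  assumes "finite A" and "\<And>a. a \<in> A \<Longrightarrow> b a \<in> boundaries K p"
  shows "(\<lambda>\<sigma>. \<Sum>a\<in>A. b a \<sigma>) \<in> boundaries K p"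
proof -
  have "A' \<subseteq> A \<longrightarrow> (\<lambda>\<sigma>. \<Sum>a\<in>A'. b a \<sigma>) \<in> boundaries K p" if "finite A'" for A'
    using that
  proof induct
    case empty
    show ?case unfolding sum.empty by (intro impI boundaries_zero)
  next
    case (insert a A')
    show ?case
    proof
      assume "insert a A' \<subseteq> A"
      then have "b a \<in> boundaries K p" "(\<lambda>\<sigma>. \<Sum>a\<in>A'. b a \<sigma>) \<in> boundaries K p"
        using insert(3) assms(2) by blast+
      then show "(\<lambda>\<sigma>. \<Sum>a\<in>insert a A'. b a \<sigma>) \<in> boundaries K p"
        unfolding sum.insert[OF insert(1,2)] by (rule boundaries_add)
    qed
  qed
  then show ?thesis using assms(1) by blast
qed

lemma coset_chain_group:
  "B #>\<^bsub>chain_group K p\<^esub> z = (\<lambda>b \<sigma>. b \<sigma> + z \<sigma>) ` B"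
  unfolding r_coset_def chain_group_simps UNION_singleton_eq_range ..

lemma coset_boundaries_absorb:
  assumes KL: "boundaries K p \<subseteq> boundaries L p" and z': "z' \<in> boundaries K p #>\<^bsub>chain_group K p\<^esub> z"
  shows "boundaries L p #>\<^bsub>chain_group L p\<^esub> z' = boundaries L p #>\<^bsub>chain_group L p\<^esub> z"
proof -
  obtain b where "b \<in> boundaries K p" and z'_eq: "z' = (\<lambda>\<sigma>. b \<sigma> + z \<sigma>)"
    using z' unfolding coset_chain_group by (rule imageE)
  with KL have b: "b \<in> boundaries L p" by blast
  have shift: "(\<lambda>\<sigma>. c \<sigma> + b \<sigma>) \<in> boundaries L p" if "c \<in> boundaries L p" for c
    by (rule boundaries_add[OF that b])
  show ?thesis
    unfolding coset_chain_group
  proof (rule subset_antisym; rule image_subsetI)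
    fix c assume c: "c \<in> boundaries L p"
    have "(\<lambda>\<sigma>. c \<sigma> + z' \<sigma>) = (\<lambda>\<sigma>. (c \<sigma> + b \<sigma>) + z \<sigma>)"
      unfolding z'_eq by (simp only: add.assoc bit_add_left_self)
    then show "(\<lambda>\<sigma>. c \<sigma> + z' \<sigma>) \<in> (\<lambda>b \<sigma>. b \<sigma> + z \<sigma>) ` boundaries L p"
      using shift[OF c] by (rule image_eqI)
  next
    fix c assume c: "c \<in> boundaries L p"
    have "(\<lambda>\<sigma>. c \<sigma> + z \<sigma>) = (\<lambda>\<sigma>. (c \<sigma> + b \<sigma>) + z' \<sigma>)"
      unfolding z'_eq by (simp only: add.assoc bit_add_left_self)
    then show "(\<lambda>\<sigma>. c \<sigma> + z \<sigma>) \<in> (\<lambda>b \<sigma>. b \<sigma> + z' \<sigma>) ` boundaries L p"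
      using shift[OF c] by (rule image_eqI)
  qed
qed

text \<open>All representatives of a class modulo the smaller boundary group are equivalent modulo
the larger one, so the union in the definition of the induced map is a single coset.\<close>

lemma homology_inclusion_coset:
  assumes "K \<subseteq> L"
  shows "homology_inclusion p L (boundaries K p #>\<^bsub>chain_group K p\<^esub> z)
    = boundaries L p #>\<^bsub>chain_group L p\<^esub> z"
proof -
  have "(\<lambda>\<sigma>. 0 + z \<sigma>) \<in> boundaries K p #>\<^bsub>chain_group K p\<^esub> z"
    unfolding coset_chain_group by (rule imageI[OF boundaries_zero])
  moreover have "\<forall>z'\<in>boundaries K p #>\<^bsub>chain_group K p\<^esub> z.
      boundaries L p #>\<^bsub>chain_group L p\<^esub> z' = boundaries L p #>\<^bsub>chain_group L p\<^esub> z"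
    by (rule ballI) (rule coset_boundaries_absorb[OF boundaries_mono[OF assms]])
  ultimately show ?thesis
    unfolding homology_inclusion_def by (rule UN_constant_eq)
qed

lemma carrier_homology_0:
  "carrier (homology 0 K) = (\<lambda>z. boundaries K 0 #>\<^bsub>chain_group K 0\<^esub> z) ` carrier (chain_group K 0)"
  by (simp only: homology_0 FactGroup_def RCOSETS_def partial_object.simps UNION_singleton_eq_range)

text \<open>By the homomorphism theorem an isomorphism of persistence modules out of \<open>H\<^sub>0\<close> amounts to
surjective homomorphisms on chains whose kernels are the boundaries; naturality then needs
to be checked for chains only.\<close>

lemma pm_isomorphic_homology_0I:
  assumes mono: "\<And>s t. s \<le> t \<Longrightarrow> K s \<subseteq> K t"
    and grp: "\<And>t. group (space_at Q t)"
    and hom: "\<And>t. g t \<in> hom (chain_group (K t) 0) (space_at Q t)"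
    and surj: "\<And>t y. y \<in> carrier (space_at Q t) \<Longrightarrow> \<exists>z\<in>carrier (chain_group (K t) 0). g t z = y"
    and ker: "\<And>t z. z \<in> carrier (chain_group (K t) 0) \<Longrightarrow>
        g t z = \<one>\<^bsub>space_at Q t\<^esub> \<longleftrightarrow> z \<in> boundaries (K t) 0"
    and bd: "\<And>t. boundaries (K t) 0 \<subseteq> carrier (chain_group (K t) 0)"
    and nat: "\<And>s t z. s \<le> t \<Longrightarrow> z \<in> carrier (chain_group (K s) 0) \<Longrightarrow> g t z = transition Q s t (g s z)"
  shows "pm_isomorphic (homology_module 0 K) Q"
proof -
  define h where "h t X = the_elem (g t ` X)" for t X
  have gh: "group_hom (chain_group (K t) 0) (space_at Q t) (g t)" for t
    using comm_group_chain_group grp hom comm_group_def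
    by (intro group_hom.intro) (auto simp: group_hom_axioms_def comm_group_def)
  have kernel: "kernel (chain_group (K t) 0) (space_at Q t) (g t) = boundaries (K t) 0" for t
    using ker bd by (auto simp: kernel_def)
  have iso: "h t \<in> iso (homology 0 (K t)) (space_at Q t)" for t
  proof -
    interpret group_hom "chain_group (K t) 0" "space_at Q t" "g t" by (rule gh)
    have "g t ` carrier (chain_group (K t) 0) = carrier (space_at Q t)"
      using surj hom_closed by blast
    from FactGroup_iso_set[OF this] show ?thesis
      by (simp add: kernel homology_0 h_def[abs_def])
  qed
  have hcoset: "h t (boundaries (K t) 0 #>\<^bsub>chain_group (K t) 0\<^esub> z) = g t z"
    if z: "z \<in> carrier (chain_group (K t) 0)" for t z
  proof -
    interpret group_hom "chain_group (K t) 0" "space_at Q t" "g t" by (rule gh)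
    show ?thesis
      unfolding h_def
    proof (rule the_elem_image_unique)
      show "boundaries (K t) 0 #>\<^bsub>chain_group (K t) 0\<^esub> z \<noteq> {}"
        unfolding r_coset_def using boundaries_zero by blast
    next
      fix y assume y: "y \<in> boundaries (K t) 0 #>\<^bsub>chain_group (K t) 0\<^esub> z"
      show "g t y = g t z"
      proof -
        obtain b where b: "b \<in> boundaries (K t) 0" "y = b \<otimes>\<^bsub>chain_group (K t) 0\<^esub> z"
          using y by (auto simp: r_coset_def)
        have "b \<in> carrier (chain_group (K t) 0)" using b bd by blast
        then have "g t y = g t b \<otimes>\<^bsub>space_at Q t\<^esub> g t z"
          unfolding b(2) using z by (rule hom_mult)
        also have "g t b = \<one>\<^bsub>space_at Q t\<^esub>"
          by (rule iffD2[OF ker[OF \<open>b \<in> carrier (chain_group (K t) 0)\<close>] b(1)])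
        also have "\<one>\<^bsub>space_at Q t\<^esub> \<otimes>\<^bsub>space_at Q t\<^esub> g t z = g t z"
          by (rule H.l_one[OF hom_closed[OF z]])
        finally show "g t y = g t z" .
      qed
    qed
  qed
  have h_nat: "h t (homology_inclusion 0 (K t) C) = transition Q s t (h s C)"
    if st: "s \<le> t" and C: "C \<in> carrier (homology 0 (K s))" for s t C
  proof -
    obtain z where z: "z \<in> carrier (chain_group (K s) 0)"
      "C = boundaries (K s) 0 #>\<^bsub>chain_group (K s) 0\<^esub> z"
      using C by (auto simp: carrier_homology_0)
    have z': "z \<in> carrier (chain_group (K t) 0)"
      by (rule chain_group_mono[OF mono[OF st] z(1)])
    show ?thesis
      unfolding z(2) homology_inclusion_coset[OF mono[OF st]] hcoset[OF z(1)] hcoset[OF z']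
      by (rule nat[OF st z(1)])
  qed
  show ?thesis
    unfolding pm_isomorphic_def homology_module_def persistence_module.simps
    using iso h_nat by blast
qed

section \<open>Bars of the sublevel filtration\<close>

definition vertex_chain :: "'v \<Rightarrow> 'v set \<Rightarrow> bit" where
  "vertex_chain v = (\<lambda>\<sigma>. if \<sigma> = {v} then 1 else 0)"

lemma padded_le_iff: "padded n x k \<le> ereal t \<longleftrightarrow> k \<in> {1..n} \<and> x k \<le> t"
  by (auto simp: padded_def)

lemma sublevel_complex_vertex:
  "{v} \<in> sublevel_complex n x t \<longleftrightarrow> v \<in> {1..n} \<and> x v \<le> t"
proof -
  have "{v} \<in> half_line_complex" by (auto simp: half_line_complex_def)
  then show ?thesis by (simp add: sublevel_complex_def padded_le_iff)
qed

lemma sublevel_complex_edge: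
  "{k, Suc k} \<in> sublevel_complex n x t \<longleftrightarrow>
     k \<in> {1..n} \<and> Suc k \<in> {1..n} \<and> pass_height x k (Suc k) \<le> t"
proof -
  have "{k, Suc k} \<in> half_line_complex" by (auto simp: half_line_complex_def)
  moreover have "{min k (Suc k)..max k (Suc k)} = {k, Suc k}" by auto
  moreover have "Max (padded n x ` {k, Suc k}) \<le> ereal t
      \<longleftrightarrow> padded n x k \<le> ereal t \<and> padded n x (Suc k) \<le> ereal t" by simp
  ultimately show ?thesis
    unfolding sublevel_complex_def pass_height_le_iff padded_le_iff by auto
qed

lemma sublevel_complex_mono: "s \<le> t \<Longrightarrow> sublevel_complex n x s \<subseteq> sublevel_complex n x t"
  by (auto simp: sublevel_complex_def intro: order_trans[of _ "ereal s" "ereal t"])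

lemma sublevel_complex_card_1:
  assumes "\<sigma> \<in> sublevel_complex n x t" "card \<sigma> = Suc 0"
  obtains v where "\<sigma> = {v}" "v \<in> {1..n}" "x v \<le> t"
proof -
  obtain v where "\<sigma> = {v}" using assms(2) card_1_singletonE by (metis One_nat_def)
  then show ?thesis using assms(1) that sublevel_complex_vertex by blast
qed

lemma sublevel_complex_card_2:
  assumes "\<sigma> \<in> sublevel_complex n x t" "card \<sigma> = Suc (Suc 0)"
  obtains k where "\<sigma> = {k, Suc k}" "k \<in> {1..n}" "Suc k \<in> {1..n}" "pass_height x k (Suc k) \<le> t"
proof -
  have "\<sigma> \<in> half_line_complex" using assms(1) by (simp add: sublevel_complex_def)
  then obtain k where "\<sigma> = {k, Suc k}" using assms(2) by (auto simp: half_line_complex_def)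
  then show ?thesis using assms(1) that sublevel_complex_edge by blast
qed

lemma chain_0_support:
  assumes "c \<in> carrier (chain_group (sublevel_complex n x t) 0)" "c \<sigma> \<noteq> 0"
  obtains v where "\<sigma> = {v}" "v \<in> {1..n}" "x v \<le> t"
  using assms sublevel_complex_card_1 unfolding chain_group_simps(1) by blast

lemma lincomb_chain_closed:
  assumes "finite A" "\<And>v. v \<in> A \<Longrightarrow> b v \<noteq> 0 \<Longrightarrow> c v \<in> carrier (chain_group K p)"
  shows "(\<lambda>\<sigma>. \<Sum>v\<in>A. b v * c v \<sigma>) \<in> carrier (chain_group K p)"
proof -
  interpret comm_group "chain_group K p" by (rule comm_group_chain_group)
  have "A' \<subseteq> A \<longrightarrow> (\<lambda>\<sigma>. \<Sum>v\<in>A'. b v * c v \<sigma>) \<in> carrier (chain_group K p)" if "finite A'" for A'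
    using that
  proof induct
    case empty
    show ?case using one_closed unfolding sum.empty chain_group_simps(3) by blast
  next
    case (insert a A')
    show ?case
    proof
      assume sub: "insert a A' \<subseteq> A"
      then have IH: "(\<lambda>\<sigma>. \<Sum>v\<in>A'. b v * c v \<sigma>) \<in> carrier (chain_group K p)"
        using insert(3) by blast
      show "(\<lambda>\<sigma>. \<Sum>v\<in>insert a A'. b v * c v \<sigma>) \<in> carrier (chain_group K p)"
      proof (cases "b a = 0")
        case True
        then show ?thesis using IH unfolding sum.insert[OF insert(1,2)] by (simp only: mult_zero_left add_0_left)
      next
        case False
        then have "b a = 1" by (cases "b a") simp_all
        have "c a \<in> carrier (chain_group K p)" using assms(2) sub False by blast
        from m_closed[OF this IH] show ?thesis
          unfolding sum.insert[OF insert(1,2)] chain_group_simps(2) \<open>b a = 1\<close> by (simp only: mult_1_left)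
      qed
    qed
  qed
  then show ?thesis using assms(1) by blast
qed

lemma boundary_map_vertex:
  assumes "c \<in> carrier (chain_group K (Suc 0))" "finite S" "{\<sigma>. c \<sigma> \<noteq> 0} \<subseteq> S"
    "\<And>\<sigma>. \<sigma> \<in> S \<Longrightarrow> card \<sigma> = Suc (Suc 0)"
  shows "boundary_map c {v} = (\<Sum>\<sigma> | \<sigma> \<in> S \<and> v \<in> \<sigma>. c \<sigma>)"
proof -
  have "{\<sigma>. \<sigma> \<in> S \<and> {v} \<subseteq> \<sigma> \<and> card \<sigma> = Suc (card {v})} = {\<sigma>. \<sigma> \<in> S \<and> v \<in> \<sigma>}"
    using assms(4) by auto
  then show ?thesis
    using boundary_map_eq_sum[OF assms(2,3), of "{v}"] by simp
qed

text \<open>Only here does the one-dimensional part of the complex enter: edges identify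
neighbouring vertices and nothing else.\<close>

lemma boundary_edge_chain:
  "boundary_map (\<lambda>\<sigma>. if \<sigma> = {k, Suc k} then 1 else 0)
     = (\<lambda>\<sigma>. vertex_chain k \<sigma> + vertex_chain (Suc k) \<sigma>)"
proof
  fix \<tau> :: "nat set"
  let ?c = "\<lambda>\<sigma>. if \<sigma> = {k, Suc k} then 1 else (0::bit)"
  show "boundary_map ?c \<tau> = vertex_chain k \<tau> + vertex_chain (Suc k) \<tau>"
  proof (cases "\<tau> \<subseteq> {k, Suc k} \<and> \<tau> \<noteq> {} \<and> card \<tau> = 1")
    case True
    then have "{\<sigma>. ?c \<sigma> \<noteq> 0 \<and> \<tau> \<subseteq> \<sigma> \<and> card \<sigma> = Suc (card \<tau>)} = {{k, Suc k}}" by auto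
    moreover have "\<tau> = {k} \<or> \<tau> = {Suc k}" using True card_1_singletonE[of \<tau>] by auto
    ultimately show ?thesis by (auto simp: boundary_map_def vertex_chain_def)
  next
    case False
    have "\<tau> \<noteq> {k}" "\<tau> \<noteq> {Suc k}" using False by auto
    moreover have "boundary_map ?c \<tau> = 0"
    proof (cases "\<tau> = {}")
      case False': False
      have "{\<sigma>. ?c \<sigma> \<noteq> 0 \<and> \<tau> \<subseteq> \<sigma> \<and> card \<sigma> = Suc (card \<tau>)} = {}"
        using False False' by auto
      then show ?thesis unfolding boundary_map_def by (simp only: sum.empty if_cancel)
    qed (simp add: boundary_map_def)
    ultimately show ?thesis by (simp add: vertex_chain_def)
  qed
qed

lemma edge_boundary:
  assumes "k \<in> {1..n}" "Suc k \<in> {1..n}" "pass_height x k (Suc k) \<le> t"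
  shows "(\<lambda>\<sigma>. vertex_chain k \<sigma> + vertex_chain (Suc k) \<sigma>) \<in> boundaries (sublevel_complex n x t) 0"
proof -
  let ?c = "\<lambda>\<sigma>. if \<sigma> = {k, Suc k} then 1 else (0::bit)"
  have "{k, Suc k} \<in> sublevel_complex n x t" using assms sublevel_complex_edge by blast
  then have "?c \<in> carrier (chain_group (sublevel_complex n x t) (Suc 0))"
    unfolding chain_group_simps by auto
  then show ?thesis unfolding boundaries_def boundary_edge_chain[symmetric] by (rule imageI)
qed

text \<open>The boundaries of the edges along the path from \<open>i\<close> to \<open>j\<close> telescope.\<close>

lemma joined_boundary_le:
  assumes "i \<le> j" "i \<in> {1..n}" "j \<in> {1..n}" "pass_height x i j \<le> t"
  shows "(\<lambda>\<sigma>. vertex_chain i \<sigma> + vertex_chain j \<sigma>) \<in> boundaries (sublevel_complex n x t) 0"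
  using assms
proof (induction j rule: dec_induct)
  case base
  then show ?case using boundaries_zero by (simp only: bit_add_self)
next
  case (step k)
  have x: "\<forall>l\<in>{i..Suc k}. x l \<le> t"
    using step by (simp add: pass_height_le_iff)
  have 1: "(\<lambda>\<sigma>. vertex_chain i \<sigma> + vertex_chain k \<sigma>) \<in> boundaries (sublevel_complex n x t) 0"
    using step x by (intro step.IH) (auto simp: pass_height_le_iff)
  have 2: "(\<lambda>\<sigma>. vertex_chain k \<sigma> + vertex_chain (Suc k) \<sigma>) \<in> boundaries (sublevel_complex n x t) 0"
    using step x by (intro edge_boundary) (auto simp: pass_height_le_iff)
  show ?case using boundaries_add[OF 1 2] by (simp only: add.assoc bit_add_left_self)
qed

lemma joined_boundary:
  assumes "i \<in> {1..n}" "j \<in> {1..n}" "pass_height x i j \<le> t"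
  shows "(\<lambda>\<sigma>. vertex_chain i \<sigma> + vertex_chain j \<sigma>) \<in> boundaries (sublevel_complex n x t) 0"
proof (cases "i \<le> j")
  case True then show ?thesis using joined_boundary_le assms by blast
next
  case False
  then have "(\<lambda>\<sigma>. vertex_chain j \<sigma> + vertex_chain i \<sigma>) \<in> boundaries (sublevel_complex n x t) 0"
    using assms by (intro joined_boundary_le) (auto simp: pass_height_commute)
  then show ?thesis by (simp only: add.commute)
qed

lemma boundaries_0_subset:
  "boundaries (sublevel_complex n x t) 0 \<subseteq> carrier (chain_group (sublevel_complex n x t) 0)"
proof
  fix b assume "b \<in> boundaries (sublevel_complex n x t) 0"
  then obtain c where c: "c \<in> carrier (chain_group (sublevel_complex n x t) (Suc 0))" "b = boundary_map c"
    unfolding boundaries_def by blast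
  have main: "card \<tau> = Suc 0 \<and> \<tau> \<in> sublevel_complex n x t" if nz: "boundary_map c \<tau> \<noteq> 0" for \<tau>
  proof -
    have "\<tau> \<noteq> {}" using nz by (auto simp: boundary_map_def)
    moreover have "{\<sigma>. c \<sigma> \<noteq> 0 \<and> \<tau> \<subseteq> \<sigma> \<and> card \<sigma> = Suc (card \<tau>)} \<noteq> {}"
      using nz unfolding boundary_map_def by (metis sum.empty)
    ultimately obtain \<sigma> where \<sigma>: "c \<sigma> \<noteq> 0" "\<tau> \<subseteq> \<sigma>" "card \<sigma> = Suc (card \<tau>)" by blast
    then have "\<sigma> \<in> sublevel_complex n x t" "card \<sigma> = Suc (Suc 0)"
      using c(1) unfolding chain_group_simps(1) by blast+
    then obtain k where k: "\<sigma> = {k, Suc k}" "k \<in> {1..n}" "Suc k \<in> {1..n}" "pass_height x k (Suc k) \<le> t"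
      using sublevel_complex_card_2 by blast
    have "card \<tau> = 1" using \<sigma>(3) \<open>card \<sigma> = Suc (Suc 0)\<close> by simp
    then obtain v where "\<tau> = {v}" using card_1_singletonE by blast
    moreover have "x k \<le> t" "x (Suc k) \<le> t"
      using k(4) le_pass_height[of x k "Suc k"] le_pass_height(2)[of x "Suc k" k] by linarith+
    ultimately have "\<tau> \<in> sublevel_complex n x t"
      using \<sigma>(2) k by (auto simp: sublevel_complex_vertex)
    then show ?thesis using \<open>card \<tau> = 1\<close> by simp
  qed
  have "{\<tau>. boundary_map c \<tau> \<noteq> 0} \<subseteq> (\<lambda>v. {v}) ` {1..n}"
    using main sublevel_complex_card_1 by blast
  then have "finite {\<tau>. boundary_map c \<tau> \<noteq> 0}" by (rule finite_subset) simp
  then show "b \<in> carrier (chain_group (sublevel_complex n x t) 0)"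
    unfolding chain_group_simps(1) c(2) using main by blast
qed

text \<open>The dual basis to the chains ``vertex plus parent'': the coefficient of the basis element of
\<open>i\<close> is the sum of the coefficients of all vertices descending from \<open>i\<close>.\<close>

definition coordinate :: "nat \<Rightarrow> (nat \<Rightarrow> real) \<Rightarrow> nat \<Rightarrow> (nat set \<Rightarrow> bit) \<Rightarrow> bit" where
  "coordinate n x i z = (\<Sum>v | v \<in> {1..n} \<and> i \<in> ancestors n x v. z {v})"

text \<open>Over the field with two elements this is the difference of the vertex and its parent. The class of this cycle is
born with \<open>i\<close> and becomes zero exactly when \<open>i\<close> is joined to its parent, so it spans the bar
of \<open>i\<close>. The globally oldest vertex has no parent and spans an infinite bar.\<close>

definition bar_chain :: "nat \<Rightarrow> (nat \<Rightarrow> real) \<Rightarrow> nat \<Rightarrow> nat set \<Rightarrow> bit" where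
  "bar_chain n x i = (\<lambda>\<sigma>. vertex_chain i \<sigma>
     + (if elders n x i = {} then 0 else vertex_chain (parent n x i) \<sigma>))"

lemma coordinate_add:
  "coordinate n x i (\<lambda>\<sigma>. z \<sigma> + z' \<sigma>) = coordinate n x i z + coordinate n x i z'"
  by (simp only: coordinate_def sum.distrib)

lemma coordinate_lincomb:
  "coordinate n x i (\<lambda>\<sigma>. \<Sum>a\<in>A. b a * c a \<sigma>) = (\<Sum>a\<in>A. b a * coordinate n x i (c a))"
  unfolding coordinate_def sum_distrib_left by (rule sum.swap)

lemma coordinate_vertex_chain:
  assumes "v \<in> {1..n}"
  shows "coordinate n x i (vertex_chain v) = (if i \<in> ancestors n x v then 1 else 0)"
proof -
  have "coordinate n x i (vertex_chain v)
      = (\<Sum>u | u \<in> {1..n} \<and> i \<in> ancestors n x u. if u = v then 1 else 0)"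
    unfolding coordinate_def vertex_chain_def by (intro sum.cong) auto
  then show ?thesis using assms by (simp add: sum.delta)
qed

lemma coordinate_bar_chain:
  assumes "i \<in> {1..n}"
  shows "coordinate n x j (bar_chain n x i) = (if i = j then 1 else 0)"
proof (cases "elders n x i = {}")
  case True
  then have "ancestors n x i = {i}" by (subst ancestors_unfold) simp
  then show ?thesis
    using True coordinate_vertex_chain[OF assms] by (auto simp: bar_chain_def)
next
  case False
  note p = parent_elder[OF False]
  have "coordinate n x j (bar_chain n x i) = (if j \<in> ancestors n x i then 1 else 0)
      + (if j \<in> ancestors n x (parent n x i) then 1 else 0)"
    unfolding bar_chain_def coordinate_add
    using False coordinate_vertex_chain[OF assms] coordinate_vertex_chain[OF elder_in[OF p]] by simp
  moreover have "j \<in> ancestors n x i \<longleftrightarrow> j = i \<or> j \<in> ancestors n x (parent n x i)"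
    using False by (subst ancestors_unfold) simp
  ultimately show ?thesis
    using self_notin_ancestors_parent[OF False] by auto
qed

lemma ancestors_subset_vertices: "v \<in> {1..n} \<Longrightarrow> ancestors n x v \<subseteq> {1..n}"
  using ancestors_subset[of n x v] elder_in by blast

lemma vertex_chain_eq_sum_bars:
  "v \<in> {1..n} \<Longrightarrow> vertex_chain v \<sigma> = (\<Sum>j\<in>ancestors n x v. bar_chain n x j \<sigma>)"
proof (induction v rule: elder_induct[of n x])
  case (step v)
  show ?case
  proof (cases "elders n x v = {}")
    case True
    then have "ancestors n x v = {v}" by (subst ancestors_unfold) simp
    then show ?thesis using True by (simp add: bar_chain_def)
  next
    case False
    note p = parent_elder[OF False]
    have fin: "finite (ancestors n x (parent n x v))"
      using ancestors_subset_vertices[OF elder_in[OF p]] finite_subset by blast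
    have "(\<Sum>j\<in>ancestors n x v. bar_chain n x j \<sigma>)
        = bar_chain n x v \<sigma> + (\<Sum>j\<in>ancestors n x (parent n x v). bar_chain n x j \<sigma>)"
      using False by (subst ancestors_unfold) (simp add: fin self_notin_ancestors_parent[OF False])
    also have "\<dots> = bar_chain n x v \<sigma> + vertex_chain (parent n x v) \<sigma>"
      using step.IH[OF p elder_in[OF p]] by simp
    also have "\<dots> = vertex_chain v \<sigma>"
      using False by (simp only: bar_chain_def if_False add.assoc bit_add_self add_0_right)
    finally show ?thesis by simp
  qed
qed

lemma chain_eq_sum_bars:
  assumes z: "z \<in> carrier (chain_group (sublevel_complex n x t) 0)"
  shows "z = (\<lambda>\<sigma>. \<Sum>j\<in>{1..n}. coordinate n x j z * bar_chain n x j \<sigma>)"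
proof
  fix \<sigma>
  have "z \<sigma> = (\<Sum>v\<in>{1..n}. z {v} * vertex_chain v \<sigma>)"
  proof (cases "\<exists>v\<in>{1..n}. \<sigma> = {v}")
    case True
    then obtain v where v: "v \<in> {1..n}" "\<sigma> = {v}" by blast
    have "(\<Sum>u\<in>{1..n}. z {u} * vertex_chain u \<sigma>) = (\<Sum>u\<in>{1..n}. if u = v then z {v} else 0)"
      by (intro sum.cong) (auto simp: vertex_chain_def v)
    then show ?thesis using v by simp
  next
    case False
    have "z \<sigma> = 0"
    proof (rule ccontr)
      assume "z \<sigma> \<noteq> 0"
      then obtain v where "\<sigma> = {v}" "v \<in> {1..n}" by (rule chain_0_support[OF z])
      then show False using False by blast
    qed
    moreover have "(\<Sum>v\<in>{1..n}. z {v} * vertex_chain v \<sigma>) = 0"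
      using False by (intro sum.neutral) (auto simp: vertex_chain_def)
    ultimately show ?thesis by simp
  qed
  also have "\<dots> = (\<Sum>v\<in>{1..n}. \<Sum>j | j \<in> {1..n} \<and> j \<in> ancestors n x v. z {v} * bar_chain n x j \<sigma>)"
  proof (intro sum.cong refl)
    fix v assume v: "v \<in> {1..n}"
    have "{j. j \<in> {1..n} \<and> j \<in> ancestors n x v} = ancestors n x v"
      using ancestors_subset_vertices[OF v] by blast
    then show "z {v} * vertex_chain v \<sigma>
        = (\<Sum>j | j \<in> {1..n} \<and> j \<in> ancestors n x v. z {v} * bar_chain n x j \<sigma>)"
      using vertex_chain_eq_sum_bars[OF v, of \<sigma> x] by (simp only: sum_distrib_left)
  qed
  also have "\<dots> = (\<Sum>j\<in>{1..n}. \<Sum>v | v \<in> {1..n} \<and> j \<in> ancestors n x v. z {v} * bar_chain n x j \<sigma>)"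
    by (rule sum.swap_restrict) auto
  also have "\<dots> = (\<Sum>j\<in>{1..n}. coordinate n x j z * bar_chain n x j \<sigma>)"
    by (simp only: coordinate_def sum_distrib_right)
  finally show "z \<sigma> = (\<Sum>j\<in>{1..n}. coordinate n x j z * bar_chain n x j \<sigma>)" .
qed

lemma vertex_chain_closed:
  assumes "v \<in> {1..n}" "x v \<le> t"
  shows "vertex_chain v \<in> carrier (chain_group (sublevel_complex n x t) 0)"
  using assms sublevel_complex_vertex[of v n x t]
  by (auto simp: chain_group_simps(1) vertex_chain_def)

lemma bar_chain_closed:
  assumes "i \<in> {1..n}" "x i \<le> t"
  shows "bar_chain n x i \<in> carrier (chain_group (sublevel_complex n x t) 0)"
proof (cases "elders n x i = {}")
  case True
  then show ?thesis using vertex_chain_closed[of i n x t, OF assms] by (simp add: bar_chain_def)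
next
  case False
  interpret comm_group "chain_group (sublevel_complex n x t) 0" by (rule comm_group_chain_group)
  have "x (parent n x i) \<le> t" using elder_le[OF parent_elder[OF False]] assms(2) by simp
  then have "vertex_chain (parent n x i) \<in> carrier (chain_group (sublevel_complex n x t) 0)"
    using vertex_chain_closed elder_in[OF parent_elder[OF False]] by blast
  from m_closed[OF vertex_chain_closed[of i n x t, OF assms] this] show ?thesis
    using False by (simp only: bar_chain_def chain_group_simps(2) if_False)
qed

lemma bar_chain_dead_boundary:
  assumes "i \<in> {1..n}" "death n x i \<le> ereal t"
  shows "bar_chain n x i \<in> boundaries (sublevel_complex n x t) 0"
  using joined_boundary[OF assms(1) elder_in[OF death_leD(2)[OF assms(2)]] death_leD(3)[OF assms(2)]]
    death_leD(1)[OF assms(2)]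
  by (simp only: bar_chain_def if_False)

lemma coordinate_zero_if_late:
  assumes z: "z \<in> carrier (chain_group (sublevel_complex n x t) 0)" and "t < x i"
  shows "coordinate n x i z = 0"
  unfolding coordinate_def
proof (intro sum.neutral ballI)
  fix v assume v: "v \<in> {v. v \<in> {1..n} \<and> i \<in> ancestors n x v}"
  show "z {v} = 0"
  proof (rule ccontr)
    assume "z {v} \<noteq> 0"
    then obtain u where "{v} = {u}" "x u \<le> t" by (rule chain_0_support[OF z])
    then have "x v \<le> t" by simp
    moreover have "x i \<le> x v" using v ancestor_le by blast
    ultimately show False using assms(2) by linarith
  qed
qed

text \<open>Each edge contributes the same coefficient at both of its ends, and both or none of the ends
descend from \<open>i\<close> as long as \<open>i\<close> is alive; over the field with two elements the contributions cancel.\<close>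

lemma coordinate_boundary:
  assumes b: "b \<in> boundaries (sublevel_complex n x t) 0" and alive: "ereal t < death n x i"
  shows "coordinate n x i b = 0"
proof -
  obtain c where c: "c \<in> carrier (chain_group (sublevel_complex n x t) (Suc 0))" "b = boundary_map c"
    using b unfolding boundaries_def by blast
  define S where "S = {\<sigma>. c \<sigma> \<noteq> 0}"
  have S: "finite S" "{\<sigma>. c \<sigma> \<noteq> 0} \<subseteq> S" "\<And>\<sigma>. \<sigma> \<in> S \<Longrightarrow> \<sigma> \<in> sublevel_complex n x t \<and> card \<sigma> = Suc (Suc 0)"
    using c(1) unfolding chain_group_simps(1) S_def by auto
  define D where "D = {v. v \<in> {1..n} \<and> i \<in> ancestors n x v}"
  have "coordinate n x i b = (\<Sum>v\<in>D. \<Sum>\<sigma> | \<sigma> \<in> S \<and> v \<in> \<sigma>. c \<sigma>)"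
    unfolding coordinate_def D_def[symmetric] c(2)
    by (rule sum.cong[OF refl], rule boundary_map_vertex[OF c(1) S(1,2)]) (use S(3) in blast)
  also have "\<dots> = (\<Sum>\<sigma>\<in>S. \<Sum>v | v \<in> D \<and> v \<in> \<sigma>. c \<sigma>)"
    by (rule sum.swap_restrict) (simp_all add: S(1) D_def)
  also have "\<dots> = 0"
  proof (rule sum.neutral, rule ballI)
    fix \<sigma> assume "\<sigma> \<in> S"
    obtain k where k: "\<sigma> = {k, Suc k}" "k \<in> {1..n}" "Suc k \<in> {1..n}" "pass_height x k (Suc k) \<le> t"
      using S(3)[OF \<open>\<sigma> \<in> S\<close>] sublevel_complex_card_2 by blast
    have "k \<in> D \<longleftrightarrow> Suc k \<in> D"
      using ancestors_joined[OF k(2-4) alive] k(2,3) by (simp add: D_def)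
    then have "{v. v \<in> D \<and> v \<in> \<sigma>} = {} \<or> {v. v \<in> D \<and> v \<in> \<sigma>} = {k, Suc k}"
      unfolding k(1) by blast
    then show "(\<Sum>v | v \<in> D \<and> v \<in> \<sigma>. c \<sigma>) = 0"
    proof (elim disjE)
      assume "{v. v \<in> D \<and> v \<in> \<sigma>} = {k, Suc k}"
      then have "(\<Sum>v | v \<in> D \<and> v \<in> \<sigma>. c \<sigma>) = (\<Sum>v\<in>{k, Suc k}. c \<sigma>)" by (simp only:)
      also have "\<dots> = c \<sigma> + c \<sigma>" by (subst sum.insert) auto
      finally show "(\<Sum>v | v \<in> D \<and> v \<in> \<sigma>. c \<sigma>) = 0" by (simp only: bit_add_self)
    qed (simp only: sum.empty)
  qed
  finally show ?thesis .
qed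

definition alive_at :: "ereal \<times> ereal \<Rightarrow> real \<Rightarrow> bool" where
  "alive_at bd t \<longleftrightarrow> fst bd \<le> ereal t \<and> ereal t < snd bd"

definition bar_index :: "(ereal \<times> ereal) multiset \<Rightarrow> ((ereal \<times> ereal) \<times> nat) set" where
  "bar_index D = {(bd, j). j < count D bd}"

lemma finite_bar_index [simp]: "finite (bar_index D)"
proof -
  have "bar_index D = (SIGMA bd:set_mset D. {..<count D bd})"
    by (auto simp: bar_index_def) (metis count_inI not_less_zero)
  then show ?thesis by simp
qed

lemma group_interval_module: "group (space_at (interval_module bd) t)"
  by (rule groupI)
    (auto simp: interval_module_def Let_def add.assoc intro: exI[where P = "\<lambda>y. y + x = 0" and x = x for x])

lemma space_at_interval_sum:
  "space_at (interval_sum D) t = sum_group (bar_index D) (\<lambda>i. space_at (interval_module (fst i)) t)"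
  by (simp add: interval_sum_def pm_direct_sum_def bar_index_def case_prod_unfold)

lemma carrier_interval_sum:
  "carrier (space_at (interval_sum D) t)
     = (\<Pi>\<^sub>E i\<in>bar_index D. if alive_at (fst i) t then UNIV else {0})"
proof -
  have "carrier (space_at (interval_module bd) t) = (if alive_at bd t then UNIV else {0})" for bd
    by (simp add: interval_module_def alive_at_def Let_def)
  then show ?thesis
    unfolding space_at_interval_sum
    by (subst carrier_sum_group[OF group_interval_module]) simp
qed

lemma mult_interval_sum:
  "y \<otimes>\<^bsub>space_at (interval_sum D) t\<^esub> y' = (\<lambda>i\<in>bar_index D. y i + y' i)"
  unfolding space_at_interval_sum mult_sum_group
  by (simp add: interval_module_def Let_def)

lemma one_interval_sum: "\<one>\<^bsub>space_at (interval_sum D) t\<^esub> = (\<lambda>i\<in>bar_index D. 0)"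
  unfolding space_at_interval_sum one_sum_group
  by (simp add: interval_module_def Let_def)

lemma group_interval_sum: "group (space_at (interval_sum D) t)"
  unfolding space_at_interval_sum by (rule sum_group[OF group_interval_module])

lemma transition_interval_sum:
  "transition (interval_sum D) s t y
     = (\<lambda>i\<in>bar_index D. if alive_at (fst i) s \<and> alive_at (fst i) t then y i else 0)"
  by (auto simp: interval_sum_def pm_direct_sum_def bar_index_def interval_module_def alive_at_def
      Let_def fun_eq_iff case_prod_unfold)

text \<open>The summands of an interval sum are indexed by a bar and a copy number, while the natural index set
is a set of vertices; this lemma provides the relabelling.\<close>

lemma bar_index_image_mset:
  assumes "finite A"
  shows "\<exists>\<phi>. bij_betw \<phi> (bar_index (image_mset f (mset_set A))) A
    \<and> (\<forall>i\<in>bar_index (image_mset f (mset_set A)). f (\<phi> i) = fst i)"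
proof -
  define D where "D = image_mset f (mset_set A)"
  define F where "F p = {a\<in>A. f a = p}" for p
  have cnt: "count D p = card (F p)" for p
    using assms by (simp add: D_def F_def count_image_mset vimage_def Int_def conj_commute)
  have "\<exists>g. bij_betw g {0..<card (F p)} (F p)" for p
    using assms by (intro ex_bij_betw_nat_finite) (simp add: F_def)
  then obtain g where g: "\<And>p. bij_betw (g p) {0..<card (F p)} (F p)" by metis
  define \<phi> where "\<phi> i = g (fst i) (snd i)" for i
  have F_img: "\<phi> i \<in> F (fst i)" if "i \<in> bar_index D" for i
    using that bij_betwE[OF g[of "fst i"]] by (auto simp: bar_index_def cnt \<phi>_def)
  have "inj_on \<phi> (bar_index D)"
  proof (rule inj_onI)
    fix i i' assume i: "i \<in> bar_index D" "i' \<in> bar_index D" "\<phi> i = \<phi> i'"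
    then have p: "fst i = fst i'" using F_img[OF i(1)] F_img[OF i(2)] by (simp add: F_def)
    have "snd i \<in> {0..<card (F (fst i))}" "snd i' \<in> {0..<card (F (fst i))}"
      using i(1,2) p by (auto simp: bar_index_def cnt)
    then have "snd i = snd i'"
      using i(3) p bij_betw_imp_inj_on[OF g[of "fst i"]] by (simp add: \<phi>_def inj_on_def)
    then show "i = i'" using p by (simp add: prod_eq_iff)
  qed
  moreover have "\<phi> ` bar_index D = A"
  proof (rule subset_antisym)
    show "\<phi> ` bar_index D \<subseteq> A" using F_img by (auto simp: F_def)
    show "A \<subseteq> \<phi> ` bar_index D"
    proof
      fix a assume "a \<in> A"
      then have "a \<in> F (f a)" by (simp add: F_def)
      then obtain j where j: "j < card (F (f a))" "g (f a) j = a"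
        using bij_betw_imp_surj_on[OF g[of "f a"]] by (metis atLeastLessThan_iff imageE)
      then show "a \<in> \<phi> ` bar_index D"
        by (intro image_eqI[of _ _ "(f a, j)"]) (auto simp: bar_index_def cnt \<phi>_def)
    qed
  qed
  ultimately have "bij_betw \<phi> (bar_index D) A" by (simp add: bij_betw_def)
  moreover have "f (\<phi> i) = fst i" if "i \<in> bar_index D" for i
    using F_img[OF that] by (simp add: F_def)
  ultimately show ?thesis unfolding D_def by blast
qed

text \<open>A vertex that is not a local minimum dies at the moment of its birth and contributes no bar.\<close>

definition bars :: "nat \<Rightarrow> (nat \<Rightarrow> real) \<Rightarrow> nat set" where
  "bars n x = {i \<in> {1..n}. ereal (x i) < death n x i}"

definition elder_diagram :: "nat \<Rightarrow> (nat \<Rightarrow> real) \<Rightarrow> (ereal \<times> ereal) multiset" where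
  "elder_diagram n x = image_mset (\<lambda>i. (ereal (x i), death n x i)) (mset_set (bars n x))"

lemma finite_bars [simp]: "finite (bars n x)"
  by (simp add: bars_def)

text \<open>The isomorphism sends a chain to those of its coordinates that are alive at level \<open>t\<close>. It is
surjective because the basis chains have coordinate vectors of weight one. A chain in the kernel is a
combination of basis chains of dead vertices, which are boundaries. The maps commute with inclusions because a
coordinate that is born after level \<open>s\<close> vanishes on chains of the complex at level \<open>s\<close>.\<close>

lemma pm_isomorphic_elder_diagram:
  "pm_isomorphic (homology_module 0 (sublevel_complex n x)) (interval_sum (elder_diagram n x))"
proof -
  let ?f = "\<lambda>i. (ereal (x i), death n x i)"
  let ?D = "elder_diagram n x"
  let ?I = "bar_index ?D"
  obtain \<phi> where \<phi>: "bij_betw \<phi> ?I (bars n x)" "\<And>i. i \<in> ?I \<Longrightarrow> ?f (\<phi> i) = fst i"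
    using bar_index_image_mset[OF finite_bars, of ?f n x] unfolding elder_diagram_def by blast
  have alive: "alive_at (fst i) t \<longleftrightarrow> x (\<phi> i) \<le> t \<and> ereal t < death n x (\<phi> i)" if "i \<in> ?I" for i t
    using \<phi>(2)[OF that] by (simp add: alive_at_def flip: \<phi>(2)[OF that])
  have \<phi>_in: "\<phi> i \<in> {1..n}" if "i \<in> ?I" for i
    using bij_betwE[OF \<phi>(1)] that by (auto simp: bars_def)
  define g where "g t z = (\<lambda>i\<in>?I. if alive_at (fst i) t then coordinate n x (\<phi> i) z else 0)" for t z
  show ?thesis
  proof (rule pm_isomorphic_homology_0I[where g = g])
    show "sublevel_complex n x s \<subseteq> sublevel_complex n x t" if "s \<le> t" for s t
      by (rule sublevel_complex_mono[OF that])
    show "group (space_at (interval_sum ?D) t)" for t by (rule group_interval_sum)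
    show "boundaries (sublevel_complex n x t) 0 \<subseteq> carrier (chain_group (sublevel_complex n x t) 0)" for t
      by (rule boundaries_0_subset)
    show "g t \<in> hom (chain_group (sublevel_complex n x t) 0) (space_at (interval_sum ?D) t)" for t
    proof (rule homI)
      fix z show "g t z \<in> carrier (space_at (interval_sum ?D) t)"
        unfolding carrier_interval_sum by (auto simp: g_def)
    next
      fix z z'
      show "g t (z \<otimes>\<^bsub>chain_group (sublevel_complex n x t) 0\<^esub> z')
        = g t z \<otimes>\<^bsub>space_at (interval_sum ?D) t\<^esub> g t z'"
        unfolding chain_group_simps(2) mult_interval_sum
        by (rule ext) (simp add: g_def coordinate_add)
    qed
    show "\<exists>z\<in>carrier (chain_group (sublevel_complex n x t) 0). g t z = y"
      if y: "y \<in> carrier (space_at (interval_sum ?D) t)" for t y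
    proof -
      define A where "A = {v \<in> bars n x. x v \<le> t \<and> ereal t < death n x v}"
      define b where "b v = y (inv_into ?I \<phi> v)" for v
      define z where "z = (\<lambda>\<sigma>. \<Sum>v\<in>A. b v * bar_chain n x v \<sigma>)"
      have A: "finite A" "\<And>v. v \<in> A \<Longrightarrow> v \<in> {1..n} \<and> x v \<le> t"
        by (auto simp: A_def bars_def)
      have zc: "z \<in> carrier (chain_group (sublevel_complex n x t) 0)"
        unfolding z_def using A bar_chain_closed by (intro lincomb_chain_closed) blast+
      have coord: "coordinate n x j z = (if j \<in> A then b j else 0)" for j
      proof -
        have "coordinate n x j z = (\<Sum>v\<in>A. b v * coordinate n x j (bar_chain n x v))"
          unfolding z_def by (rule coordinate_lincomb)
        also have "\<dots> = (\<Sum>v\<in>A. if v = j then b j else 0)"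
          using A(2) by (intro sum.cong) (auto simp: coordinate_bar_chain)
        finally show ?thesis using A(1) by simp
      qed
      have "g t z = y"
      proof
        fix i
        show "g t z i = y i"
        proof (cases "i \<in> ?I")
          case True
          then have "b (\<phi> i) = y i"
            unfolding b_def using bij_betw_inv_into_left[OF \<phi>(1) True] by simp
          moreover have "alive_at (fst i) t \<longleftrightarrow> \<phi> i \<in> A"
            using alive[OF True] bij_betwE[OF \<phi>(1)] True by (auto simp: A_def)
          moreover have "\<not> alive_at (fst i) t \<Longrightarrow> y i = 0"
            using PiE_mem[OF y[unfolded carrier_interval_sum] True] by simp
          ultimately show ?thesis using True by (simp add: g_def coord)
        next
          case False
          then show ?thesis
            using PiE_arb[OF y[unfolded carrier_interval_sum] False] by (simp add: g_def)
        qed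
      qed
      then show ?thesis using zc by blast
    qed
    show "g t z = \<one>\<^bsub>space_at (interval_sum ?D) t\<^esub> \<longleftrightarrow> z \<in> boundaries (sublevel_complex n x t) 0"
      if z: "z \<in> carrier (chain_group (sublevel_complex n x t) 0)" for t z
    proof
      assume b: "z \<in> boundaries (sublevel_complex n x t) 0"
      have "(if alive_at (fst i) t then coordinate n x (\<phi> i) z else 0) = 0" if "i \<in> ?I" for i
        using coordinate_boundary[OF b] alive[OF that] by simp
      then show "g t z = \<one>\<^bsub>space_at (interval_sum ?D) t\<^esub>"
        unfolding g_def one_interval_sum by (intro restrict_ext)
    next
      assume one: "g t z = \<one>\<^bsub>space_at (interval_sum ?D) t\<^esub>"
      have coord: "coordinate n x j z = 0" if j: "x j \<le> t" "ereal t < death n x j" "j \<in> {1..n}" for j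
      proof -
        have "ereal (x j) < death n x j" using j by (meson ereal_less_eq(3) le_less_trans)
        then have "j \<in> bars n x" using j by (simp add: bars_def)
        then obtain i where i: "i \<in> ?I" "j = \<phi> i" using bij_betw_imp_surj_on[OF \<phi>(1)] by blast
        have "g t z i = 0" using one i(1) unfolding one_interval_sum by simp
        then show ?thesis using i j alive[OF i(1)] by (simp add: g_def)
      qed
      have "(\<lambda>\<sigma>. \<Sum>j\<in>{1..n}. coordinate n x j z * bar_chain n x j \<sigma>) \<in> boundaries (sublevel_complex n x t) 0"
      proof (rule boundaries_sum)
        fix j assume j: "j \<in> {1..n}"
        show "(\<lambda>\<sigma>. coordinate n x j z * bar_chain n x j \<sigma>) \<in> boundaries (sublevel_complex n x t) 0"
        proof (cases "coordinate n x j z = 0")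
          case True
          then show ?thesis using boundaries_zero by (simp only: mult_zero_left)
        next
          case False
          then have one: "coordinate n x j z = 1" by (cases "coordinate n x j z") simp_all
          have "x j \<le> t" using False coordinate_zero_if_late[OF z, of j] by (meson not_le)
          then have "death n x j \<le> ereal t" using coord[OF _ _ j] False by (meson not_le)
          then show ?thesis using bar_chain_dead_boundary[OF j] by (simp only: one mult_1_left)
        qed
      qed simp
      then show "z \<in> boundaries (sublevel_complex n x t) 0"
        using chain_eq_sum_bars[OF z] by (simp only: flip: chain_eq_sum_bars[OF z])
    qed
    show "g t z = transition (interval_sum ?D) s t (g s z)"
      if st: "s \<le> t" and z: "z \<in> carrier (chain_group (sublevel_complex n x s) 0)" for s t z
    proof -
      have "(if alive_at (fst i) t then coordinate n x (\<phi> i) z else 0)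
        = (if alive_at (fst i) s \<and> alive_at (fst i) t
            then (\<lambda>i\<in>?I. if alive_at (fst i) s then coordinate n x (\<phi> i) z else 0) i else 0)"
        if i: "i \<in> ?I" for i
      proof (cases "alive_at (fst i) t \<and> \<not> alive_at (fst i) s")
        case True
        then have "ereal t < death n x (\<phi> i)" using alive[OF i] by blast
        then have "ereal s < death n x (\<phi> i)" using st by (meson ereal_less_eq(3) le_less_trans)
        then have "s < x (\<phi> i)" using True alive[OF i, of s] by (meson not_le)
        then have "coordinate n x (\<phi> i) z = 0" by (rule coordinate_zero_if_late[OF z])
        then show ?thesis using True by simp
      next
        case False
        then show ?thesis using i by auto
      qed
      then show ?thesis
        unfolding transition_interval_sum g_def by (intro restrict_ext)
    qed
  qed
qed

section \<open>Uniqueness of the diagram\<close>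

text \<open>Cardinalities of images serve as ranks: the image is a power of the field with two elements,
with one factor for each bar that contains both \<open>s\<close> and \<open>t\<close>.\<close>

lemma card_transition_interval_sum:
  assumes "s \<le> t"
  shows "card (transition (interval_sum D) s t ` carrier (space_at (interval_sum D) s))
     = 2 ^ size {#bd \<in># D. fst bd \<le> ereal s \<and> ereal t < snd bd#}"
proof -
  let ?P = "\<lambda>bd. alive_at bd s \<and> alive_at bd t"
  have img: "transition (interval_sum D) s t ` carrier (space_at (interval_sum D) s)
     = (\<Pi>\<^sub>E i\<in>bar_index D. if ?P (fst i) then UNIV else {0})" (is "?L = ?R")
  proof (rule subset_antisym)
    show "?L \<subseteq> ?R" by (auto simp: transition_interval_sum)
    show "?R \<subseteq> ?L"
    proof
      fix y assume y: "y \<in> ?R"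
      have "y \<in> carrier (space_at (interval_sum D) s)"
        unfolding carrier_interval_sum by (rule subsetD[OF PiE_mono y]) auto
      moreover have "transition (interval_sum D) s t y = y"
        unfolding transition_interval_sum
        by (rule ext) (use y in \<open>auto simp: PiE_iff extensional_def split: if_splits\<close>)
      ultimately show "y \<in> ?L" by (metis imageI)
    qed
  qed
  have "card ?R = (\<Prod>i\<in>bar_index D. card (if ?P (fst i) then UNIV else {0::bit}))"
    by (rule card_PiE) simp
  also have "\<dots> = (\<Prod>i\<in>bar_index D. if ?P (fst i) then 2 else 1)"
  proof (rule prod.cong[OF refl])
    have "(UNIV::bit set) = {0, 1}" using bit_not_zero_iff by blast
    then have "card (UNIV::bit set) = card {0, 1::bit}" by (rule arg_cong)
    also have "\<dots> = 2" by (simp add: card_insert_if)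
    finally have "card (UNIV::bit set) = 2" .
    then show "card (if ?P (fst i) then UNIV else {0::bit}) = (if ?P (fst i) then 2 else 1)" for i :: "(ereal \<times> ereal) \<times> nat"
      by simp
  qed
  also have "\<dots> = 2 ^ card {i \<in> bar_index D. ?P (fst i)}"
    by (simp add: prod.If_cases Int_def)
  also have "card {i \<in> bar_index D. ?P (fst i)} = size {#bd \<in># D. ?P bd#}"
  proof -
    have "{i \<in> bar_index D. ?P (fst i)} = (SIGMA bd:set_mset {#bd \<in># D. ?P bd#}. {..<count D bd})"
      by (auto simp: bar_index_def) (metis count_inI not_less_zero)
    then have "card {i \<in> bar_index D. ?P (fst i)} = (\<Sum>bd\<in>set_mset {#bd \<in># D. ?P bd#}. count D bd)"
      by simp
    also have "\<dots> = (\<Sum>bd\<in>set_mset {#bd \<in># D. ?P bd#}. count {#bd \<in># D. ?P bd#} bd)"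
      by (intro sum.cong) auto
    finally show ?thesis by (simp add: size_multiset_overloaded_eq)
  qed
  also have "{#bd \<in># D. ?P bd#} = {#bd \<in># D. fst bd \<le> ereal s \<and> ereal t < snd bd#}"
  proof (rule filter_mset_cong[OF refl])
    fix bd
    have "ereal s \<le> ereal t" using assms by simp
    then show "?P bd \<longleftrightarrow> fst bd \<le> ereal s \<and> ereal t < snd bd"
      unfolding alive_at_def by (meson le_less_trans order_trans)
  qed
  finally show ?thesis unfolding img .
qed

lemma interval_sums_same_rank:
  assumes iso: "pm_isomorphic P (interval_sum D)" "pm_isomorphic P (interval_sum D')"
    and closed: "\<And>y. y \<in> carrier (space_at P s) \<Longrightarrow> transition P s t y \<in> carrier (space_at P t)"
    and st: "s \<le> t"
  shows "size {#bd \<in># D. fst bd \<le> ereal s \<and> ereal t < snd bd#}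
    = size {#bd \<in># D'. fst bd \<le> ereal s \<and> ereal t < snd bd#}"
proof -
  have rank: "card (transition (interval_sum E) s t ` carrier (space_at (interval_sum E) s))
      = card (transition P s t ` carrier (space_at P s))" if isoE: "pm_isomorphic P (interval_sum E)" for E
  proof -
    obtain h where "(\<forall>t. h t \<in> iso (space_at P t) (space_at (interval_sum E) t)) \<and>
          (\<forall>s t. s \<le> t \<longrightarrow> (\<forall>y \<in> carrier (space_at P s).
             h t (transition P s t y) = transition (interval_sum E) s t (h s y)))"
      using isoE[unfolded pm_isomorphic_def] by (rule exE)
    then have h: "\<And>t. h t \<in> iso (space_at P t) (space_at (interval_sum E) t)"
      "\<And>s t y. s \<le> t \<Longrightarrow> y \<in> carrier (space_at P s) \<Longrightarrow>
        h t (transition P s t y) = transition (interval_sum E) s t (h s y)"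
      by blast+
    have bij: "bij_betw (h u) (carrier (space_at P u)) (carrier (space_at (interval_sum E) u))" for u
      using h(1)[of u] by (simp add: iso_def)
    have "transition (interval_sum E) s t ` carrier (space_at (interval_sum E) s)
        = transition (interval_sum E) s t ` h s ` carrier (space_at P s)"
      using bij_betw_imp_surj_on[OF bij] by simp
    also have "\<dots> = h t ` transition P s t ` carrier (space_at P s)"
      unfolding image_image by (rule image_cong[OF refl]) (simp add: h(2)[OF st])
    finally have eq: "transition (interval_sum E) s t ` carrier (space_at (interval_sum E) s)
        = h t ` transition P s t ` carrier (space_at P s)" .
    have "inj_on (h t) (transition P s t ` carrier (space_at P s))"
      by (rule inj_on_subset[OF bij_betw_imp_inj_on[OF bij]]) (use closed in blast)
    then show ?thesis unfolding eq by (rule card_image)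
  qed
  have "(2::nat) ^ size {#bd \<in># D. fst bd \<le> ereal s \<and> ereal t < snd bd#}
      = 2 ^ size {#bd \<in># D'. fst bd \<le> ereal s \<and> ereal t < snd bd#}"
    using rank[OF iso(1)] rank[OF iso(2)] by (simp add: card_transition_interval_sum[OF st])
  then show ?thesis by simp
qed

text \<open>Take \<open>s\<close> to be the birth of the bar and \<open>t\<close> below its death but not below any smaller death that occurs.
Because the bar has the earliest birth, and the latest death for this birth, it is the only bar counted at
\<open>(s, t)\<close>, so the two counts differ.\<close>

lemma no_unmatched_extreme_bar:
  assumes D: "set_mset D \<subseteq> Delta" "set_mset D' \<subseteq> Delta" and disj: "D \<inter># D' = {#}"
    and rank: "\<And>s t. s \<le> t \<Longrightarrow> size {#bd \<in># D. fst bd \<le> ereal s \<and> ereal t < snd bd#}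
    = size {#bd \<in># D'. fst bd \<le> ereal s \<and> ereal t < snd bd#}"
    and bd: "bd \<in># D"
    and min_birth: "\<And>p. p \<in># D + D' \<Longrightarrow> fst bd \<le> fst p"
    and max_death: "\<And>p. p \<in># D + D' \<Longrightarrow> fst p = fst bd \<Longrightarrow> snd p \<le> snd bd"
  shows False
proof -
  obtain b d where bd_eq: "bd = (b, d)" by (cases bd)
  have "- \<infinity> < b" "b < d" using bd D(1) by (auto simp: bd_eq Delta_def)
  then obtain s where s: "b = ereal s" by (cases b) auto
  define T where "T = insert b (snd ` {p \<in> set_mset (D + D'). snd p < d})"
  have "finite T" by (simp add: T_def)
  then have "Max T < d" "b \<le> Max T" using \<open>b < d\<close> by (auto simp: T_def)
  then obtain t where t: "Max T = ereal t" using s by (cases "Max T") auto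
  have st: "s \<le> t" and td: "ereal t < d" using \<open>b \<le> Max T\<close> \<open>Max T < d\<close> s t by auto
  have only: "p = bd" if p: "p \<in># D + D'" "fst p \<le> ereal s" "ereal t < snd p" for p
  proof -
    have "fst p = b" using min_birth[OF p(1)] p(2) s by (simp add: bd_eq)
    then have "snd p \<le> d" using max_death[OF p(1)] by (simp add: bd_eq)
    moreover have "\<not> snd p < d"
    proof
      assume "snd p < d"
      then have "snd p \<in> T" using p(1) by (auto simp: T_def)
      then have "snd p \<le> Max T" using \<open>finite T\<close> by (rule Max_ge[rotated])
      then show False using p(3) t by simp
    qed
    ultimately show ?thesis using \<open>fst p = b\<close> by (simp add: bd_eq prod_eq_iff)
  qed
  have "bd \<notin># D'"
  proof
    assume "bd \<in># D'"
    then have "bd \<in># D \<inter># D'" using bd by simp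
    then show False using disj by simp
  qed
  then have "\<not> (fst p \<le> ereal s \<and> ereal t < snd p)" if "p \<in># D'" for p
    using only[of p] that by auto
  then have "{#p \<in># D'. fst p \<le> ereal s \<and> ereal t < snd p#} = {#}"
    unfolding filter_mset_eq_mempty_iff by blast
  then have "size {#p \<in># D. fst p \<le> ereal s \<and> ereal t < snd p#} = size ({#} :: (ereal \<times> ereal) multiset)"
    by (intro trans[OF rank[OF st]] arg_cong[where f = size])
  then have "{#p \<in># D. fst p \<le> ereal s \<and> ereal t < snd p#} = {#}"
    by (metis Multiset.size_empty Multiset.size_eq_0_iff_empty)
  moreover have "bd \<in># {#p \<in># D. fst p \<le> ereal s \<and> ereal t < snd p#}"
    using bd td by (simp add: bd_eq s)
  ultimately show False by (simp only: set_mset_empty empty_iff)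
qed

text \<open>After removal of the common part the ranks still agree, and the bar with the earliest birth and
then the latest death lies in one of the two remainders only.\<close>

lemma multiset_eq_if_same_ranks:
  assumes D: "set_mset D \<subseteq> Delta" "set_mset D' \<subseteq> Delta"
    and rank: "\<And>s t. s \<le> t \<Longrightarrow> size {#bd \<in># D. fst bd \<le> ereal s \<and> ereal t < snd bd#}
    = size {#bd \<in># D'. fst bd \<le> ereal s \<and> ereal t < snd bd#}"
  shows "D = D'"
proof (rule ccontr)
  assume ne: "D \<noteq> D'"
  define E where "E = D - D'"
  define E' where "E' = D' - D"
  have sub: "set_mset E \<subseteq> Delta" "set_mset E' \<subseteq> Delta"
    using D in_diffD by (fastforce simp: E_def E'_def)+
  have disj: "E \<inter># E' = {#}" "E' \<inter># E = {#}"
    by (auto simp: E_def E'_def multiset_eq_iff)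
  have DE: "D = (D \<inter># D') + E" "D' = (D \<inter># D') + E'"
    by (auto simp: E_def E'_def multiset_eq_iff)
  have rankE: "size {#bd \<in># E. fst bd \<le> ereal s \<and> ereal t < snd bd#}
    = size {#bd \<in># E'. fst bd \<le> ereal s \<and> ereal t < snd bd#}" if "s \<le> t" for s t
  proof -
    let ?F = "\<lambda>C. size {#bd \<in># C. fst bd \<le> ereal s \<and> ereal t < snd bd#}"
    have "?F D = ?F (D \<inter># D') + ?F E" using DE(1) by (metis filter_union_mset size_union)
    moreover have "?F D' = ?F (D \<inter># D') + ?F E'" using DE(2) by (metis filter_union_mset size_union)
    ultimately show ?thesis using rank[OF that] by linarith
  qed
  define B where "B = set_mset (E + E')"
  have "B \<noteq> {}" using ne DE by (auto simp: B_def)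
  define b where "b = Min (fst ` B)"
  define d where "d = Max (snd ` {p \<in> B. fst p = b})"
  have fin: "finite B" by (simp add: B_def)
  have "b \<in> fst ` B" unfolding b_def using fin \<open>B \<noteq> {}\<close> by (intro Min_in) auto
  then have "snd ` {p \<in> B. fst p = b} \<noteq> {}" by auto
  then have "d \<in> snd ` {p \<in> B. fst p = b}" unfolding d_def using fin by (intro Max_in) auto
  then have bd: "(b, d) \<in> B" by auto
  have minb: "fst (b, d) \<le> fst p" if "p \<in> B" for p
    using that fin by (simp add: b_def)
  have maxd: "snd p \<le> snd (b, d)" if "p \<in> B" "fst p = fst (b, d)" for p
    unfolding d_def snd_conv using that fin by (intro Max_ge) auto
  from bd consider "(b, d) \<in># E" | "(b, d) \<in># E'" by (auto simp: B_def)
  then show False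
  proof cases
    case 1
    show False
      by (rule no_unmatched_extreme_bar[OF sub disj(1) rankE 1])
        (use minb maxd in \<open>auto simp: B_def\<close>)
  next
    case 2
    show False
      by (rule no_unmatched_extreme_bar[OF sub(2,1) disj(2) rankE[symmetric] 2])
        (use minb maxd in \<open>auto simp: B_def\<close>)
  qed
qed

lemma elder_diagram_subset: "set_mset (elder_diagram n x) \<subseteq> Delta"
  by (auto simp: elder_diagram_def Delta_def bars_def)

theorem PD0_eq_elder_diagram: "PD0 n x = elder_diagram n x"
proof -
  let ?P = "homology_module 0 (sublevel_complex n x)"
  have closed: "transition ?P s t C \<in> carrier (space_at ?P t)"
    if st: "s \<le> t" and C: "C \<in> carrier (space_at ?P s)" for s t C
  proof -
    let ?K = "sublevel_complex n x"
    obtain z where z: "z \<in> carrier (chain_group (?K s) 0)"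
      "C = boundaries (?K s) 0 #>\<^bsub>chain_group (?K s) 0\<^esub> z"
      using C by (auto simp: homology_module_def carrier_homology_0)
    have "z \<in> carrier (chain_group (?K t) 0)"
      by (rule chain_group_mono[OF sublevel_complex_mono[OF st] z(1)])
    then show ?thesis
      by (simp add: homology_module_def z(2) homology_inclusion_coset[OF sublevel_complex_mono[OF st]]
        carrier_homology_0)
  qed
  have iso: "pm_isomorphic ?P (interval_sum (elder_diagram n x))"
    by (rule pm_isomorphic_elder_diagram)
  have "persistence_diagram ?P = elder_diagram n x"
    unfolding persistence_diagram_def is_persistence_diagram_def
  proof (rule the_equality)
    show "set_mset (elder_diagram n x) \<subseteq> Delta \<and> pm_isomorphic ?P (interval_sum (elder_diagram n x))"
      using iso elder_diagram_subset by blast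
    fix D assume D: "set_mset D \<subseteq> Delta \<and> pm_isomorphic ?P (interval_sum D)"
    show "D = elder_diagram n x"
    proof (rule multiset_eq_if_same_ranks)
      show "set_mset D \<subseteq> Delta" using D by blast
      show "set_mset (elder_diagram n x) \<subseteq> Delta" by (rule elder_diagram_subset)
      show "size {#bd \<in># D. fst bd \<le> ereal s \<and> ereal t < snd bd#}
        = size {#bd \<in># elder_diagram n x. fst bd \<le> ereal s \<and> ereal t < snd bd#}" if "s \<le> t" for s t
        by (rule interval_sums_same_rank[OF conjunct2[OF D] iso closed[OF that] that])
    qed
  qed
  then show ?thesis by (simp add: PD0_def)
qed

section \<open>Persistent Betti numbers as counts of exits\<close>

definition persistent_betti :: "nat \<Rightarrow> (nat \<Rightarrow> real) \<Rightarrow> real \<Rightarrow> real \<Rightarrow> nat" where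
  "persistent_betti n x s t = size {#bd \<in># PD0 n x. fst bd \<le> ereal s \<and> ereal t < snd bd#}"

text \<open>Since \<open>s \<le> t\<close>, zero-length bars are never counted, so the restriction to genuine bars
can be dropped.\<close>

lemma persistent_betti_eq_card_alive:
  assumes "s \<le> t"
  shows "persistent_betti n x s t = card {i \<in> {1..n}. x i \<le> s \<and> ereal t < death n x i}"
proof -
  have "{i \<in> bars n x. x i \<le> s \<and> ereal t < death n x i} = {i \<in> {1..n}. x i \<le> s \<and> ereal t < death n x i}"
  proof -
    have "ereal (x i) < death n x i" if "x i \<le> s" "ereal t < death n x i" for i
    proof -
      have "ereal (x i) \<le> ereal t" using that assms by simp
      then show ?thesis using that(2) by (rule le_less_trans)
    qed
    then show ?thesis by (auto simp: bars_def)
  qed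
  then show ?thesis
    by (simp add: persistent_betti_def PD0_eq_elder_diagram elder_diagram_def filter_mset_image_mset
        filter_mset_mset_set)
qed

text \<open>A vertex of value at most \<open>s\<close> that is the last one of this kind in its component of the
sublevel set at \<open>t\<close>: before any later such vertex the path exceeds \<open>t\<close>.\<close>

definition last_low :: "nat \<Rightarrow> (nat \<Rightarrow> real) \<Rightarrow> real \<Rightarrow> real \<Rightarrow> nat \<Rightarrow> bool" where
  "last_low n x s t j \<longleftrightarrow> x j \<le> s \<and> (\<forall>r\<in>{j<..n}. x r \<le> s \<longrightarrow> (\<exists>k\<in>{j<..<r}. t < x k))"

text \<open>A component with a vertex of value at most \<open>s\<close> can be represented by its oldest vertex, which
is how the diagram counts it, or by its last vertex of value at most \<open>s\<close>, which is visible locally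
from the path. Passing from the latter to the former is a bijection.\<close>

lemma persistent_betti_eq_card_last_low:
  assumes st: "s \<le> t"
  shows "persistent_betti n x s t = card {j \<in> {1..n}. last_low n x s t j}"
proof -
  let ?A = "{i \<in> {1..n}. x i \<le> s \<and> ereal t < death n x i}"
  let ?B = "{j \<in> {1..n}. last_low n x s t j}"
  \<comment> \<open>The living, that is the oldest, vertex in the component of \<open>j\<close> at level \<open>t\<close>.\<close>
  define e where "e j = (SOME e. e \<in> {1..n} \<and> ereal t < death n x e \<and> pass_height x j e \<le> t)" for j
  have e: "e j \<in> {1..n} \<and> ereal t < death n x (e j) \<and> pass_height x j (e j) \<le> t"
    if "j \<in> {1..n}" "x j \<le> t" for j
    unfolding e_def by (rule someI_ex) (use alive_representative[of j n x t] that in blast)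
  have e_low: "x (e j) \<le> s" if j: "j \<in> {1..n}" "x j \<le> s" for j
  proof (rule ccontr)
    assume gt: "\<not> x (e j) \<le> s"
    have jt: "x j \<le> t" using j st by simp
    have "j \<in> elders n x (e j)" using j gt by (simp add: elders_def)
    then have "death n x (e j) \<le> ereal (pass_height x (e j) j)" by (rule death_le_elder)
    also have "\<dots> \<le> ereal t" using e[OF j(1) jt] by (simp add: pass_height_commute)
    finally show False using e[OF j(1) jt] by (meson leD)
  qed
  have apart: False
    if low: "last_low n x s t j" "j < r" "r \<le> n" "x r \<le> s" and pass: "pass_height x j r \<le> t" for j r
  proof -
    have "r \<in> {j<..n}" using low by simp
    then obtain k where k: "k \<in> {j<..<r}" "t < x k" using low unfolding last_low_def by blast
    then have "k \<in> {min j r..max j r}" by simp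
    then have "x k \<le> t" using pass unfolding pass_height_le_iff by blast
    then show False using k(2) by simp
  qed
  have "bij_betw e ?B ?A"
    unfolding bij_betw_def
  proof
    show "inj_on e ?B"
    proof (rule inj_onI)
      fix j j' assume jj: "j \<in> ?B" "j' \<in> ?B" "e j = e j'"
      then have low: "x j \<le> s" "x j' \<le> s" by (auto simp: last_low_def)
      have jn: "j \<in> {1..n}" "j' \<in> {1..n}" using jj(1,2) by blast+
      have lt: "x j \<le> t" "x j' \<le> t" using low st by simp_all
      have "pass_height x j (e j) \<le> t" using e[OF jn(1) lt(1)] by blast
      moreover have "pass_height x (e j) j' \<le> t"
        unfolding jj(3) using e[OF jn(2) lt(2)] pass_height_commute[of x "e j'" j'] by metis
      ultimately have 1: "pass_height x j j' \<le> t" by (rule pass_height_trans)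
      then have 2: "pass_height x j' j \<le> t" unfolding pass_height_commute[of x j' j] .
      show "j = j'"
      proof (cases j j' rule: linorder_cases)
        case less
        then show ?thesis using apart[of j j'] 1 jj low by simp
      next
        case greater
        then show ?thesis using apart[of j' j] 2 jj low by simp
      qed
    qed
    show "e ` ?B = ?A"
    proof (rule subset_antisym)
      show "e ` ?B \<subseteq> ?A"
      proof
        fix i assume "i \<in> e ` ?B"
        then obtain j where j: "j \<in> {1..n}" "last_low n x s t j" "i = e j" by blast
        then have "x j \<le> s" by (simp add: last_low_def)
        then show "i \<in> ?A" using e[OF j(1)] e_low[OF j(1)] st j(3) by simp
      qed
      show "?A \<subseteq> e ` ?B"
      proof
        fix i assume i: "i \<in> ?A"
        define C where "C = {j \<in> {1..n}. x j \<le> s \<and> pass_height x i j \<le> t}"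
        have "i \<in> C" "finite C" using i st by (auto simp: C_def)
        define j where "j = Max C"
        have j: "j \<in> C" unfolding j_def using \<open>i \<in> C\<close> \<open>finite C\<close> by (intro Max_in) auto
        have "last_low n x s t j"
          unfolding last_low_def
        proof (intro conjI ballI impI)
          show "x j \<le> s" using j by (simp add: C_def)
          fix r assume r: "r \<in> {j<..n}" "x r \<le> s"
          have "r \<notin> C" using r(1) Max_ge[OF \<open>finite C\<close>, of r] by (auto simp: j_def)
          then have "\<not> pass_height x i r \<le> t" using r j by (auto simp: C_def)
          then have "\<not> pass_height x j r \<le> t"
            using j pass_height_trans[of x i j t r] unfolding C_def by blast
          then obtain k where k: "k \<in> {min j r..max j r}" "t < x k"
            unfolding pass_height_le_iff by (auto simp: not_le)
          have "x j \<le> t" "x r \<le> t" using j r st by (auto simp: C_def)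
          then have "k \<noteq> j" "k \<noteq> r" using k by auto
          then show "\<exists>k\<in>{j<..<r}. t < x k" using k r by (intro bexI[of _ k]) auto
        qed
        then have jB: "j \<in> ?B" using j by (simp add: C_def)
        have ej: "e j \<in> {1..n} \<and> ereal t < death n x (e j) \<and> pass_height x j (e j) \<le> t"
          using j st by (intro e) (auto simp: C_def)
        have "pass_height x i (e j) \<le> t"
          using pass_height_trans[of x i j t "e j"] j ej unfolding C_def by blast
        then have "i = e j" using alive_joined_eq[of i n "e j" x t] i ej by blast
        then show "i \<in> e ` ?B" using jB by blast
      qed
    qed
  qed
  then show ?thesis
    unfolding persistent_betti_eq_card_alive[OF st] by (rule bij_betw_same_card[symmetric])
qed

lemma sum_mset_return_eq_size:
  assumes "A \<in> sets borel"
  shows "(\<Sum>p\<in>#D. emeasure (return borel p) A) = ennreal (real (size {#p \<in># D. p \<in> A#}))"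
proof (induction D)
  case (add p D)
  have "emeasure (return borel p) A = ennreal (if p \<in> A then 1 else 0)"
    using assms by (simp add: emeasure_return)
  then show ?case using add by (simp flip: ennreal_plus)
qed simp

lemma emeasure_dirac_sum:
  assumes A: "A \<in> sets borel"
  shows "emeasure (dirac_sum D) A = (\<Sum>p\<in>#D. emeasure (return borel p) A)"
proof (rule emeasure_measure_of[OF dirac_sum_def])
  show "countably_additive (sets (dirac_sum D)) (\<lambda>A. \<Sum>p\<in>#D. emeasure (return borel p) A)"
  proof (rule countably_additiveI)
    fix B :: "nat \<Rightarrow> (ereal \<times> ereal) set"
    assume B: "range B \<subseteq> sets (dirac_sum D)" "disjoint_family B"
    have "sets (dirac_sum D) = sets borel"
      unfolding dirac_sum_def using sets.sigma_sets_eq[of "borel :: (ereal \<times> ereal) measure"] by simp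
    then have B': "range B \<subseteq> sets (return borel p)" for p using B(1) by simp
    show "(\<Sum>i. \<Sum>p\<in>#D. emeasure (return borel p) (B i)) = (\<Sum>p\<in>#D. emeasure (return borel p) (\<Union> (range B)))"
    proof (induction D)
      case (add p D)
      have "(\<Sum>i. \<Sum>p\<in>#add_mset p D. emeasure (return borel p) (B i))
          = (\<Sum>i. emeasure (return borel p) (B i)) + (\<Sum>i. \<Sum>p\<in>#D. emeasure (return borel p) (B i))"
        by (simp add: suminf_add[OF summableI summableI, symmetric])
      also have "(\<Sum>i. emeasure (return borel p) (B i)) = emeasure (return borel p) (\<Union> (range B))"
        by (rule suminf_emeasure[OF B' B(2)])
      finally show ?case using add by simp
    qed simp
  qed
  show "A \<in> sets (dirac_sum D)"
    unfolding dirac_sum_def using A sets.sigma_sets_eq[of "borel :: (ereal \<times> ereal) measure"] by simp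
qed (simp_all add: positive_def image_mset_const_eq)

lemma sets_dirac_sum [simp]: "sets (dirac_sum D) = sets borel"
  unfolding dirac_sum_def using sets.sigma_sets_eq[of "borel :: (ereal \<times> ereal) measure"] by simp

lemma space_dirac_sum [simp]: "space (dirac_sum D) = UNIV"
  unfolding dirac_sum_def by (simp add: space_measure_of_conv)

lemma emeasure_dirac_sum_size:
  "A \<in> sets borel \<Longrightarrow> emeasure (dirac_sum D) A = ennreal (real (size {#p \<in># D. p \<in> A#}))"
  by (simp only: emeasure_dirac_sum sum_mset_return_eq_size)

lemma integral_dirac_sum_rectangles:
  assumes "\<And>l. l \<in> L \<Longrightarrow> R l \<in> sets borel" "finite L"
  shows "(\<integral>p. (\<Sum>l\<in>L. a l * indicator (R l) p) \<partial>dirac_sum D)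
    = (\<Sum>l\<in>L. a l * real (size {#p \<in># D. p \<in> R l#}))"
proof -
  have meas: "measure (dirac_sum D) (R l) = real (size {#p \<in># D. p \<in> R l#})" if "l \<in> L" for l
    using emeasure_dirac_sum_size[OF assms(1)[OF that]] by (simp add: measure_def)
  have int: "integrable (dirac_sum D) (\<lambda>p. a l * indicator (R l) p)" if "l \<in> L" for l
    using emeasure_dirac_sum_size[OF assms(1)[OF that], of D] assms(1)[OF that]
    by (intro integrable_mult_right integrable_real_indicator) (simp_all add: less_top)
  have "(\<integral>p. (\<Sum>l\<in>L. a l * indicator (R l) p) \<partial>dirac_sum D)
      = (\<Sum>l\<in>L. \<integral>p. a l * indicator (R l) p \<partial>dirac_sum D)"
    by (rule Bochner_Integration.integral_sum[OF int])
  also have "\<dots> = (\<Sum>l\<in>L. a l * real (size {#p \<in># D. p \<in> R l#}))"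
    by (rule sum.cong[OF refl]) (simp add: meas)
  finally show ?thesis .
qed

text \<open>Inclusion and exclusion over the corners; this is how the persistent Betti numbers determine
the measure of a rectangle above the diagonal.\<close>

lemma size_rectangle:
  fixes D :: "(ereal \<times> ereal) multiset"
  assumes "s1 \<le> s2" "t1 \<le> t2"
  shows "real (size {#p \<in># D. p \<in> {ereal s1<..ereal s2} \<times> {ereal t1<..ereal t2}#})
    = real (size {#p \<in># D. fst p \<le> ereal s2 \<and> ereal t1 < snd p#})
      - real (size {#p \<in># D. fst p \<le> ereal s2 \<and> ereal t2 < snd p#})
      - real (size {#p \<in># D. fst p \<le> ereal s1 \<and> ereal t1 < snd p#})
      + real (size {#p \<in># D. fst p \<le> ereal s1 \<and> ereal t2 < snd p#})"
proof (induction D)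
  case (add p D)
  define A where "A \<longleftrightarrow> fst p \<le> ereal s1"
  define B where "B \<longleftrightarrow> fst p \<le> ereal s2"
  define C where "C \<longleftrightarrow> ereal t1 < snd p"
  define E where "E \<longleftrightarrow> ereal t2 < snd p"
  have "A \<Longrightarrow> B" unfolding A_def B_def using assms(1) by (meson ereal_less_eq(3) order_trans)
  have "E \<Longrightarrow> C" unfolding E_def C_def using assms(2) by (meson ereal_less_eq(3) le_less_trans)
  have "p \<in> {ereal s1<..ereal s2} \<times> {ereal t1<..ereal t2} \<longleftrightarrow> B \<and> \<not> A \<and> C \<and> \<not> E"
    by (cases p) (auto simp: A_def B_def C_def E_def)
  then show ?case
    using add \<open>A \<Longrightarrow> B\<close> \<open>E \<Longrightarrow> C\<close>
    unfolding filter_mset_add_mset A_def[symmetric] B_def[symmetric] C_def[symmetric] E_def[symmetric]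
    by (cases A; cases B; cases C; cases E) simp_all
qed simp

lemma measurable_fst_snd_ereal [measurable]:
  "fst \<in> borel_measurable (borel :: (ereal \<times> ereal) measure)"
  "snd \<in> borel_measurable (borel :: (ereal \<times> ereal) measure)"
  by (rule borel_measurable_continuous_onI, rule continuous_on_fst[OF continuous_on_id],
      rule borel_measurable_continuous_onI, rule continuous_on_snd[OF continuous_on_id])

lemma rectangle_borel: "{s1<..s2} \<times> {t1<..t2} \<in> sets (borel :: (ereal \<times> ereal) measure)"
proof -
  have "{p \<in> space borel. s1 < fst p \<and> fst p \<le> s2 \<and> t1 < snd p \<and> snd p \<le> t2} \<in> sets (borel :: (ereal \<times> ereal) measure)"
    by measurable
  moreover have "{p \<in> space borel. s1 < fst p \<and> fst p \<le> s2 \<and> t1 < snd p \<and> snd p \<le> t2} = {s1<..s2} \<times> {t1<..t2}"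
    by auto
  ultimately show ?thesis by (simp only:)
qed

lemma Delta_finite_borel: "Delta_finite \<in> sets (borel :: (ereal \<times> ereal) measure)"
proof -
  have "{p \<in> space borel. -\<infinity> < fst p \<and> fst p < snd p \<and> snd p < \<infinity>} \<in> sets (borel :: (ereal \<times> ereal) measure)"
    by measurable
  moreover have "{p \<in> space borel. -\<infinity> < fst p \<and> fst p < snd p \<and> snd p < \<infinity>} = Delta_finite"
  proof (rule Set.set_eqI)
    fix p :: "ereal \<times> ereal"
    obtain x y where p: "p = (x, y)" by (cases p)
    show "p \<in> {p \<in> space borel. -\<infinity> < fst p \<and> fst p < snd p \<and> snd p < \<infinity>} \<longleftrightarrow> p \<in> Delta_finite"
      unfolding p by (cases x; cases y) (auto simp: Delta_finite_def Delta_def)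
  qed
  ultimately show ?thesis by (simp only:)
qed

lemma integral_xi0_finite:
  fixes f :: "ereal \<times> ereal \<Rightarrow> real"
  assumes "\<And>p. p \<notin> Delta_finite \<Longrightarrow> f p = 0"
  shows "(\<integral>p. f p \<partial>xi0_finite n x) = (\<integral>p. f p \<partial>xi0 n x)"
proof -
  have "(\<integral>p. f p \<partial>xi0_finite n x) = (\<integral>p. indicator Delta_finite p *\<^sub>R f p \<partial>xi0 n x)"
    unfolding xi0_finite_def
    by (rule integral_restrict_space) (simp add: xi0_def Delta_finite_borel)
  also have "(\<lambda>p. indicator Delta_finite p *\<^sub>R f p) = f"
  proof
    fix p show "indicator Delta_finite p *\<^sub>R f p = f p"
      using assms[of p] by (cases "p \<in> Delta_finite") simp_all
  qed
  finally show ?thesis .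
qed

text \<open>Exit above \<open>t\<close> exactly at step \<open>i\<close>: the path starts at most at \<open>s\<close> and stays in \<open>(s, t]\<close>
strictly between the start and the exit. For given \<open>y\<close> at most one \<open>i\<close> qualifies.\<close>

definition exit_ind :: "real \<Rightarrow> real \<Rightarrow> nat \<Rightarrow> (nat \<Rightarrow> real) \<Rightarrow> real" where
  "exit_ind s t i y = (if y 0 \<le> s \<and> (\<forall>k\<in>{1..<i}. s < y k \<and> y k \<le> t) \<and> t < y i then 1 else 0)"

lemma exit_ind_cases: "exit_ind s t i y = 0 \<or> exit_ind s t i y = 1"
  by (simp add: exit_ind_def)

lemma sum_exit_ind:
  assumes st: "s \<le> t"
  shows "(\<Sum>i\<in>{1..N}. exit_ind s t i y) = (if \<exists>i\<in>{1..N}. exit_ind s t i y = 1 then 1 else 0)"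
proof (cases "\<exists>i\<in>{1..N}. exit_ind s t i y = 1")
  case True
  then obtain i where i: "i \<in> {1..N}" "exit_ind s t i y = 1" by blast
  have other: "exit_ind s t i' y = 0" if i': "i' \<in> {1..N} - {i}" for i'
  proof (rule ccontr)
    assume "exit_ind s t i' y \<noteq> 0"
    then have A: "y 0 \<le> s" "\<forall>k\<in>{1..<i'}. s < y k \<and> y k \<le> t" "t < y i'"
      by (simp_all add: exit_ind_def split: if_splits)
    have B: "\<forall>k\<in>{1..<i}. s < y k \<and> y k \<le> t" "t < y i"
      using i(2) by (simp_all add: exit_ind_def split: if_splits)
    have "i \<in> {1..<i'} \<or> i' \<in> {1..<i}" using i(1) i' by auto
    then show False
    proof
      assume "i \<in> {1..<i'}"
      then have "y i \<le> t" using A(2) by blast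
      then show False using B(2) by linarith
    next
      assume "i' \<in> {1..<i}"
      then have "y i' \<le> t" using B(1) by blast
      then show False using A(3) by linarith
    qed
  qed
  have "(\<Sum>i\<in>{1..N}. exit_ind s t i y) = exit_ind s t i y + (\<Sum>i\<in>{1..N} - {i}. exit_ind s t i y)"
    by (rule sum.remove[OF _ i(1)]) simp
  also have "(\<Sum>i\<in>{1..N} - {i}. exit_ind s t i y) = 0" by (rule sum.neutral) (use other in blast)
  finally show ?thesis using True i(2) by (simp only: if_True add_0_right)
next
  case False
  have "(\<Sum>i\<in>{1..N}. exit_ind s t i y) = 0"
    by (rule sum.neutral) (use False exit_ind_cases in blast)
  then show ?thesis using False by (simp only: if_False)
qed

text \<open>When another vertex of value at most \<open>s\<close> follows, \<open>j\<close> is the last one of its component if and only if the path exceeds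
\<open>t\<close> before that vertex, and then the first time it does so is an exit in the sense above.\<close>

lemma last_low_iff_exit:
  assumes st: "s \<le> t" and j: "j \<in> {1..n}" and r: "r \<in> {j<..n}" "x r \<le> s"
  shows "last_low n x s t j \<longleftrightarrow> (\<exists>i\<in>{1..n}. exit_ind s t i (\<lambda>k. x (j + k)) = 1)"
proof (cases "x j \<le> s")
  case False
  then show ?thesis by (simp add: last_low_def exit_ind_def)
next
  case low: True
  \<comment> \<open>The next vertex of value at most \<open>s\<close>; later ones give weaker conditions.\<close>
  define r0 where "r0 = (LEAST r. j < r \<and> x r \<le> s)"
  have r0: "j < r0" "x r0 \<le> s" "r0 \<le> r"
    using LeastI[of "\<lambda>r. j < r \<and> x r \<le> s" r] Least_le[of "\<lambda>r. j < r \<and> x r \<le> s" r] r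
    by (simp_all add: r0_def)
  have before: "s < x k" if "j < k" "k < r0" for k
    using not_less_Least[of k "\<lambda>r. j < r \<and> x r \<le> s"] that by (force simp: r0_def)
  have exit_iff: "exit_ind s t i (\<lambda>k. x (j + k)) = 1 \<longleftrightarrow> (\<forall>k\<in>{1..<i}. s < x (j + k) \<and> x (j + k) \<le> t) \<and> t < x (j + i)" for i
    using low by (simp add: exit_ind_def)
  show ?thesis
  proof
    assume "last_low n x s t j"
    moreover have "r0 \<in> {j<..n}" using r0 r by simp
    ultimately obtain k where k: "k \<in> {j<..<r0}" "t < x k"
      using r0(2) unfolding last_low_def by blast
    define k0 where "k0 = (LEAST k. j < k \<and> t < x k)"
    have k0: "j < k0" "t < x k0" "k0 \<le> k"
      using LeastI[of "\<lambda>k. j < k \<and> t < x k" k] Least_le[of "\<lambda>k. j < k \<and> t < x k" k] k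
      by (simp_all add: k0_def)
    have inner: "x i \<le> t" if "j < i" "i < k0" for i
      using not_less_Least[of i "\<lambda>k. j < k \<and> t < x k"] that by (force simp: k0_def)
    have "exit_ind s t (k0 - j) (\<lambda>k. x (j + k)) = 1"
      unfolding exit_iff
    proof (intro conjI ballI)
      fix i assume i: "i \<in> {1..<k0 - j}"
      then have "j < j + i" "j + i < k0" "j + i < r0" using k0(3) k(1) by auto
      then show "s < x (j + i)" "x (j + i) \<le> t" using before inner by blast+
    next
      show "t < x (j + (k0 - j))" using k0 by simp
    qed
    moreover have "k0 - j \<in> {1..n}" using k0 k r0 r by auto
    ultimately show "\<exists>i\<in>{1..n}. exit_ind s t i (\<lambda>k. x (j + k)) = 1" by blast
  next
    assume "\<exists>i\<in>{1..n}. exit_ind s t i (\<lambda>k. x (j + k)) = 1"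
    then obtain i where i: "i \<in> {1..n}" "\<forall>k\<in>{1..<i}. s < x (j + k) \<and> x (j + k) \<le> t" "t < x (j + i)"
      unfolding exit_iff by blast
    show "last_low n x s t j"
      unfolding last_low_def
    proof (intro conjI ballI impI)
      fix r' assume r': "r' \<in> {j<..n}" "x r' \<le> s"
      have "j + i < r'"
      proof (rule ccontr)
        assume "\<not> j + i < r'"
        then consider "r' = j + i" | "r' - j \<in> {1..<i}" using r'(1) by fastforce
        then show False
        proof cases
          case 1 then show False using i(3) r'(2) st by simp
        next
          case 2
          then have "s < x (j + (r' - j))" using i(2) by blast
          then show False using r' by simp
        qed
      qed
      then show "\<exists>k\<in>{j<..<r'}. t < x k" using i(1,3) by (intro bexI[of _ "j + i"]) auto
    qed (rule low)
  qed
qed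

text \<open>The two counts can only disagree at the very last vertex of value at most \<open>s\<close>: its component may reach the end
of the observed path, where no exit is seen.\<close>

lemma persistent_betti_approx:
  assumes st: "s \<le> t"
  shows "\<bar>real (persistent_betti n x s t) - (\<Sum>j\<in>{1..n}. \<Sum>i\<in>{1..n}. exit_ind s t i (\<lambda>k. x (j + k)))\<bar> \<le> 1"
proof -
  define b where "b j = (if last_low n x s t j then 1 else 0 :: real)" for j
  define c where "c j = (if \<exists>i\<in>{1..n}. exit_ind s t i (\<lambda>k. x (j + k)) = 1 then 1 else 0 :: real)" for j
  have betti: "real (persistent_betti n x s t) = (\<Sum>j\<in>{1..n}. b j)"
    unfolding persistent_betti_eq_card_last_low[OF st] b_def
    by (simp add: sum.If_cases Int_def)
  have bc: "\<bar>b j - c j\<bar> \<le> 1" for j by (simp add: b_def c_def)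
  have "\<bar>(\<Sum>j\<in>{1..n}. b j) - (\<Sum>j\<in>{1..n}. c j)\<bar> \<le> 1"
  proof (cases "\<exists>j\<in>{1..n}. x j \<le> s")
    case False
    have "b j = c j" if "j \<in> {1..n}" for j
      using False that by (simp add: b_def c_def last_low_def exit_ind_def)
    then show ?thesis by simp
  next
    case True
    define J where "J = Max {j \<in> {1..n}. x j \<le> s}"
    have "J \<in> {j \<in> {1..n}. x j \<le> s}" unfolding J_def using True by (intro Max_in) auto
    then have J: "J \<in> {1..n}" "x J \<le> s" by simp_all
    have same: "b j = c j" if j: "j \<in> {1..n} - {J}" for j
    proof (cases "x j \<le> s")
      case True
      then have "j \<le> J" unfolding J_def using j by (intro Max_ge) auto
      then have "J \<in> {j<..n}" using j J by auto
      then show ?thesis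
        using last_low_iff_exit[of s t j n J x] st J(2) j by (simp add: b_def c_def)
    next
      case False
      then show ?thesis by (simp add: b_def c_def last_low_def exit_ind_def)
    qed
    have "(\<Sum>j\<in>{1..n}. b j) - (\<Sum>j\<in>{1..n}. c j) = b J - c J"
      using sum.remove[of "{1..n}" J b] sum.remove[of "{1..n}" J c] J(1) sum.cong[OF refl same, of "{1..n} - {J}"]
      by simp
    then show ?thesis using bc[of J] by simp
  qed
  moreover have "(\<Sum>j\<in>{1..n}. \<Sum>i\<in>{1..n}. exit_ind s t i (\<lambda>k. x (j + k))) = (\<Sum>j\<in>{1..n}. c j)"
    unfolding c_def by (rule sum.cong[OF refl]) (rule sum_exit_ind[OF st])
  ultimately show ?thesis by (simp only: betti)
qed

section \<open>Square-integrable variables and mixing coefficients\<close>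

context prob_space
begin

definition L2 :: "('a \<Rightarrow> real) \<Rightarrow> bool" where
  "L2 U \<longleftrightarrow> U \<in> borel_measurable M \<and> integrable M (\<lambda>\<omega>. (U \<omega>)\<^sup>2)"

lemma L2_measurable [measurable_dest]: "L2 U \<Longrightarrow> U \<in> borel_measurable M"
  and L2_integrable_power2: "L2 U \<Longrightarrow> integrable M (\<lambda>\<omega>. (U \<omega>)\<^sup>2)"
  by (simp_all add: L2_def)

lemma L2I: "U \<in> borel_measurable M \<Longrightarrow> integrable M (\<lambda>\<omega>. (U \<omega>)\<^sup>2) \<Longrightarrow> L2 U"
  by (simp add: L2_def)

lemma L2_bounded:
  assumes "U \<in> borel_measurable M" "\<And>\<omega>. \<omega> \<in> space M \<Longrightarrow> \<bar>U \<omega>\<bar> \<le> B"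
  shows "L2 U"
proof -
  have "\<And>\<omega>. \<omega> \<in> space M \<Longrightarrow> (U \<omega>)\<^sup>2 \<le> B\<^sup>2"
    using assms(2) by (metis abs_ge_zero power2_abs power_mono)
  then show ?thesis
    unfolding L2_def using assms(1) by (auto intro!: integrable_const_bound[of _ "B\<^sup>2"])
qed

lemma L2_integrable_mult:
  assumes "L2 U" "L2 V" shows "integrable M (\<lambda>\<omega>. U \<omega> * V \<omega>)"
proof (rule Bochner_Integration.integrable_bound)
  show "integrable M (\<lambda>\<omega>. (U \<omega>)\<^sup>2 + (V \<omega>)\<^sup>2)" using assms by (simp add: L2_def)
  show "(\<lambda>\<omega>. U \<omega> * V \<omega>) \<in> borel_measurable M" using L2_measurable[OF assms(1)] L2_measurable[OF assms(2)] by measurable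
  have "\<bar>u * v\<bar> \<le> u\<^sup>2 + v\<^sup>2" for u v :: real
  proof -
    have "2 * \<bar>u\<bar> * \<bar>v\<bar> \<le> u\<^sup>2 + v\<^sup>2" using sum_squares_bound[of "\<bar>u\<bar>" "\<bar>v\<bar>"] by simp
    moreover have "0 \<le> \<bar>u\<bar> * \<bar>v\<bar>" by simp
    ultimately show ?thesis unfolding abs_mult by linarith
  qed
  then show "AE \<omega> in M. norm (U \<omega> * V \<omega>) \<le> norm ((U \<omega>)\<^sup>2 + (V \<omega>)\<^sup>2)" by simp
qed

lemma L2_const: "L2 (\<lambda>_. c)"
  by (simp add: L2_def)

lemma L2_integrable: "L2 U \<Longrightarrow> integrable M U"
  using L2_integrable_mult[OF _ L2_const[of 1], of U] by simp

lemma L2_add: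
  assumes "L2 U" "L2 V" shows "L2 (\<lambda>\<omega>. U \<omega> + V \<omega>)"
proof (rule L2I)
  show "(\<lambda>\<omega>. U \<omega> + V \<omega>) \<in> borel_measurable M"
    using L2_measurable[OF assms(1)] L2_measurable[OF assms(2)] by measurable
  have "integrable M (\<lambda>\<omega>. (U \<omega>)\<^sup>2 + (V \<omega>)\<^sup>2 + 2 * (U \<omega> * V \<omega>))"
    by (intro Bochner_Integration.integrable_add integrable_mult_right L2_integrable_power2
        L2_integrable_mult assms)
  then show "integrable M (\<lambda>\<omega>. (U \<omega> + V \<omega>)\<^sup>2)" by (simp add: power2_sum mult.assoc)
qed

lemma L2_cmult: "L2 U \<Longrightarrow> L2 (\<lambda>\<omega>. c * U \<omega>)"
  by (rule L2I) (simp_all add: L2_measurable L2_integrable_power2 power_mult_distrib)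

lemma L2_abs: "L2 U \<Longrightarrow> L2 (\<lambda>\<omega>. \<bar>U \<omega>\<bar>)"
  by (rule L2I) (simp_all add: L2_measurable L2_integrable_power2)

lemma L2_diff:
  assumes "L2 U" "L2 V" shows "L2 (\<lambda>\<omega>. U \<omega> - V \<omega>)"
  using L2_add[OF assms(1) L2_cmult[OF assms(2), of "-1"]] by simp

lemma L2_sum:
  assumes "finite A" "\<And>a. a \<in> A \<Longrightarrow> L2 (U a)"
  shows "L2 (\<lambda>\<omega>. \<Sum>a\<in>A. U a \<omega>)"
  using assms
proof (induction A rule: finite_induct)
  case empty
  show ?case using L2_const[of 0] by simp
next
  case (insert a A)
  have "L2 (\<lambda>\<omega>. U a \<omega> + (\<Sum>a\<in>A. U a \<omega>))"
    by (rule L2_add) (use insert in auto)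
  then show ?case using insert(1,2) by simp
qed

lemma Cauchy_Schwarz_expectation:
  assumes "L2 U" "L2 V"
  shows "(expectation (\<lambda>\<omega>. U \<omega> * V \<omega>))\<^sup>2 \<le> expectation (\<lambda>\<omega>. (U \<omega>)\<^sup>2) * expectation (\<lambda>\<omega>. (V \<omega>)\<^sup>2)"
proof -
  let ?a = "expectation (\<lambda>\<omega>. (U \<omega>)\<^sup>2)" and ?b = "expectation (\<lambda>\<omega>. U \<omega> * V \<omega>)"
    and ?c = "expectation (\<lambda>\<omega>. (V \<omega>)\<^sup>2)"
  note [simp] = assms[THEN L2_integrable_power2] L2_integrable_mult[OF assms]
  have pos: "0 \<le> x\<^sup>2 * ?a + 2 * x * ?b + ?c" for x
  proof -
    have "0 \<le> expectation (\<lambda>\<omega>. (x * U \<omega> + V \<omega>)\<^sup>2)" by (simp add: integral_nonneg)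
    also have "(\<lambda>\<omega>. (x * U \<omega> + V \<omega>)\<^sup>2) = (\<lambda>\<omega>. x\<^sup>2 * (U \<omega>)\<^sup>2 + 2 * x * (U \<omega> * V \<omega>) + (V \<omega>)\<^sup>2)"
      by (auto simp: power2_eq_square algebra_simps)
    finally show ?thesis by simp
  qed
  have a: "0 \<le> ?a" by (simp add: integral_nonneg)
  show ?thesis
  proof (cases "?a = 0")
    case True
    have "?b = 0"
    proof (rule ccontr)
      assume b: "?b \<noteq> 0"
      define x where "x = - (?c + 1) / (2 * ?b)"
      have "x * (2 * ?b) = - (?c + 1)" unfolding x_def using b by simp
      moreover have "0 \<le> x * (2 * ?b) + ?c" using pos[of x] True by simp
      ultimately show False by linarith
    qed
    then show ?thesis using True by simp
  next
    case False
    have "(- ?b / ?a)\<^sup>2 * ?a + 2 * (- ?b / ?a) * ?b + ?c = ?c - ?b\<^sup>2 / ?a"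
      using False by (simp add: power2_eq_square field_simps)
    then have "?b\<^sup>2 / ?a \<le> ?c" using pos[of "- ?b / ?a"] by simp
    then show ?thesis using a False by (simp add: divide_le_eq mult.commute)
  qed
qed

definition L2norm :: "('a \<Rightarrow> real) \<Rightarrow> real" where
  "L2norm U = sqrt (expectation (\<lambda>\<omega>. (U \<omega>)\<^sup>2))"

lemma L2norm_nonneg [simp]: "0 \<le> L2norm U"
  by (simp add: L2norm_def integral_nonneg)

lemma L2norm_power2: "(L2norm U)\<^sup>2 = expectation (\<lambda>\<omega>. (U \<omega>)\<^sup>2)"
  by (simp add: L2norm_def integral_nonneg)

lemma abs_expectation_mult_le:
  assumes "L2 U" "L2 V" shows "\<bar>expectation (\<lambda>\<omega>. U \<omega> * V \<omega>)\<bar> \<le> L2norm U * L2norm V"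
proof (rule power2_le_imp_le)
  show "\<bar>expectation (\<lambda>\<omega>. U \<omega> * V \<omega>)\<bar>\<^sup>2 \<le> (L2norm U * L2norm V)\<^sup>2"
    unfolding power_mult_distrib L2norm_power2 power2_abs by (rule Cauchy_Schwarz_expectation[OF assms])
qed simp

lemma abs_expectation_le_L2norm:
  assumes "L2 U" shows "expectation (\<lambda>\<omega>. \<bar>U \<omega>\<bar>) \<le> L2norm U"
proof -
  from abs_expectation_mult_le[OF L2_abs[OF assms] L2_const[of 1]] show ?thesis
    by (simp add: L2norm_def prob_space)
qed

lemma L2norm_add_le:
  assumes "L2 U" "L2 V" shows "L2norm (\<lambda>\<omega>. U \<omega> + V \<omega>) \<le> L2norm U + L2norm V"
proof (rule power2_le_imp_le)
  note [simp] = assms[THEN L2_integrable_power2] L2_integrable_mult[OF assms]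
  have "(L2norm (\<lambda>\<omega>. U \<omega> + V \<omega>))\<^sup>2 = (L2norm U)\<^sup>2 + (L2norm V)\<^sup>2 + 2 * expectation (\<lambda>\<omega>. U \<omega> * V \<omega>)"
    unfolding L2norm_power2 by (simp add: power2_sum mult.assoc)
  also have "\<dots> \<le> (L2norm U + L2norm V)\<^sup>2"
    using abs_expectation_mult_le[OF assms] by (simp add: power2_sum)
  finally show "(L2norm (\<lambda>\<omega>. U \<omega> + V \<omega>))\<^sup>2 \<le> (L2norm U + L2norm V)\<^sup>2" .
qed simp

lemma L2norm_cmult: "L2norm (\<lambda>\<omega>. c * U \<omega>) = \<bar>c\<bar> * L2norm U"
  by (simp add: L2norm_def power_mult_distrib real_sqrt_mult)

lemma L2norm_sum_le:
  assumes "finite A" "\<And>a. a \<in> A \<Longrightarrow> L2 (U a)"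
  shows "L2norm (\<lambda>\<omega>. \<Sum>a\<in>A. U a \<omega>) \<le> (\<Sum>a\<in>A. L2norm (U a))"
  using assms
proof (induction A rule: finite_induct)
  case empty
  then show ?case by (simp add: L2norm_def)
next
  case (insert a A)
  have "L2norm (\<lambda>\<omega>. U a \<omega> + (\<Sum>a\<in>A. U a \<omega>)) \<le> L2norm (U a) + L2norm (\<lambda>\<omega>. \<Sum>a\<in>A. U a \<omega>)"
    by (rule L2norm_add_le) (use insert in \<open>auto intro: L2_sum\<close>)
  also have "\<dots> \<le> L2norm (U a) + (\<Sum>a\<in>A. L2norm (U a))" using insert by simp
  finally show ?case using insert(1,2) by simp
qed

lemma L2norm_bounded:
  assumes "U \<in> borel_measurable M" "\<And>\<omega>. \<omega> \<in> space M \<Longrightarrow> \<bar>U \<omega>\<bar> \<le> B" "0 \<le> B"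
  shows "L2norm U \<le> B"
proof -
  have "expectation (\<lambda>\<omega>. (U \<omega>)\<^sup>2) \<le> expectation (\<lambda>\<omega>. B\<^sup>2)"
  proof (rule integral_mono)
    show "integrable M (\<lambda>\<omega>. (U \<omega>)\<^sup>2)" using L2_bounded[OF assms(1,2)] by (simp add: L2_def)
    show "(U \<omega>)\<^sup>2 \<le> B\<^sup>2" if "\<omega> \<in> space M" for \<omega>
      using assms(2)[OF that] assms(3) by (simp add: abs_le_square_iff[symmetric])
  qed simp
  then have "expectation (\<lambda>\<omega>. (U \<omega>)\<^sup>2) \<le> B\<^sup>2" by (simp add: prob_space)
  then show ?thesis unfolding L2norm_def using assms(3) by (simp add: real_le_lsqrt)
qed

definition centered :: "('a \<Rightarrow> real) \<Rightarrow> 'a \<Rightarrow> real" where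
  "centered U = (\<lambda>\<omega>. U \<omega> - expectation U)"

lemma L2_centered: "L2 U \<Longrightarrow> L2 (centered U)"
  unfolding centered_def by (rule L2_diff[OF _ L2_const])

lemma expectation_centered: "L2 U \<Longrightarrow> expectation (centered U) = 0"
  using L2_integrable[of U] by (simp add: centered_def prob_space)

lemma covariance_centered: "covariance_rv M U V = expectation (\<lambda>\<omega>. centered U \<omega> * centered V \<omega>)"
  by (simp add: covariance_rv_def centered_def)

lemma variance_centered: "variance_rv M U = (L2norm (centered U))\<^sup>2"
  by (simp add: variance_rv_def L2norm_power2 centered_def)

lemma covariance_eq:
  assumes "L2 U" "L2 V"
  shows "covariance_rv M U V = expectation (\<lambda>\<omega>. U \<omega> * V \<omega>) - expectation U * expectation V"
proof -
  note [simp] = L2_integrable[OF assms(1)] L2_integrable[OF assms(2)] L2_integrable_mult[OF assms]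
  have "covariance_rv M U V = expectation (\<lambda>\<omega>. U \<omega> * V \<omega> - expectation V * U \<omega> - expectation U * V \<omega>
     + expectation U * expectation V)"
    unfolding covariance_rv_def by (intro Bochner_Integration.integral_cong) (auto simp: algebra_simps)
  then show ?thesis by (simp add: prob_space)
qed

lemma L2norm_centered_le:
  assumes "L2 U" shows "L2norm (centered U) \<le> L2norm U"
proof -
  have "(L2norm (centered U))\<^sup>2 = (L2norm U)\<^sup>2 - (expectation U)\<^sup>2"
    using covariance_eq[OF assms assms] unfolding covariance_centered L2norm_power2
    by (simp add: power2_eq_square)
  then have "(L2norm (centered U))\<^sup>2 \<le> (L2norm U)\<^sup>2" by simp
  then show ?thesis by (rule power2_le_imp_le) simp
qed

lemma abs_correlation_le_1:
  assumes "L2 U" "L2 V" shows "\<bar>correlation M U V\<bar> \<le> 1"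
proof -
  let ?d = "L2norm (centered U) * L2norm (centered V)"
  have "\<bar>covariance_rv M U V\<bar> \<le> ?d"
    unfolding covariance_centered by (rule abs_expectation_mult_le[OF assms[THEN L2_centered]])
  moreover have "sqrt (variance_rv M U * variance_rv M V) = ?d"
    by (simp add: variance_centered real_sqrt_mult)
  moreover have "\<bar>c / d\<bar> \<le> 1" if "\<bar>c\<bar> \<le> d" for c d :: real
  proof (cases "d = 0")
    case False
    then have "0 < d" using that by linarith
    then show ?thesis using that by (simp add: abs_divide)
  qed simp
  ultimately show ?thesis by (simp only: correlation_def)
qed

lemma borel_measurable_finer:
  "U \<in> borel_measurable A \<Longrightarrow> sets A \<subseteq> sets B \<Longrightarrow> space A = space B \<Longrightarrow> U \<in> borel_measurable B"
  by (auto simp: measurable_def)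

lemma nondegenerate_L2D:
  assumes "U \<in> nondegenerate_L2 M A" "sets A \<subseteq> sets M" "space A = space M"
  shows "L2 U"
proof (rule L2I)
  show "U \<in> borel_measurable M"
    by (rule borel_measurable_finer[OF _ assms(2,3)]) (use assms(1) in \<open>simp add: nondegenerate_L2_def\<close>)
  show "integrable M (\<lambda>\<omega>. (U \<omega>)\<^sup>2)" using assms(1) by (simp add: nondegenerate_L2_def)
qed

lemma rho_coeff_le_1:
  assumes "sets A \<subseteq> sets M" "space A = space M" "sets B \<subseteq> sets M" "space B = space M"
  shows "rho_coeff M A B \<le> 1"
  unfolding rho_coeff_def
proof (rule SUP_least, rule SUP_least)
  fix U V assume "U \<in> nondegenerate_L2 M A" "V \<in> nondegenerate_L2 M B"
  then have "L2 U" "L2 V"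
    using nondegenerate_L2D[OF _ assms(1,2)] nondegenerate_L2D[OF _ assms(3,4)] by simp_all
  then show "ennreal \<bar>correlation M U V\<bar> \<le> 1" using abs_correlation_le_1 by simp
qed

lemma rho_coeff_mono:
  assumes "sets A \<subseteq> sets A'" "space A = space A'" "sets B \<subseteq> sets B'" "space B = space B'"
  shows "rho_coeff M A B \<le> rho_coeff M A' B'"
proof -
  have "nondegenerate_L2 M A \<subseteq> nondegenerate_L2 M A'" "nondegenerate_L2 M B \<subseteq> nondegenerate_L2 M B'"
    using borel_measurable_finer[OF _ assms(1,2)] borel_measurable_finer[OF _ assms(3,4)]
    by (auto simp: nondegenerate_L2_def)
  then show ?thesis
    unfolding rho_coeff_def by (rule SUP_subset_mono[OF _ SUP_subset_mono[OF _ order_refl]])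
qed

text \<open>If a variable is degenerate, the supremum says nothing about it, but then the covariance vanishes by
the Cauchy--Schwarz inequality.\<close>

lemma covariance_le_rho_coeff:
  assumes A: "sets A \<subseteq> sets M" "space A = space M" and B: "sets B \<subseteq> sets M" "space B = space M"
    and U: "U \<in> borel_measurable A" "L2 U" and V: "V \<in> borel_measurable B" "L2 V"
    and fin: "rho_coeff M A B \<le> ennreal c" "0 \<le> c"
  shows "\<bar>covariance_rv M U V\<bar> \<le> c * (L2norm (centered U) * L2norm (centered V))"
proof (cases "variance_rv M U = 0 \<or> variance_rv M V = 0")
  case True
  have "\<bar>covariance_rv M U V\<bar> \<le> L2norm (centered U) * L2norm (centered V)"
    unfolding covariance_centered
    by (rule abs_expectation_mult_le[OF L2_centered[OF U(2)] L2_centered[OF V(2)]])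
  then show ?thesis using True by (auto simp: variance_centered)
next
  case False
  have "U \<in> nondegenerate_L2 M A" "V \<in> nondegenerate_L2 M B"
    using False U V by (auto simp: nondegenerate_L2_def L2_def)
  then have "ennreal \<bar>correlation M U V\<bar> \<le> rho_coeff M A B"
    unfolding rho_coeff_def by (intro SUP_upper2[where i = U] SUP_upper[where i = V])
  then have "\<bar>correlation M U V\<bar> \<le> c" using fin by (meson ennreal_le_iff order_trans)
  moreover have "sqrt (variance_rv M U * variance_rv M V) = L2norm (centered U) * L2norm (centered V)"
    by (simp add: variance_centered real_sqrt_mult)
  moreover have "0 < L2norm (centered U)" "0 < L2norm (centered V)"
    using False L2norm_nonneg[of "centered U"] L2norm_nonneg[of "centered V"]
    by (auto simp: variance_centered less_le)
  ultimately show ?thesis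
    by (simp add: correlation_def abs_mult pos_divide_le_eq)
qed

end

lemma space_sigma_gen [simp]: "space (sigma_gen M X I) = space M"
  by (simp add: sigma_gen_def space_measure_of_conv)

lemma sets_sigma_gen:
  "sets (sigma_gen M X I) = sigma_sets (space M) {X i -` B \<inter> space M | i B. i \<in> I \<and> B \<in> sets borel}"
  unfolding sigma_gen_def by (rule sets_measure_of) auto

lemma measurable_sigma_gen:
  assumes "i \<in> I" shows "X i \<in> borel_measurable (sigma_gen M X I)"
proof (rule measurableI)
  fix B :: "real set" assume "B \<in> sets borel"
  then show "X i -` B \<inter> space (sigma_gen M X I) \<in> sets (sigma_gen M X I)"
    unfolding space_sigma_gen sets_sigma_gen using assms by (intro sigma_sets.Basic) blast
qed simp

text \<open>Used with \<open>N = M\<close>, and with \<open>N\<close> generated by another process to compare the past and the future of a process with those of a functional of it.\<close>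

lemma sets_sigma_gen_subset:
  assumes "\<And>i. i \<in> I \<Longrightarrow> X i \<in> borel_measurable N" "space N = space M"
  shows "sets (sigma_gen M X I) \<subseteq> sets N"
proof -
  have "sigma_sets (space N) {X i -` B \<inter> space M | i B. i \<in> I \<and> B \<in> sets borel} \<subseteq> sets N"
  proof (rule sets.sigma_sets_subset, rule subsetI)
    fix A assume "A \<in> {X i -` B \<inter> space M | i B. i \<in> I \<and> B \<in> sets borel}"
    then obtain i B where "i \<in> I" "B \<in> sets borel" "A = X i -` B \<inter> space N"
      using assms(2) by blast
    then show "A \<in> sets N" using measurable_sets[OF assms(1)[OF \<open>i \<in> I\<close>]] by simp
  qed
  then show ?thesis unfolding sets_sigma_gen assms(2) .
qed

section \<open>Variances of partial sums of a mixing sequence\<close>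

lemma Cesaro_mean_tendsto:
  fixes d :: "nat \<Rightarrow> real"
  assumes "d \<longlonglongrightarrow> L" shows "(\<lambda>n. (\<Sum>k<n. d k) / real n) \<longlonglongrightarrow> L"
proof (rule LIMSEQ_I)
  fix e :: real assume e: "0 < e"
  obtain N where N: "\<And>n. N \<le> n \<Longrightarrow> \<bar>d n - L\<bar> < e / 2"
    using LIMSEQ_D[OF assms, of "e / 2"] e by auto
  define C where "C = (\<Sum>k<N. \<bar>d k - L\<bar>)"
  obtain K where K: "2 * C / e < real K" using reals_Archimedean2 by blast
  have "norm ((\<Sum>k<n. d k) / real n - L) < e" if n: "max (Suc N) (Suc K) \<le> n" for n
  proof -
    have n0: "0 < real n" and nN: "N \<le> n" using n by auto
    have "(\<Sum>k<n. d k) / real n - L = (\<Sum>k<n. d k - L) / real n"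
      using n0 by (simp add: sum_subtractf field_simps)
    moreover have "\<bar>\<Sum>k<n. d k - L\<bar> \<le> C + real n * (e / 2)"
    proof -
      have "\<bar>\<Sum>k<n. d k - L\<bar> \<le> (\<Sum>k<n. \<bar>d k - L\<bar>)" by (rule sum_abs)
      also have "\<dots> = C + (\<Sum>k\<in>{N..<n}. \<bar>d k - L\<bar>)"
        unfolding C_def using nN sum.atLeastLessThan_concat[of 0 N n "\<lambda>k. \<bar>d k - L\<bar>"]
        by (simp add: lessThan_atLeast0)
      also have "(\<Sum>k\<in>{N..<n}. \<bar>d k - L\<bar>) \<le> (\<Sum>k\<in>{N..<n}. e / 2)"
        by (rule sum_mono) (use N in \<open>simp add: less_imp_le\<close>)
      also have "(\<Sum>k\<in>{N..<n}. e / 2) \<le> real n * (e / 2)"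
        using e by (simp add: mult_right_mono)
      finally show ?thesis by simp
    qed
    moreover have "C < real n * (e / 2)"
    proof -
      have "2 * C / e < real n" using K n by simp
      then show ?thesis using e by (simp add: field_simps)
    qed
    ultimately show ?thesis using n0 by (simp add: abs_divide divide_less_eq mult.commute)
  qed
  then show "\<exists>no. \<forall>n\<ge>no. norm ((\<Sum>k<n. d k) / real n - L) < e" by blast
qed

text \<open>The mixing rates are finite from lag \<open>1\<close> on, so they are used as real numbers; lag \<open>0\<close> never
occurs.\<close>

locale rho_mixing_process = prob_space M for M :: "'a measure" +
  fixes X :: "nat \<Rightarrow> 'a \<Rightarrow> real"
  assumes X_measurable: "\<And>i. 1 \<le> i \<Longrightarrow> X i \<in> borel_measurable M"
    and stationary: "strictly_stationary M X"
    and rho_summable: "(\<Sum>k. rho_mixing M X (Suc k)) < \<infinity>"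
begin

definition rate :: "nat \<Rightarrow> real" where
  "rate k = enn2real (rho_mixing M X k)"

lemma rate_nonneg [simp]: "0 \<le> rate k"
  by (simp add: rate_def)

lemma rho_mixing_eq_rate: "rho_mixing M X (Suc k) = ennreal (rate (Suc k))"
proof -
  have "rho_mixing M X (Suc k) < \<infinity>"
    using ennreal_suminf_lessD[OF rho_summable] by simp
  then show ?thesis by (simp add: rate_def less_top)
qed

lemma summable_rate: "summable (\<lambda>k. rate (Suc k))"
  using rho_summable unfolding rho_mixing_eq_rate
  by (intro summable_suminf_not_top) (simp_all add: less_top)

lemma rate_tendsto_0: "(\<lambda>k. rate (Suc k)) \<longlonglongrightarrow> 0"
  by (rule summable_LIMSEQ_zero[OF summable_rate])

definition total_rate :: real where
  "total_rate = (\<Sum>k. rate (Suc k))"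

lemma total_rate_nonneg: "0 \<le> total_rate"
  unfolding total_rate_def by (rule suminf_nonneg[OF summable_rate]) simp

lemma sum_rate_le: "(\<Sum>k<n. rate (Suc k)) \<le> total_rate"
  unfolding total_rate_def by (rule sum_le_suminf[OF summable_rate]) simp_all

lemma sets_past: "I \<subseteq> {1..} \<Longrightarrow> sets (sigma_gen M X I) \<subseteq> sets M"
  using X_measurable by (intro sets_sigma_gen_subset) auto

lemma covariance_le_rate:
  assumes m: "1 \<le> m"
    and U: "U \<in> borel_measurable (sigma_gen M X {1..m})" "L2 U"
    and V: "V \<in> borel_measurable (sigma_gen M X {m + Suc k..})" "L2 V"
  shows "\<bar>covariance_rv M U V\<bar> \<le> rate (Suc k) * (L2norm (centered U) * L2norm (centered V))"
proof (rule covariance_le_rho_coeff[OF _ _ _ _ U V])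
  have "rho_coeff M (sigma_gen M X {1..m}) (sigma_gen M X {m + Suc k..}) \<le> rho_mixing M X (Suc k)"
    unfolding rho_mixing_def by (rule SUP_upper) (use m in simp)
  then show "rho_coeff M (sigma_gen M X {1..m}) (sigma_gen M X {m + Suc k..}) \<le> ennreal (rate (Suc k))"
    by (simp only: rho_mixing_eq_rate)
qed (use m in \<open>simp_all add: sets_past\<close>)

lemma measurable_block [measurable]:
  "(\<lambda>\<omega>. \<lambda>i\<in>{1..m}. X (i + h) \<omega>) \<in> measurable M (\<Pi>\<^sub>M i\<in>{1..m}. borel)"
  by (rule measurable_restrict, rule X_measurable) simp

text \<open>Stationarity is an identity of laws on finite products; it is used through expectations of
measurable functionals of a window.\<close>

lemma stationary_expectation:
  fixes \<Phi> :: "(nat \<Rightarrow> real) \<Rightarrow> 'b :: {banach, second_countable_topology}"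
  assumes "\<Phi> \<in> borel_measurable (\<Pi>\<^sub>M i\<in>{1..m}. borel)"
  shows "expectation (\<lambda>\<omega>. \<Phi> (\<lambda>i\<in>{1..m}. X (i + h) \<omega>)) = expectation (\<lambda>\<omega>. \<Phi> (\<lambda>i\<in>{1..m}. X i \<omega>))"
proof -
  have "expectation (\<lambda>\<omega>. \<Phi> (\<lambda>i\<in>{1..m}. X (i + h) \<omega>))
      = integral\<^sup>L (distr M (\<Pi>\<^sub>M i\<in>{1..m}. borel) (\<lambda>\<omega>. \<lambda>i\<in>{1..m}. X (i + h) \<omega>)) \<Phi>"
    by (rule integral_distr[symmetric, OF measurable_block assms])
  also have "\<dots> = integral\<^sup>L (distr M (\<Pi>\<^sub>M i\<in>{1..m}. borel) (\<lambda>\<omega>. \<lambda>i\<in>{1..m}. X i \<omega>)) \<Phi>"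
    using stationary by (simp add: strictly_stationary_def)
  also have "\<dots> = expectation (\<lambda>\<omega>. \<Phi> (\<lambda>i\<in>{1..m}. X i \<omega>))"
    using integral_distr[OF measurable_block[where m = m and h = 0] assms] by simp
  finally show ?thesis .
qed

text \<open>The offset \<open>h\<close> makes it possible to speak of a later stretch of the process: \<open>psum h n\<close> has
the law of \<open>psum 0 n\<close>.\<close>

definition psum :: "nat \<Rightarrow> nat \<Rightarrow> 'a \<Rightarrow> real" where
  "psum h n = (\<lambda>\<omega>. \<Sum>i\<in>{1..n}. X (i + h) \<omega>)"

lemma psum_measurable [measurable]: "psum h n \<in> borel_measurable M"
  unfolding psum_def by (rule borel_measurable_sum, rule X_measurable) simp

lemma psum_stationary:
  fixes g :: "real \<Rightarrow> 'b :: {banach, second_countable_topology}"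
  assumes g: "g \<in> borel_measurable borel"
  shows "expectation (\<lambda>\<omega>. g (psum h n \<omega>)) = expectation (\<lambda>\<omega>. g (psum 0 n \<omega>))"
proof -
  have sum: "(\<lambda>x. \<Sum>i\<in>{1..n}. x i) \<in> borel_measurable (\<Pi>\<^sub>M i\<in>{1..n}. (borel :: real measure))"
    by (rule borel_measurable_sum) (rule measurable_component_singleton)
  have "(\<lambda>x. g (\<Sum>i\<in>{1..n}. x i)) \<in> borel_measurable (\<Pi>\<^sub>M i\<in>{1..n}. borel)"
    by (rule measurable_compose[OF sum g])
  from stationary_expectation[OF this, of h] show ?thesis
    by (simp add: psum_def)
qed

lemma pair_stationary:
  "expectation (\<lambda>\<omega>. X (1 + h) \<omega> * X (Suc k + h) \<omega>) = expectation (\<lambda>\<omega>. X 1 \<omega> * X (Suc k) \<omega>)"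
proof -
  have "(\<lambda>x. x 1 * x (Suc k)) \<in> borel_measurable (\<Pi>\<^sub>M i\<in>{1..Suc k}. (borel :: real measure))"
    by (intro borel_measurable_times measurable_component_singleton) auto
  from stationary_expectation[OF this, of h] show ?thesis by simp
qed

lemma X_past: "i \<in> I \<Longrightarrow> X i \<in> borel_measurable (sigma_gen M X I)"
  by (rule measurable_sigma_gen)

lemma psum_past: "psum 0 m \<in> borel_measurable (sigma_gen M X {1..m})"
  unfolding psum_def by (rule borel_measurable_sum, rule X_past) simp

lemma psum_future: "psum (m + k) n \<in> borel_measurable (sigma_gen M X {m + Suc k..})"
  unfolding psum_def by (rule borel_measurable_sum, rule X_past) simp

end

text \<open>Boundedness makes all moments finite. The general bounded case reduces to mean zero by
centering.\<close>

locale bounded_rho_mixing = rho_mixing_process +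
  fixes B :: real
  assumes bounded: "\<And>i \<omega>. 1 \<le> i \<Longrightarrow> \<omega> \<in> space M \<Longrightarrow> \<bar>X i \<omega>\<bar> \<le> B"
    and mean_zero: "expectation (X 1) = 0"
begin

lemma B_nonneg: "0 \<le> B"
proof -
  obtain \<omega> where "\<omega> \<in> space M" using not_empty by blast
  then show ?thesis using bounded[of 1 \<omega>] by simp
qed

lemma L2_X: "1 \<le> i \<Longrightarrow> L2 (X i)"
  by (rule L2_bounded[of _ B], erule X_measurable, erule bounded)

lemma mean_zero_all: "1 \<le> i \<Longrightarrow> expectation (X i) = 0"
  using psum_stationary[of "\<lambda>x. x" "i - 1" 1] mean_zero by (simp add: psum_def)

lemma psum_bounded: "\<omega> \<in> space M \<Longrightarrow> \<bar>psum h n \<omega>\<bar> \<le> B * real n"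
proof -
  assume \<omega>: "\<omega> \<in> space M"
  have "\<bar>psum h n \<omega>\<bar> \<le> (\<Sum>i\<in>{1..n}. \<bar>X (i + h) \<omega>\<bar>)" unfolding psum_def by (rule sum_abs)
  also have "\<dots> \<le> (\<Sum>i\<in>{1..n}. B)" by (rule sum_mono) (auto intro: bounded \<omega>)
  finally show ?thesis by (simp add: mult.commute)
qed

lemma L2_psum: "L2 (psum h n)"
  by (rule L2_bounded[OF psum_measurable psum_bounded])

lemma mean_psum: "expectation (psum h n) = 0"
proof -
  have "expectation (psum h n) = (\<Sum>i\<in>{1..n}. expectation (X (i + h)))"
    unfolding psum_def by (rule Bochner_Integration.integral_sum, rule L2_integrable, rule L2_X) simp
  also have "\<dots> = 0" by (rule sum.neutral) (auto intro: mean_zero_all)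
  finally show ?thesis .
qed

definition autocov :: "nat \<Rightarrow> real" where
  "autocov k = expectation (\<lambda>\<omega>. X 1 \<omega> * X (Suc k) \<omega>)"

lemma autocov_0_nonneg: "0 \<le> autocov 0"
  by (simp add: autocov_def integral_nonneg)

lemma abs_autocov_le: "\<bar>autocov (Suc k)\<bar> \<le> rate (Suc k) * autocov 0"
proof -
  have "\<bar>covariance_rv M (X 1) (X (Suc (Suc k)))\<bar>
      \<le> rate (Suc k) * (L2norm (centered (X 1)) * L2norm (centered (X (Suc (Suc k)))))"
    by (rule covariance_le_rate[where m = 1]) (simp_all add: X_past L2_X)
  moreover have cent: "centered (X i) = X i" if "1 \<le> i" for i
    using mean_zero_all[OF that] by (simp add: centered_def)
  have "covariance_rv M (X 1) (X (Suc (Suc k))) = autocov (Suc k)"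
    unfolding covariance_centered autocov_def by (simp add: cent)
  moreover have "L2norm (centered (X 1)) * L2norm (centered (X (Suc (Suc k)))) = autocov 0"
  proof -
    have "L2norm (X (1 + Suc k)) = L2norm (X 1)"
      using psum_stationary[of "\<lambda>x. x\<^sup>2" "Suc k" 1] by (simp add: L2norm_def psum_def)
    then have "L2norm (centered (X 1)) * L2norm (centered (X (Suc (Suc k)))) = (L2norm (X 1))\<^sup>2"
      by (simp add: cent power2_eq_square)
    also have "\<dots> = autocov 0" unfolding L2norm_power2 autocov_def by (simp add: power2_eq_square)
    finally show ?thesis .
  qed
  ultimately show ?thesis by (simp only:)
qed

definition var_sum :: "nat \<Rightarrow> real" where
  "var_sum n = expectation (\<lambda>\<omega>. (psum 0 n \<omega>)\<^sup>2)"

lemma var_sum_nonneg: "0 \<le> var_sum n"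
  by (simp add: var_sum_def integral_nonneg)

lemma L2norm_psum: "L2norm (psum 0 n) = sqrt (var_sum n)"
  by (simp add: L2norm_def var_sum_def)

text \<open>The increments of the variance converge because the autocovariances are summable; the limit of
\<open>var_sum n / n\<close> is then a Cesaro limit.\<close>

lemma var_sum_Suc: "var_sum (Suc n) - var_sum n = autocov 0 + 2 * (\<Sum>k<n. autocov (Suc k))"
proof -
  have prod_int: "integrable M (\<lambda>\<omega>. psum 0 n \<omega> * X (Suc n) \<omega>)"
    by (rule L2_integrable_mult[OF L2_psum L2_X]) simp
  have "var_sum (Suc n) = expectation (\<lambda>\<omega>. (psum 0 n \<omega>)\<^sup>2 + 2 * (psum 0 n \<omega> * X (Suc n) \<omega>) + (X (Suc n) \<omega>)\<^sup>2)"
    unfolding var_sum_def psum_def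
    by (intro Bochner_Integration.integral_cong refl) (simp add: power2_sum algebra_simps)
  also have "\<dots> = var_sum n + 2 * expectation (\<lambda>\<omega>. psum 0 n \<omega> * X (Suc n) \<omega>) + expectation (\<lambda>\<omega>. (X (Suc n) \<omega>)\<^sup>2)"
    using prod_int L2_integrable_power2[OF L2_psum[of 0 n]] L2_integrable_power2[OF L2_X[of "Suc n"]]
    by (simp add: var_sum_def)
  also have "expectation (\<lambda>\<omega>. (X (Suc n) \<omega>)\<^sup>2) = autocov 0"
    using pair_stationary[of n 0] by (simp add: autocov_def power2_eq_square)
  also have "expectation (\<lambda>\<omega>. psum 0 n \<omega> * X (Suc n) \<omega>) = (\<Sum>k<n. autocov (Suc k))"
  proof -
    have "expectation (\<lambda>\<omega>. psum 0 n \<omega> * X (Suc n) \<omega>) = (\<Sum>i\<in>{1..n}. expectation (\<lambda>\<omega>. X i \<omega> * X (Suc n) \<omega>))"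
      unfolding psum_def sum_distrib_right add_0_right
      by (rule Bochner_Integration.integral_sum, rule L2_integrable_mult; rule L2_X) simp_all
    also have "\<dots> = (\<Sum>i\<in>{1..n}. autocov (Suc n - i))"
    proof (rule sum.cong[OF refl])
      fix i assume "i \<in> {1..n}"
      then show "expectation (\<lambda>\<omega>. X i \<omega> * X (Suc n) \<omega>) = autocov (Suc n - i)"
        using pair_stationary[of "i - 1" "Suc n - i"] by (simp add: autocov_def Suc_diff_le)
    qed
    also have "\<dots> = (\<Sum>k<n. autocov (Suc k))"
      by (rule sum.reindex_bij_witness[of _ "\<lambda>k. n - k" "\<lambda>i. n - i"]) (auto simp: Suc_diff_le)
    finally show ?thesis .
  qed
  finally show ?thesis by simp
qed

lemma var_sum_0: "var_sum 0 = 0"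
  by (simp add: var_sum_def psum_def)

lemma abs_sum_autocov_le: "\<bar>\<Sum>k<n. autocov (Suc k)\<bar> \<le> total_rate * autocov 0"
proof -
  have "\<bar>\<Sum>k<n. autocov (Suc k)\<bar> \<le> (\<Sum>k<n. rate (Suc k) * autocov 0)"
    by (rule order_trans[OF sum_abs]) (rule sum_mono, rule abs_autocov_le)
  also have "\<dots> \<le> total_rate * autocov 0"
    unfolding sum_distrib_right[symmetric] by (rule mult_right_mono[OF sum_rate_le autocov_0_nonneg])
  finally show ?thesis .
qed

lemma var_sum_le: "var_sum n \<le> real n * (autocov 0 * (1 + 2 * total_rate))"
proof (induction n)
  case (Suc n)
  have "var_sum (Suc n) \<le> var_sum n + autocov 0 * (1 + 2 * total_rate)"
    using var_sum_Suc[of n] abs_sum_autocov_le[of n] by (simp add: algebra_simps)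
  then show ?case using Suc by (simp add: algebra_simps)
qed (simp add: var_sum_0)

definition long_run_variance :: real where
  "long_run_variance = autocov 0 + 2 * (\<Sum>k. autocov (Suc k))"

lemma summable_autocov: "summable (\<lambda>k. autocov (Suc k))"
  by (rule summable_comparison_test'[OF summable_mult2[OF summable_rate, of "autocov 0"], of 0])
    (simp only: real_norm_def abs_autocov_le)

lemma var_sum_tendsto: "(\<lambda>n. var_sum n / real n) \<longlonglongrightarrow> long_run_variance"
proof -
  have "(\<lambda>n. autocov 0 + 2 * (\<Sum>k<n. autocov (Suc k))) \<longlonglongrightarrow> long_run_variance"
    unfolding long_run_variance_def
    by (rule tendsto_add[OF tendsto_const tendsto_mult_left[OF summable_LIMSEQ[OF summable_autocov]]])
  then have "(\<lambda>n. var_sum (Suc n) - var_sum n) \<longlonglongrightarrow> long_run_variance" by (simp only: var_sum_Suc)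
  from Cesaro_mean_tendsto[OF this] show ?thesis
    by (simp only: sum_lessThan_telescope var_sum_0 diff_zero)
qed

lemma long_run_variance_nonneg: "0 \<le> long_run_variance"
  by (rule LIMSEQ_le_const[OF var_sum_tendsto], rule exI[of _ 0]) (simp add: var_sum_nonneg)

end

section \<open>Fourth moments of partial sums\<close>

text \<open>A coefficient slightly above one for the pure fourth powers is what matters below: together with the perturbation
lemma it keeps the factor in the doubling recursion under \<open>4\<close>. The difference of the
two sides is a sum of squares.\<close>

lemma fourth_power_add_le:
  fixes u v :: real
  shows "(u + v)^4 \<le> 9/8 * (u^4 + v^4) + 70 * (u\<^sup>2 * v\<^sup>2)"
proof -
  have "9/8 * (u^4 + v^4) + 70 * (u\<^sup>2 * v\<^sup>2) - (u + v)^4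
      = 1/8 * (u\<^sup>2 - 16 * (u * v))\<^sup>2 + 1/8 * (v\<^sup>2 - 16 * (u * v))\<^sup>2"
    by (simp add: power2_eq_square power4_eq_xxxx algebra_simps)
  moreover have "0 \<le> 1/8 * (u\<^sup>2 - 16 * (u * v))\<^sup>2 + 1/8 * (v\<^sup>2 - 16 * (u * v))\<^sup>2" by simp
  ultimately show ?thesis by linarith
qed

lemma fourth_power_perturb_le:
  fixes w g :: real
  shows "(w + g)^4 \<le> 7/6 * w^4 + 9261 * g^4"
proof -
  have sq: "(a + b)\<^sup>2 \<le> 21/20 * a\<^sup>2 + 21 * b\<^sup>2" for a b :: real
  proof -
    have "21/20 * a\<^sup>2 + 21 * b\<^sup>2 - (a + b)\<^sup>2 = 1/20 * (a - 20 * b)\<^sup>2"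
      by (simp add: power2_eq_square algebra_simps)
    moreover have "0 \<le> 1/20 * (a - 20 * b)\<^sup>2" by simp
    ultimately show ?thesis by linarith
  qed
  have p4: "z^4 = (z\<^sup>2)\<^sup>2" for z :: real by simp
  have "(w + g)^4 \<le> (21/20 * w\<^sup>2 + 21 * g\<^sup>2)\<^sup>2"
    unfolding p4 by (rule power_mono[OF sq]) simp
  also have "\<dots> \<le> 21/20 * (21/20 * w\<^sup>2)\<^sup>2 + 21 * (21 * g\<^sup>2)\<^sup>2" by (rule sq)
  also have "\<dots> = 9261/8000 * w^4 + 9261 * g^4" by (simp add: power_mult_distrib power2_eq_square power4_eq_xxxx)
  also have "\<dots> \<le> 7/6 * w^4 + 9261 * g^4" by (intro add_mono mult_right_mono) simp_all
  finally show ?thesis .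
qed

context bounded_rho_mixing
begin

lemma psum_add: "psum 0 (m + n) \<omega> = psum 0 m \<omega> + psum m n \<omega>"
proof -
  have "(\<Sum>i\<in>{1..m + n}. X i \<omega>) = (\<Sum>i\<in>{1..m}. X i \<omega>) + (\<Sum>i\<in>{m+1..m + n}. X i \<omega>)"
    by (rule sum.ub_add_nat) simp
  also have "(\<Sum>i\<in>{m+1..m + n}. X i \<omega>) = (\<Sum>i\<in>{1..n}. X (i + m) \<omega>)"
    using sum.shift_bounds_cl_nat_ivl[of "\<lambda>i. X i \<omega>" 1 m n] by (simp add: add.commute)
  finally show ?thesis by (simp add: psum_def)
qed

text \<open>Shifting the window by one step changes one summand at either end.\<close>

lemma psum_shift_le:
  assumes \<omega>: "\<omega> \<in> space M"
  shows "\<bar>psum h n \<omega> - psum (h + q) n \<omega>\<bar> \<le> 2 * B * real q"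
proof (induction q)
  case (Suc q)
  have "psum (h + q) n \<omega> + X (Suc n + (h + q)) \<omega> = X (1 + (h + q)) \<omega> + psum (h + Suc q) n \<omega>"
  proof -
    have "(\<Sum>i\<in>{1..Suc n}. X (i + (h + q)) \<omega>) = psum (h + q) n \<omega> + X (Suc n + (h + q)) \<omega>"
      by (simp add: psum_def)
    moreover have "(\<Sum>i\<in>{1..Suc n}. X (i + (h + q)) \<omega>) = X (1 + (h + q)) \<omega> + (\<Sum>i\<in>{Suc 1..Suc n}. X (i + (h + q)) \<omega>)"
      by (rule sum.atLeast_Suc_atMost) simp
    moreover have "(\<Sum>i\<in>{Suc 1..Suc n}. X (i + (h + q)) \<omega>) = psum (h + Suc q) n \<omega>"
      unfolding psum_def sum.shift_bounds_cl_Suc_ivl by simp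
    ultimately show ?thesis by simp
  qed
  moreover have "\<bar>X (Suc n + (h + q)) \<omega>\<bar> \<le> B" "\<bar>X (1 + (h + q)) \<omega>\<bar> \<le> B" by (simp_all add: bounded \<omega>)
  ultimately have "\<bar>psum (h + q) n \<omega> - psum (h + Suc q) n \<omega>\<bar> \<le> 2 * B" by linarith
  then have "\<bar>psum h n \<omega> - psum (h + Suc q) n \<omega>\<bar> \<le> 2 * B * real q + 2 * B" using Suc by linarith
  then show ?case by (simp add: algebra_simps)
qed simp

definition mom4 :: "nat \<Rightarrow> real" where
  "mom4 n = expectation (\<lambda>\<omega>. (psum 0 n \<omega>)^4)"

lemma mom4_nonneg: "0 \<le> mom4 n"
  by (simp add: mom4_def integral_nonneg)

lemma L2_psum_sq: "L2 (\<lambda>\<omega>. (psum h n \<omega>)\<^sup>2)"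
proof (rule L2_bounded[of _ "(B * real n)\<^sup>2"])
  fix \<omega> assume "\<omega> \<in> space M"
  then have "\<bar>psum h n \<omega>\<bar>\<^sup>2 \<le> (B * real n)\<^sup>2" by (intro power_mono psum_bounded) simp_all
  then show "\<bar>(psum h n \<omega>)\<^sup>2\<bar> \<le> (B * real n)\<^sup>2" by simp
qed measurable

lemma integrable_psum4: "integrable M (\<lambda>\<omega>. (psum h n \<omega>)^4)"
  using L2_integrable_power2[OF L2_psum_sq[of h n]] by simp

lemma mom4_shift: "expectation (\<lambda>\<omega>. (psum h n \<omega>)^4) = mom4 n"
  unfolding mom4_def by (rule psum_stationary) measurable

text \<open>The squares of two separated sums are nearly uncorrelated. The error involves the fourth moment
itself, but with a factor that is small once the gap \<open>q\<close> is large.\<close>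

lemma expectation_sq_sq_le:
  assumes "1 \<le> n"
  shows "expectation (\<lambda>\<omega>. (psum 0 n \<omega>)\<^sup>2 * (psum (n + q) n \<omega>)\<^sup>2)
    \<le> (var_sum n)\<^sup>2 + rate (Suc q) * mom4 n"
proof -
  let ?U = "\<lambda>\<omega>. (psum 0 n \<omega>)\<^sup>2" and ?V = "\<lambda>\<omega>. (psum (n + q) n \<omega>)\<^sup>2"
  have "\<bar>covariance_rv M ?U ?V\<bar> \<le> rate (Suc q) * (L2norm (centered ?U) * L2norm (centered ?V))"
    by (rule covariance_le_rate[OF assms])
      (intro borel_measurable_power psum_past psum_future L2_psum_sq)+
  also have "\<dots> \<le> rate (Suc q) * (L2norm ?U * L2norm ?V)"
    by (intro mult_left_mono mult_mono L2norm_centered_le L2_psum_sq L2norm_nonneg rate_nonneg)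
  also have "L2norm ?U * L2norm ?V = mom4 n"
    by (simp add: L2norm_def mom4_shift mom4_nonneg)
  finally have "\<bar>covariance_rv M ?U ?V\<bar> \<le> rate (Suc q) * mom4 n" .
  moreover have "expectation ?V = var_sum n"
    unfolding var_sum_def by (rule psum_stationary) measurable
  then have "covariance_rv M ?U ?V = expectation (\<lambda>\<omega>. ?U \<omega> * ?V \<omega>) - (var_sum n)\<^sup>2"
    using covariance_eq[OF L2_psum_sq L2_psum_sq, of 0 n "n + q" n]
    by (simp add: var_sum_def power2_eq_square)
  ultimately show ?thesis by linarith
qed

text \<open>Two halves of the sum, separated by a gap of fixed length \<open>q\<close>, and a bounded rest.
The point is the factor \<open>3 < 4\<close>: since \<open>n\<^sup>2\<close> gains a factor \<open>4\<close> under doubling, iteration yields a bound of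
order \<open>n\<^sup>2\<close>.\<close>

lemma mom4_doubling:
  assumes q: "rate (Suc q) \<le> 1/250" and N: "2 \<le> N"
  shows "mom4 N \<le> 3 * mom4 (N div 2) + 82 * (var_sum (N div 2))\<^sup>2 + 9261 * (B * (2 * real q + 1))^4"
proof -
  define n where "n = N div 2"
  have n: "1 \<le> n" "N = n + n \<or> N = n + n + 1" using N by (auto simp: n_def)
  define K where "K = B * (2 * real q + 1)"
  let ?U = "psum 0 n" and ?V = "psum (n + q) n"
  have rest: "\<bar>psum 0 N \<omega> - (?U \<omega> + ?V \<omega>)\<bar> \<le> K" if \<omega>: "\<omega> \<in> space M" for \<omega>
  proof -
    have 1: "\<bar>psum 0 (n + n) \<omega> - (?U \<omega> + ?V \<omega>)\<bar> \<le> 2 * B * real q"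
      using psum_shift_le[OF \<omega>, of n n q] by (simp add: psum_add)
    have 2: "\<bar>psum 0 N \<omega> - psum 0 (n + n) \<omega>\<bar> \<le> B"
      using n(2)
    proof
      assume "N = n + n + 1"
      then have "psum 0 N \<omega> - psum 0 (n + n) \<omega> = psum (n + n) 1 \<omega>" using psum_add[of "n + n" 1 \<omega>] by simp
      then show ?thesis using psum_bounded[OF \<omega>, of "n + n" 1] by simp
    qed (simp add: B_nonneg)
    show ?thesis using 1 2 by (simp add: K_def algebra_simps)
  qed
  \<comment> \<open>\<open>21/16 = 7/6 * 9/8\<close> and \<open>245/3 = 7/6 * 70\<close>. After taking expectations the two
pure fourth powers give \<open>21/8\<close>, which together with \<open>245/3 * 1/250\<close> from the mixed term stays below \<open>3\<close>.\<close>
  have pw: "(psum 0 N \<omega>)^4 \<le> 21/16 * (?U \<omega>)^4 + 21/16 * (?V \<omega>)^4 + 245/3 * ((?U \<omega>)\<^sup>2 * (?V \<omega>)\<^sup>2) + 9261 * K^4"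
    if \<omega>: "\<omega> \<in> space M" for \<omega>
  proof -
    define g where "g = psum 0 N \<omega> - (?U \<omega> + ?V \<omega>)"
    have "g^4 \<le> K^4" using power_mono[OF rest[OF \<omega>], of 4] by (simp add: g_def)
    have "(psum 0 N \<omega>)^4 = ((?U \<omega> + ?V \<omega>) + g)^4" by (simp add: g_def)
    also have "\<dots> \<le> 7/6 * (?U \<omega> + ?V \<omega>)^4 + 9261 * g^4" by (rule fourth_power_perturb_le)
    also have "\<dots> \<le> 7/6 * (9/8 * ((?U \<omega>)^4 + (?V \<omega>)^4) + 70 * ((?U \<omega>)\<^sup>2 * (?V \<omega>)\<^sup>2)) + 9261 * K^4"
      by (intro add_mono mult_left_mono fourth_power_add_le \<open>g^4 \<le> K^4\<close>) simp_all
    finally show ?thesis by (simp add: algebra_simps)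
  qed
  have int: "integrable M (\<lambda>\<omega>. (?U \<omega>)\<^sup>2 * (?V \<omega>)\<^sup>2)" by (rule L2_integrable_mult[OF L2_psum_sq L2_psum_sq])
  have "mom4 N \<le> expectation (\<lambda>\<omega>. 21/16 * (?U \<omega>)^4 + 21/16 * (?V \<omega>)^4 + 245/3 * ((?U \<omega>)\<^sup>2 * (?V \<omega>)\<^sup>2) + 9261 * K^4)"
    unfolding mom4_def
    by (rule integral_mono[OF _ _ pw]) (simp_all add: integrable_psum4 int)
  also have "\<dots> = 21/16 * mom4 n + 21/16 * mom4 n + 245/3 * expectation (\<lambda>\<omega>. (?U \<omega>)\<^sup>2 * (?V \<omega>)\<^sup>2) + 9261 * K^4"
    by (simp add: integrable_psum4 int mom4_shift prob_space)
  also have "\<dots> \<le> 3 * mom4 n + 82 * (var_sum n)\<^sup>2 + 9261 * K^4"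
  proof -
    have "rate (Suc q) * mom4 n \<le> 1/250 * mom4 n" by (rule mult_right_mono[OF q mom4_nonneg])
    then have "expectation (\<lambda>\<omega>. (?U \<omega>)\<^sup>2 * (?V \<omega>)\<^sup>2) \<le> (var_sum n)\<^sup>2 + 1/250 * mom4 n"
      using expectation_sq_sq_le[OF n(1), of q] by linarith
    moreover have "0 \<le> (var_sum n)\<^sup>2" by simp
    ultimately show ?thesis using mom4_nonneg[of n] by linarith
  qed
  finally show ?thesis by (simp add: n_def K_def)
qed

text \<open>The constant \<open>D\<close> is chosen so that one quarter of it covers the inhomogeneous terms of the
recursion.\<close>

lemma mom4_bound: "\<exists>D\<ge>0. \<forall>n. mom4 n \<le> D * (real n)\<^sup>2"
proof -
  obtain q where "\<forall>n\<ge>q. norm (rate (Suc n) - 0) < 1/250"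
    using LIMSEQ_D[OF rate_tendsto_0, of "1/250"] by auto
  then have "norm (rate (Suc q) - 0) < 1/250" by blast
  then have q: "rate (Suc q) \<le> 1/250" by simp
  define C where "C = autocov 0 * (1 + 2 * total_rate)"
  define K where "K = B * (2 * real q + 1)"
  define D where "D = 82 * C\<^sup>2 + 4 * (9261 * K^4) + B^4"
  have C: "0 \<le> C" using autocov_0_nonneg total_rate_nonneg by (simp add: C_def)
  have D0: "0 \<le> D" by (simp add: D_def)
  have "mom4 n \<le> D * (real n)\<^sup>2" for n
  proof (induction n rule: less_induct)
    case (less N)
    consider "N = 0" | "N = 1" | "2 \<le> N" by linarith
    then show ?case
    proof cases
      case 1
      then show ?thesis by (simp add: mom4_def psum_def)
    next
      case 2
      have "mom4 1 \<le> expectation (\<lambda>_. B^4)"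
        unfolding mom4_def
      proof (rule integral_mono[OF integrable_psum4])
        fix \<omega> assume \<omega>: "\<omega> \<in> space M"
        have "\<bar>psum 0 1 \<omega>\<bar>^4 \<le> B^4" using psum_bounded[OF \<omega>, of 0 1] by (intro power_mono) simp_all
        then show "(psum 0 1 \<omega>)^4 \<le> B^4" by simp
      qed simp
      also have "\<dots> \<le> D" by (simp add: D_def prob_space)
      finally show ?thesis using 2 by simp
    next
      case 3
      define n where "n = N div 2"
      have nN: "real n \<le> real N / 2" by (simp add: n_def)
      then have n2: "(real n)\<^sup>2 \<le> (real N)\<^sup>2 / 4"
        using power_mono[OF nN, of 2] by (simp add: power_divide)
      have "mom4 n \<le> D * (real n)\<^sup>2" unfolding n_def by (rule less) (use 3 in simp)
      also have "\<dots> \<le> D * ((real N)\<^sup>2 / 4)" by (rule mult_left_mono[OF n2 D0])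
      finally have m: "mom4 n \<le> D * ((real N)\<^sup>2 / 4)" .
      have "(var_sum n)\<^sup>2 \<le> (real n * C)\<^sup>2"
        using var_sum_le[of n] var_sum_nonneg[of n] by (intro power_mono) (simp_all add: C_def)
      also have "\<dots> \<le> C\<^sup>2 * ((real N)\<^sup>2 / 4)"
        using mult_left_mono[OF n2, of "C\<^sup>2"] by (simp add: power_mult_distrib mult.commute)
      finally have v: "(var_sum n)\<^sup>2 \<le> C\<^sup>2 * ((real N)\<^sup>2 / 4)" .
      have "1 \<le> (real N)\<^sup>2" using 3 by (simp add: one_le_power)
      then have k: "9261 * K^4 \<le> 9261 * K^4 * (real N)\<^sup>2"
        using mult_left_mono[of 1 "(real N)\<^sup>2" "9261 * K^4"] by simp
      have b: "0 \<le> B^4 * ((real N)\<^sup>2 / 4)" by simp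
      have "mom4 N \<le> 3 * mom4 n + 82 * (var_sum n)\<^sup>2 + 9261 * K^4"
        using mom4_doubling[OF q 3] by (simp add: n_def K_def)
      also have "\<dots> \<le> 3 * (D * ((real N)\<^sup>2 / 4)) + 82 * (C\<^sup>2 * ((real N)\<^sup>2 / 4)) + 9261 * K^4 * (real N)\<^sup>2
          + B^4 * ((real N)\<^sup>2 / 4)"
        using m v k b by linarith
      also have "\<dots> = D * (real N)\<^sup>2" by (simp add: D_def algebra_simps)
      finally show ?thesis .
    qed
  qed
  then show ?thesis using D0 by blast
qed

end

section \<open>Characteristic functions of partial sums\<close>

lemma iexp_diff_le: "cmod (iexp a - iexp b) \<le> \<bar>a - b\<bar>"
proof -
  have "iexp a - iexp b = iexp b * (iexp (a - b) - 1)"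
    by (simp add: algebra_simps exp_add[symmetric])
  then have "cmod (iexp a - iexp b) = cmod (iexp (a - b) - 1)" by (simp add: norm_mult)
  then show ?thesis using iexp_approx1[of "a - b" 0] by simp
qed

text \<open>With \<open>c = n\<^sup>1\<^sup>/\<^sup>2\<close> this bounds the third absolute moment of a partial sum by its second and fourth
moments, all in the right order of magnitude.\<close>

lemma abs_cube_le:
  fixes s c :: real assumes "0 < c"
  shows "\<bar>s\<bar>^3 \<le> c * s\<^sup>2 + s^4 / c"
proof -
  have "2 * (c * \<bar>s\<bar>) \<le> c\<^sup>2 + s\<^sup>2"
    using sum_squares_bound[of c "\<bar>s\<bar>"] by (simp add: mult.assoc)
  then have "s\<^sup>2 * (c * \<bar>s\<bar>) \<le> s\<^sup>2 * (c\<^sup>2 + s\<^sup>2)"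
    using assms by (intro mult_left_mono) (auto intro: order_trans[rotated])
  then have "c * \<bar>s\<bar>^3 \<le> c * (c * s\<^sup>2 + s^4 / c)"
    using assms by (simp add: power2_eq_square power3_eq_cube power4_eq_xxxx algebra_simps abs_mult_self_eq)
  then show ?thesis using assms by simp
qed

context prob_space
begin

definition chf :: "('a \<Rightarrow> real) \<Rightarrow> real \<Rightarrow> complex" where
  "chf U t = expectation (\<lambda>\<omega>. iexp (t * U \<omega>))"

lemma integrable_iexp_mult: "U \<in> borel_measurable M \<Longrightarrow> integrable M (\<lambda>\<omega>. iexp (t * U \<omega>))"
  by (rule integrable_iexp) simp_all

lemma norm_chf_le_1: "U \<in> borel_measurable M \<Longrightarrow> cmod (chf U t) \<le> 1"
proof -
  assume "U \<in> borel_measurable M"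
  have "cmod (chf U t) \<le> expectation (\<lambda>\<omega>. cmod (iexp (t * U \<omega>)))"
    unfolding chf_def by (rule integral_norm_bound)
  then show ?thesis by (simp add: prob_space)
qed

lemma chf_char: "U \<in> borel_measurable M \<Longrightarrow> char (distr M borel U) t = chf U t"
  unfolding char_def chf_def by (subst integral_distr) auto

lemma chf_diff_le:
  assumes U: "L2 U" and V: "L2 V"
  shows "cmod (chf U t - chf V t) \<le> \<bar>t\<bar> * L2norm (\<lambda>\<omega>. U \<omega> - V \<omega>)"
proof -
  have D: "L2 (\<lambda>\<omega>. U \<omega> - V \<omega>)" by (rule L2_diff[OF U V])
  have iU: "integrable M (\<lambda>\<omega>. iexp (t * U \<omega>))" and iV: "integrable M (\<lambda>\<omega>. iexp (t * V \<omega>))"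
    by (rule integrable_iexp_mult[OF L2_measurable[OF U]], rule integrable_iexp_mult[OF L2_measurable[OF V]])
  have "chf U t - chf V t = expectation (\<lambda>\<omega>. iexp (t * U \<omega>) - iexp (t * V \<omega>))"
    unfolding chf_def by (rule Bochner_Integration.integral_diff[symmetric, OF iU iV])
  then have "cmod (chf U t - chf V t) \<le> expectation (\<lambda>\<omega>. cmod (iexp (t * U \<omega>) - iexp (t * V \<omega>)))"
    by (simp only: integral_norm_bound)
  also have "\<dots> \<le> expectation (\<lambda>\<omega>. \<bar>t\<bar> * \<bar>U \<omega> - V \<omega>\<bar>)"
  proof (rule integral_mono)
    show "integrable M (\<lambda>\<omega>. cmod (iexp (t * U \<omega>) - iexp (t * V \<omega>)))"
      by (rule integrable_norm[OF Bochner_Integration.integrable_diff[OF iU iV]])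
    show "integrable M (\<lambda>\<omega>. \<bar>t\<bar> * \<bar>U \<omega> - V \<omega>\<bar>)"
      by (rule integrable_mult_right[OF L2_integrable[OF L2_abs[OF D]]])
    fix \<omega>
    show "cmod (iexp (t * U \<omega>) - iexp (t * V \<omega>)) \<le> \<bar>t\<bar> * \<bar>U \<omega> - V \<omega>\<bar>"
      using iexp_diff_le[of "t * U \<omega>" "t * V \<omega>"] by (simp only: abs_mult flip: right_diff_distrib)
  qed
  also have "\<dots> \<le> \<bar>t\<bar> * L2norm (\<lambda>\<omega>. U \<omega> - V \<omega>)"
    using mult_left_mono[OF abs_expectation_le_L2norm[OF D], of "\<bar>t\<bar>"] by simp
  finally show ?thesis .
qed

end

context rho_mixing_process
begin

text \<open>Split into cosine and sine, the defect of multiplicativity is a combination of four covariances, each of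
variables with \<open>L\<^sup>2\<close> norm at most one.\<close>

lemma chf_add_mixing:
  assumes m: "1 \<le> m"
    and U: "U \<in> borel_measurable (sigma_gen M X {1..m})"
    and V: "V \<in> borel_measurable (sigma_gen M X {m + Suc q..})"
  shows "cmod (chf (\<lambda>\<omega>. U \<omega> + V \<omega>) t - chf U t * chf V t) \<le> 4 * rate (Suc q)"
proof -
  have UM: "U \<in> borel_measurable M"
    by (rule borel_measurable_finer[OF U]) (simp_all add: sets_past)
  have VM: "V \<in> borel_measurable M"
    by (rule borel_measurable_finer[OF V]) (simp_all add: sets_past)
  define c1 where "c1 \<omega> = cos (t * U \<omega>)" for \<omega>
  define s1 where "s1 \<omega> = sin (t * U \<omega>)" for \<omega>
  define c2 where "c2 \<omega> = cos (t * V \<omega>)" for \<omega>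
  define s2 where "s2 \<omega> = sin (t * V \<omega>)" for \<omega>
  have past: "c1 \<in> borel_measurable (sigma_gen M X {1..m})" "s1 \<in> borel_measurable (sigma_gen M X {1..m})"
    unfolding c1_def[abs_def] s1_def[abs_def] using U by measurable
  have future: "c2 \<in> borel_measurable (sigma_gen M X {m + Suc q..})" "s2 \<in> borel_measurable (sigma_gen M X {m + Suc q..})"
    unfolding c2_def[abs_def] s2_def[abs_def] using V by measurable
  have meas: "c1 \<in> borel_measurable M" "s1 \<in> borel_measurable M" "c2 \<in> borel_measurable M" "s2 \<in> borel_measurable M"
    unfolding c1_def[abs_def] s1_def[abs_def] c2_def[abs_def] s2_def[abs_def] using UM VM by measurable
  have bnd: "\<bar>c1 \<omega>\<bar> \<le> 1" "\<bar>s1 \<omega>\<bar> \<le> 1" "\<bar>c2 \<omega>\<bar> \<le> 1" "\<bar>s2 \<omega>\<bar> \<le> 1" for \<omega>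
    by (simp_all add: c1_def c2_def s1_def s2_def)
  have unit: "L2 f \<and> L2norm (centered f) \<le> 1"
    if f: "f \<in> borel_measurable M" "\<And>\<omega>. \<bar>f \<omega>\<bar> \<le> 1" for f
  proof
    show l2: "L2 f" by (rule L2_bounded[OF f])
    show "L2norm (centered f) \<le> 1"
      by (rule order_trans[OF L2norm_centered_le[OF l2] L2norm_bounded[OF f]]) simp
  qed
  note l2 = unit[OF meas(1) bnd(1), THEN conjunct1] unit[OF meas(2) bnd(2), THEN conjunct1]
    unit[OF meas(3) bnd(3), THEN conjunct1] unit[OF meas(4) bnd(4), THEN conjunct1]
  note nrm = unit[OF meas(1) bnd(1), THEN conjunct2] unit[OF meas(2) bnd(2), THEN conjunct2]
    unit[OF meas(3) bnd(3), THEN conjunct2] unit[OF meas(4) bnd(4), THEN conjunct2]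
  have cov: "\<bar>expectation (\<lambda>\<omega>. f \<omega> * g \<omega>) - expectation f * expectation g\<bar> \<le> rate (Suc q)"
    if f: "f \<in> borel_measurable (sigma_gen M X {1..m})" "L2 f" "L2norm (centered f) \<le> 1"
      and g: "g \<in> borel_measurable (sigma_gen M X {m + Suc q..})" "L2 g" "L2norm (centered g) \<le> 1" for f g
  proof -
    have "L2norm (centered f) * L2norm (centered g) \<le> 1"
      using f(3) g(3) by (intro mult_le_one) simp_all
    then have "rate (Suc q) * (L2norm (centered f) * L2norm (centered g)) \<le> rate (Suc q)"
      using mult_left_mono[of _ 1 "rate (Suc q)"] by simp
    then show ?thesis
      using covariance_le_rate[OF m f(1,2) g(1,2)] by (simp add: covariance_eq[OF f(2) g(2)])
  qed
  have chf_eq: "chf W t = Complex (expectation (\<lambda>\<omega>. cos (t * W \<omega>))) (expectation (\<lambda>\<omega>. sin (t * W \<omega>)))"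
    if W: "W \<in> borel_measurable M" for W
  proof -
    note i = integrable_iexp_mult[OF W, of t]
    have "Re (chf W t) = expectation (\<lambda>\<omega>. cos (t * W \<omega>))"
      unfolding chf_def using integral_Re[OF i] by (simp add: Re_exp)
    moreover have "Im (chf W t) = expectation (\<lambda>\<omega>. sin (t * W \<omega>))"
      unfolding chf_def using integral_Im[OF i] by (simp add: Im_exp)
    ultimately show ?thesis by (simp add: complex_eq_iff)
  qed
  have "expectation (\<lambda>\<omega>. cos (t * (U \<omega> + V \<omega>))) = expectation (\<lambda>\<omega>. c1 \<omega> * c2 \<omega>) - expectation (\<lambda>\<omega>. s1 \<omega> * s2 \<omega>)"
    using L2_integrable_mult[OF l2(1,3)] L2_integrable_mult[OF l2(2,4)]
    by (simp add: c1_def c2_def s1_def s2_def distrib_left cos_add)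
  moreover have "expectation (\<lambda>\<omega>. sin (t * (U \<omega> + V \<omega>))) = expectation (\<lambda>\<omega>. s1 \<omega> * c2 \<omega>) + expectation (\<lambda>\<omega>. c1 \<omega> * s2 \<omega>)"
    using L2_integrable_mult[OF l2(2,3)] L2_integrable_mult[OF l2(1,4)]
    by (simp add: c1_def c2_def s1_def s2_def distrib_left sin_add)
  moreover have UV: "(\<lambda>\<omega>. U \<omega> + V \<omega>) \<in> borel_measurable M" using UM VM by measurable
  ultimately have eq: "chf (\<lambda>\<omega>. U \<omega> + V \<omega>) t - chf U t * chf V t = Complex
      ((expectation (\<lambda>\<omega>. c1 \<omega> * c2 \<omega>) - expectation c1 * expectation c2)
        - (expectation (\<lambda>\<omega>. s1 \<omega> * s2 \<omega>) - expectation s1 * expectation s2))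
      ((expectation (\<lambda>\<omega>. s1 \<omega> * c2 \<omega>) - expectation s1 * expectation c2)
        + (expectation (\<lambda>\<omega>. c1 \<omega> * s2 \<omega>) - expectation c1 * expectation s2))"
    unfolding chf_eq[OF UV] chf_eq[OF UM] chf_eq[OF VM]
    by (simp add: complex_eq_iff c1_def[abs_def] c2_def[abs_def] s1_def[abs_def] s2_def[abs_def])
  have "cmod (Complex a b) \<le> \<bar>a\<bar> + \<bar>b\<bar>" for a b using cmod_le[of "Complex a b"] by simp
  note this[of "(expectation (\<lambda>\<omega>. c1 \<omega> * c2 \<omega>) - expectation c1 * expectation c2)
        - (expectation (\<lambda>\<omega>. s1 \<omega> * s2 \<omega>) - expectation s1 * expectation s2)"
      "(expectation (\<lambda>\<omega>. s1 \<omega> * c2 \<omega>) - expectation s1 * expectation c2)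
        + (expectation (\<lambda>\<omega>. c1 \<omega> * s2 \<omega>) - expectation c1 * expectation s2)"]
  then show ?thesis
    unfolding eq
    using cov[OF past(1) l2(1) nrm(1) future(1) l2(3) nrm(3)] cov[OF past(2) l2(2) nrm(2) future(2) l2(4) nrm(4)]
      cov[OF past(2) l2(2) nrm(2) future(1) l2(3) nrm(3)] cov[OF past(1) l2(1) nrm(1) future(2) l2(4) nrm(4)]
    by linarith
qed

end

context bounded_rho_mixing
begin

abbreviation "\<psi> n t \<equiv> chf (psum 0 n) t"

lemma chf_psum_shift: "chf (psum h n) t = \<psi> n t"
  unfolding chf_def by (rule psum_stationary[where g = "\<lambda>x. iexp (t * x)"]) measurable

text \<open>The sum over the second stretch is first moved away by \<open>q\<close> steps, at the cost of at most \<open>2 B q\<close>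
pointwise, and is then almost independent of the first one.\<close>

lemma chf_psum_add:
  assumes "1 \<le> m"
  shows "cmod (\<psi> (m + n) t - \<psi> m t * \<psi> n t) \<le> 4 * rate (Suc q) + 2 * B * real q * \<bar>t\<bar>"
proof -
  let ?V = "psum (m + q) n"
  have 1: "cmod (chf (\<lambda>\<omega>. psum 0 m \<omega> + ?V \<omega>) t - \<psi> m t * \<psi> n t) \<le> 4 * rate (Suc q)"
    using chf_add_mixing[OF assms psum_past psum_future[of m q n], of t]
    unfolding chf_psum_shift[of "m + q" n t] .
  have l2: "L2 (\<lambda>\<omega>. psum 0 m \<omega> + ?V \<omega>)" by (rule L2_add[OF L2_psum L2_psum])
  have "L2norm (\<lambda>\<omega>. psum 0 (m + n) \<omega> - (psum 0 m \<omega> + ?V \<omega>)) \<le> 2 * B * real q"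
  proof (rule L2norm_bounded)
    fix \<omega> assume "\<omega> \<in> space M"
    then show "\<bar>psum 0 (m + n) \<omega> - (psum 0 m \<omega> + ?V \<omega>)\<bar> \<le> 2 * B * real q"
      using psum_shift_le[of \<omega> m n q] by (simp add: psum_add)
  qed (simp_all add: B_nonneg)
  from mult_left_mono[OF this abs_ge_zero[of t]]
  have 2: "cmod (\<psi> (m + n) t - chf (\<lambda>\<omega>. psum 0 m \<omega> + ?V \<omega>) t) \<le> \<bar>t\<bar> * (2 * B * real q)"
    by (rule order_trans[OF chf_diff_le[OF L2_psum l2]])
  have "cmod (\<psi> (m + n) t - \<psi> m t * \<psi> n t) \<le> cmod (\<psi> (m + n) t - chf (\<lambda>\<omega>. psum 0 m \<omega> + ?V \<omega>) t)
     + cmod (chf (\<lambda>\<omega>. psum 0 m \<omega> + ?V \<omega>) t - \<psi> m t * \<psi> n t)"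
    using dist_triangle[of "\<psi> (m + n) t" "\<psi> m t * \<psi> n t" "chf (\<lambda>\<omega>. psum 0 m \<omega> + ?V \<omega>) t"]
    unfolding dist_norm .
  also have "\<dots> \<le> \<bar>t\<bar> * (2 * B * real q) + 4 * rate (Suc q)" by (rule add_mono[OF 2 1])
  also have "\<bar>t\<bar> * (2 * B * real q) = 2 * B * real q * \<bar>t\<bar>" by (rule mult.commute)
  finally show ?thesis by linarith
qed

lemma chf_psum_power:
  assumes p: "1 \<le> p"
  shows "cmod (\<psi> (r * p) t - \<psi> p t ^ r) \<le> real r * (4 * rate (Suc q) + 2 * B * real q * \<bar>t\<bar>)"
proof (induction r)
  case 0
  have "\<psi> 0 t = 1" by (simp add: chf_def psum_def prob_space)
  then show ?case by simp
next
  case (Suc r)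
  let ?e = "4 * rate (Suc q) + 2 * B * real q * \<bar>t\<bar>"
  have "\<psi> (Suc r * p) t - \<psi> p t ^ Suc r
      = (\<psi> (p + r * p) t - \<psi> p t * \<psi> (r * p) t) + \<psi> p t * (\<psi> (r * p) t - \<psi> p t ^ r)"
    by (simp add: algebra_simps)
  then have "cmod (\<psi> (Suc r * p) t - \<psi> p t ^ Suc r) \<le> cmod (\<psi> (p + r * p) t - \<psi> p t * \<psi> (r * p) t)
      + cmod (\<psi> p t) * cmod (\<psi> (r * p) t - \<psi> p t ^ r)"
    by (metis norm_mult norm_triangle_ineq)
  also have "\<dots> \<le> ?e + 1 * (real r * ?e)"
    by (intro add_mono mult_mono chf_psum_add[OF p] norm_chf_le_1 Suc.IH psum_measurable) simp_all
  finally show ?case by (simp add: algebra_simps)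
qed

lemma chf_psum_diff:
  assumes "m \<le> n"
  shows "cmod (\<psi> n t - \<psi> m t) \<le> \<bar>t\<bar> * (B * real (n - m))"
proof -
  have "L2norm (\<lambda>\<omega>. psum 0 n \<omega> - psum 0 m \<omega>) \<le> B * real (n - m)"
  proof (rule L2norm_bounded)
    fix \<omega> assume "\<omega> \<in> space M"
    then show "\<bar>psum 0 n \<omega> - psum 0 m \<omega>\<bar> \<le> B * real (n - m)"
      using psum_add[of m "n - m" \<omega>] psum_bounded[of \<omega> m "n - m"] assms by simp
  qed (simp_all add: B_nonneg)
  from mult_left_mono[OF this abs_ge_zero[of t]] show ?thesis
    by (rule order_trans[OF chf_diff_le[OF L2_psum L2_psum]])
qed

text \<open>The remainder is of order \<open>(\<bar>t\<bar> p\<^sup>1\<^sup>/\<^sup>2)\<^sup>3\<close>, uniformly in the length \<open>p\<close> of the block; this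
replaces the Lindeberg condition.\<close>

lemma chf_psum_taylor:
  obtains C where "0 \<le> C"
    "\<And>p t. 1 \<le> p \<Longrightarrow> cmod (\<psi> p t - (1 - t\<^sup>2 * var_sum p / 2)) \<le> \<bar>t\<bar>^3 * (C * (real p * sqrt (real p)))"
proof -
  obtain D where D: "0 \<le> D" "\<And>n. mom4 n \<le> D * (real n)\<^sup>2" using mom4_bound by blast
  define G where "G = autocov 0 * (1 + 2 * total_rate)"
  have G: "0 \<le> G" using autocov_0_nonneg total_rate_nonneg by (simp add: G_def)
  show ?thesis
  proof (rule that[of "(G + D) / 6"])
    show "0 \<le> (G + D) / 6" using G D(1) by simp
    fix p :: nat and t :: real assume p: "1 \<le> p"
    have sp: "0 < sqrt (real p)" using p by simp
    let ?S = "psum 0 p"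
    have "cmod (char (distr M borel ?S) t - (1 - t\<^sup>2 * var_sum p / 2))
        \<le> (t\<^sup>2 / 6) * expectation (\<lambda>\<omega>. min (6 * (?S \<omega>)\<^sup>2) (\<bar>t\<bar> * \<bar>?S \<omega>\<bar>^3))"
      by (rule char_approx3')
        (simp_all add: L2_integrable L2_psum L2_integrable_power2 mean_psum var_sum_def)
    also have "\<dots> \<le> (t\<^sup>2 / 6) * (\<bar>t\<bar> * ((G + D) * (real p * sqrt (real p))))"
    proof (rule mult_left_mono)
      have "expectation (\<lambda>\<omega>. min (6 * (?S \<omega>)\<^sup>2) (\<bar>t\<bar> * \<bar>?S \<omega>\<bar>^3))
          \<le> expectation (\<lambda>\<omega>. \<bar>t\<bar> * (sqrt (real p) * (?S \<omega>)\<^sup>2 + (?S \<omega>)^4 / sqrt (real p)))"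
      proof (rule integral_mono')
        show "integrable M (\<lambda>\<omega>. \<bar>t\<bar> * (sqrt (real p) * (?S \<omega>)\<^sup>2 + (?S \<omega>)^4 / sqrt (real p)))"
          by (simp add: integrable_psum4 L2_integrable_power2 L2_psum)
        fix \<omega>
        show "min (6 * (?S \<omega>)\<^sup>2) (\<bar>t\<bar> * \<bar>?S \<omega>\<bar>^3) \<le> \<bar>t\<bar> * (sqrt (real p) * (?S \<omega>)\<^sup>2 + (?S \<omega>)^4 / sqrt (real p))"
          by (rule min.coboundedI2, rule mult_left_mono[OF abs_cube_le[OF sp]]) simp
        show "0 \<le> \<bar>t\<bar> * (sqrt (real p) * (?S \<omega>)\<^sup>2 + (?S \<omega>)^4 / sqrt (real p))" by simp
      qed
      also have "\<dots> = \<bar>t\<bar> * (sqrt (real p) * var_sum p + mom4 p / sqrt (real p))"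
        by (simp add: integrable_psum4 L2_integrable_power2 L2_psum var_sum_def mom4_def)
      also have "\<dots> \<le> \<bar>t\<bar> * (sqrt (real p) * (real p * G) + D * (real p)\<^sup>2 / sqrt (real p))"
        by (intro mult_left_mono add_mono divide_right_mono D(2)) (simp_all add: G_def var_sum_le)
      also have "(real p)\<^sup>2 / sqrt (real p) = real p * sqrt (real p)"
        using p by (simp add: power2_eq_square real_div_sqrt flip: times_divide_eq_right)
      then have "\<bar>t\<bar> * (sqrt (real p) * (real p * G) + D * (real p)\<^sup>2 / sqrt (real p))
          = \<bar>t\<bar> * ((G + D) * (real p * sqrt (real p)))"
        by (simp add: algebra_simps flip: times_divide_eq_right)
      finally show "expectation (\<lambda>\<omega>. min (6 * (?S \<omega>)\<^sup>2) (\<bar>t\<bar> * \<bar>?S \<omega>\<bar>^3))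
          \<le> \<bar>t\<bar> * ((G + D) * (real p * sqrt (real p)))" .
    qed simp
    also have "\<dots> = \<bar>t\<bar>^3 * ((G + D) / 6 * (real p * sqrt (real p)))"
      by (simp add: power2_eq_square power3_eq_cube)
    finally show "cmod (\<psi> p t - (1 - t\<^sup>2 * var_sum p / 2)) \<le> \<bar>t\<bar>^3 * ((G + D) / 6 * (real p * sqrt (real p)))"
      by (simp add: chf_char)
  qed
qed

end

lemma tendsto_div_ratio:
  assumes "1 \<le> r"
  shows "(\<lambda>n. real (n div r) / real n) \<longlonglongrightarrow> 1 / real r"
proof -
  have "(\<lambda>n. real (n div r) / real n - 1 / real r) \<longlonglongrightarrow> 0"
  proof (rule Lim_null_comparison[OF _ lim_inverse_n])
    show "\<forall>\<^sub>F n in sequentially. norm (real (n div r) / real n - 1 / real r) \<le> inverse (real n)"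
    proof (rule eventually_sequentiallyI[of 1])
      fix n :: nat assume n: "1 \<le> n"
      have "real n = real r * real (n div r) + real (n mod r)"
        by (metis mult_div_mod_eq of_nat_add of_nat_mult)
      then have "real (n div r) / real n - 1 / real r = - (real (n mod r) / real r) / real n"
        using n assms by (simp add: field_simps)
      then have "norm (real (n div r) / real n - 1 / real r) = (real (n mod r) / real r) / real n"
        by simp
      also have "\<dots> \<le> 1 / real n"
        using assms mod_less_divisor[of r n]
        by (intro divide_right_mono) (simp_all add: divide_le_eq less_imp_le)
      finally show "norm (real (n div r) / real n - 1 / real r) \<le> inverse (real n)"
        by (simp add: inverse_eq_divide)
    qed
  qed
  then show ?thesis by (simp only: LIM_zero_iff)
qed

lemma filterlim_div_at_top: "1 \<le> r \<Longrightarrow> filterlim (\<lambda>n. n div r) at_top (at_top :: nat filter)"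
  unfolding filterlim_at_top
proof
  fix Z assume r: "1 \<le> r"
  show "\<forall>\<^sub>F n in sequentially. Z \<le> n div r"
  proof (rule eventually_sequentiallyI[of "Z * r"])
    fix n assume "Z * r \<le> n"
    then show "Z \<le> n div r" using r by (simp add: less_eq_div_iff_mult_less_eq)
  qed
qed

lemma tendsto_over_sqrt: "(\<lambda>n. c / sqrt (real n)) \<longlonglongrightarrow> 0"
proof -
  have "(\<lambda>n. c * inverse (sqrt (real n))) \<longlonglongrightarrow> c * 0"
    by (intro tendsto_mult tendsto_const tendsto_inverse_0_at_top
        filterlim_compose[OF sqrt_at_top filterlim_real_sequentially])
  then show ?thesis by (simp add: divide_inverse)
qed

context bounded_rho_mixing
begin

lemma block_variance_tendsto:
  assumes r: "1 \<le> r"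
  shows "(\<lambda>n. (t / sqrt (real n))\<^sup>2 * var_sum (n div r) / 2) \<longlonglongrightarrow> t\<^sup>2 * long_run_variance / (2 * real r)"
proof -
  have "(\<lambda>n. t\<^sup>2 / 2 * (var_sum (n div r) / real (n div r)) * (real (n div r) / real n))
      \<longlonglongrightarrow> t\<^sup>2 / 2 * long_run_variance * (1 / real r)"
    by (intro tendsto_mult tendsto_const tendsto_div_ratio[OF r]
        filterlim_compose[OF var_sum_tendsto filterlim_div_at_top[OF r]])
  then have lim: "(\<lambda>n. t\<^sup>2 / 2 * (var_sum (n div r) / real (n div r)) * (real (n div r) / real n))
      \<longlonglongrightarrow> t\<^sup>2 * long_run_variance / (2 * real r)"
    by simp
  show ?thesis
  proof (rule Lim_transform_eventually[OF lim], rule eventually_sequentiallyI[of r])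
    fix n assume n: "r \<le> n"
    then have "0 < n div r" using r by (simp add: div_greater_zero_iff)
    then have "real (n div r) \<noteq> 0" by simp
    then have eq: "t\<^sup>2 / 2 * (v / real (n div r)) * (real (n div r) / real n) = t\<^sup>2 * v / (2 * real n)" for v :: real
      by simp
    show "t\<^sup>2 / 2 * (var_sum (n div r) / real (n div r)) * (real (n div r) / real n)
        = (t / sqrt (real n))\<^sup>2 * var_sum (n div r) / 2"
      unfolding eq by (simp add: power_divide)
  qed
qed

text \<open>For a fixed number \<open>r\<close> of blocks of length \<open>n div r\<close> the characteristic function is, up to errors that vanish
for \<open>n \<rightarrow> \<infinity>\<close> and then for a growing gap \<open>q\<close>, the \<open>r\<close>-th power of that of one block. Replacing each factor
by its second order expansion costs \<open>r\<close> times an error of order \<open>r\<^sup>-\<^sup>3\<^sup>/\<^sup>2\<close>, and the expansion tends to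
\<open>1 - t\<^sup>2 \<sigma>\<^sup>2 / (2 r)\<close>, whose \<open>r\<close>-th power is close to the Gaussian limit for large \<open>r\<close>.\<close>

theorem chf_psum_tendsto:
  "(\<lambda>n. \<psi> n (t / sqrt (real n))) \<longlonglongrightarrow> complex_of_real (exp (- (t\<^sup>2 * long_run_variance / 2)))"
proof (rule tendstoI)
  fix e :: real assume e: "0 < e"
  let ?L = "complex_of_real (exp (- (t\<^sup>2 * long_run_variance / 2)))"
  obtain C where C: "0 \<le> C"
    "\<And>p t. 1 \<le> p \<Longrightarrow> cmod (\<psi> p t - (1 - t\<^sup>2 * var_sum p / 2)) \<le> \<bar>t\<bar>^3 * (C * (real p * sqrt (real p)))"
    using chf_psum_taylor by metis
  define G where "G = autocov 0 * (1 + 2 * total_rate)"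
  have G: "0 \<le> G" "\<And>n. var_sum n \<le> real n * G"
    using autocov_0_nonneg total_rate_nonneg var_sum_le by (simp_all add: G_def)
  have ev1: "\<forall>\<^sub>F r in sequentially. \<bar>t\<bar>^3 * C / sqrt (real r) < e / 5"
    using order_tendstoD(2)[OF tendsto_over_sqrt, of "e / 5" "\<bar>t\<bar>^3 * C"] e by simp
  have "(\<lambda>r. (1 + (- (t\<^sup>2 * long_run_variance / 2)) / real r) ^ r) \<longlonglongrightarrow> exp (- (t\<^sup>2 * long_run_variance / 2))"
    by (rule tendsto_exp_limit_sequentially)
  then have ev2: "\<forall>\<^sub>F r in sequentially.
      dist ((1 + (- (t\<^sup>2 * long_run_variance / 2)) / real r) ^ r) (exp (- (t\<^sup>2 * long_run_variance / 2))) < e / 5"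
    by (rule tendstoD) (use e in simp)
  \<comment> \<open>This condition on \<open>r\<close> keeps the second order expansion \<open>w n\<close> below in the unit interval.\<close>
  have ev3: "\<forall>\<^sub>F r in sequentially. t\<^sup>2 * G / 4 \<le> real r"
    using filterlim_real_sequentially unfolding filterlim_at_top by blast
  have "\<forall>\<^sub>F r in sequentially. 1 \<le> r \<and> \<bar>t\<bar>^3 * C / sqrt (real r) < e / 5
      \<and> dist ((1 + (- (t\<^sup>2 * long_run_variance / 2)) / real r) ^ r) (exp (- (t\<^sup>2 * long_run_variance / 2))) < e / 5
      \<and> t\<^sup>2 * G / 4 \<le> real r"
    using eventually_ge_at_top[of 1] ev1 ev2 ev3 by eventually_elim blast
  then obtain r where r: "1 \<le> r" "\<bar>t\<bar>^3 * C / sqrt (real r) < e / 5"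
      "dist ((1 + (- (t\<^sup>2 * long_run_variance / 2)) / real r) ^ r) (exp (- (t\<^sup>2 * long_run_variance / 2))) < e / 5"
      "t\<^sup>2 * G / 4 \<le> real r"
    unfolding eventually_sequentially by blast
  have "(\<lambda>q. 4 * real r * rate (Suc q)) \<longlonglongrightarrow> 4 * real r * 0"
    by (rule tendsto_mult[OF tendsto_const rate_tendsto_0])
  then have "\<forall>\<^sub>F q in sequentially. 4 * real r * rate (Suc q) < e / 5"
    by (rule order_tendstoD(2)) (use e in simp)
  then obtain q where q: "4 * real r * rate (Suc q) < e / 5"
    unfolding eventually_sequentially by blast
  define \<theta> where "\<theta> n = t / sqrt (real n)" for n
  define w where "w n = 1 - (\<theta> n)\<^sup>2 * var_sum (n div r) / 2" for n
  have ev4: "\<forall>\<^sub>F n in sequentially. \<bar>t\<bar> * (B * real r + real r * (2 * B * real q)) / sqrt (real n) < e / 5"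
    using order_tendstoD(2)[OF tendsto_over_sqrt, of "e / 5"] e by simp
  have "w \<longlonglongrightarrow> 1 - t\<^sup>2 * long_run_variance / (2 * real r)"
    unfolding w_def[abs_def] \<theta>_def by (rule tendsto_diff[OF tendsto_const block_variance_tendsto[OF r(1)]])
  then have "(\<lambda>n. w n ^ r) \<longlonglongrightarrow> (1 - t\<^sup>2 * long_run_variance / (2 * real r)) ^ r" by (rule tendsto_power)
  then have ev5: "\<forall>\<^sub>F n in sequentially. dist (w n ^ r) ((1 - t\<^sup>2 * long_run_variance / (2 * real r)) ^ r) < e / 5"
    by (rule tendstoD) (use e in simp)
  show "\<forall>\<^sub>F n in sequentially. dist (\<psi> n (t / sqrt (real n))) ?L < e"
    using ev4 ev5 eventually_ge_at_top[of r]
  proof eventually_elim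
    fix n assume n4: "\<bar>t\<bar> * (B * real r + real r * (2 * B * real q)) / sqrt (real n) < e / 5"
      and n5: "dist (w n ^ r) ((1 - t\<^sup>2 * long_run_variance / (2 * real r)) ^ r) < e / 5" and n: "r \<le> n"
    define p where "p = n div r"
    define x where "x = \<theta> n"
    have p: "1 \<le> p" using n r(1) by (simp add: p_def Suc_le_eq div_greater_zero_iff)
    have n0: "0 < real n" using n r(1) by simp
    have abs_x: "\<bar>x\<bar> = \<bar>t\<bar> / sqrt (real n)" by (simp add: x_def \<theta>_def abs_divide)
    have x2: "x\<^sup>2 = t\<^sup>2 / real n" by (simp add: x_def \<theta>_def power_divide)
    have pn: "real p \<le> real n / real r" 
    proof -
      have "real (p * r) \<le> real n" by (simp only: of_nat_le_iff p_def div_times_less_eq_dividend)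
      then show ?thesis using r(1) by (simp add: le_divide_eq)
    qed
    \<comment> \<open>The fewer than \<open>r\<close> terms outside the blocks.\<close>
    have d1: "cmod (\<psi> n x - \<psi> (r * p) x) \<le> \<bar>x\<bar> * (B * real r)"
    proof -
      have le: "r * p \<le> n" by (simp add: p_def)
      have "n - r * p = n mod r" by (simp add: p_def minus_mult_div_eq_mod)
      then have "real (n - r * p) \<le> real r" using mod_less_divisor[of r n] r(1) by simp
      then have "\<bar>x\<bar> * (B * real (n - r * p)) \<le> \<bar>x\<bar> * (B * real r)"
        by (intro mult_left_mono B_nonneg) simp_all
      then show ?thesis using chf_psum_diff[OF le, of x] by (rule order_trans[rotated])
    qed
    have d2: "cmod (\<psi> (r * p) x - \<psi> p x ^ r) \<le> real r * (4 * rate (Suc q) + 2 * B * real q * \<bar>x\<bar>)"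
      by (rule chf_psum_power[OF p])
    have wn: "w n = 1 - x\<^sup>2 * var_sum p / 2" by (simp add: w_def x_def p_def)
    have w1: "\<bar>w n\<bar> \<le> 1"
    proof -
      have "x\<^sup>2 * var_sum p \<le> t\<^sup>2 / real n * (real n / real r * G)"
        unfolding x2 using order_trans[OF G(2) mult_right_mono[OF pn G(1)]] by (intro mult_left_mono) simp_all
      also have "\<dots> = t\<^sup>2 * G / real r" using n0 by simp
      also have "\<dots> \<le> 4" using r(1,4) by (simp add: divide_le_eq)
      finally have "x\<^sup>2 * var_sum p \<le> 4" .
      moreover have "0 \<le> x\<^sup>2 * var_sum p" by (simp add: var_sum_nonneg)
      ultimately show ?thesis unfolding wn by linarith
    qed
    have d3: "cmod (\<psi> p x ^ r - complex_of_real (w n) ^ r) \<le> \<bar>t\<bar>^3 * C / sqrt (real r)"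
    proof -
      have "cmod (\<psi> p x ^ r - complex_of_real (w n) ^ r) \<le> real r * cmod (\<psi> p x - complex_of_real (w n))"
        by (rule norm_power_diff) (simp_all add: norm_chf_le_1 w1)
      also have "\<dots> \<le> real r * (\<bar>x\<bar>^3 * (C * (real p * sqrt (real p))))"
        using C(2)[OF p, of x] by (intro mult_left_mono) (simp_all add: wn)
      also have "\<dots> \<le> real r * (\<bar>x\<bar>^3 * (C * ((real n / real r) * sqrt (real n / real r))))"
        by (intro mult_left_mono mult_mono real_sqrt_le_mono pn C(1)) simp_all
      also have "\<dots> = \<bar>t\<bar>^3 * C / sqrt (real r)"
      proof -
        define a where "a = sqrt (real n)"
        define b where "b = sqrt (real r)"
        have ab: "real n = a * a" "real r = b * b" "0 < a" "0 < b"
          using n0 r(1) by (simp_all add: a_def b_def)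
        have "sqrt (real n / real r) = a / b" by (simp add: a_def b_def real_sqrt_divide)
        moreover have "\<bar>x\<bar> = \<bar>t\<bar> / a" by (simp add: abs_x a_def)
        ultimately show ?thesis
          using ab(3,4) unfolding b_def[symmetric] by (simp add: ab(1,2) power3_eq_cube)
      qed
      finally show ?thesis .
    qed
    have d4: "cmod (complex_of_real (w n) ^ r - ?L) < 2 * (e / 5)"
    proof -
      have "(1 - t\<^sup>2 * long_run_variance / (2 * real r)) = 1 + (- (t\<^sup>2 * long_run_variance / 2)) / real r" by simp
      then have "dist (w n ^ r) (exp (- (t\<^sup>2 * long_run_variance / 2))) < e / 5 + e / 5"
        using n5 r(3) dist_triangle[of "w n ^ r" "exp (- (t\<^sup>2 * long_run_variance / 2))" "(1 - t\<^sup>2 * long_run_variance / (2 * real r)) ^ r"]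
        by simp
      moreover have "cmod (complex_of_real (w n) ^ r - ?L) = dist (w n ^ r) (exp (- (t\<^sup>2 * long_run_variance / 2)))"
        unfolding dist_norm of_real_power[symmetric] of_real_diff[symmetric] norm_of_real by simp
      ultimately show ?thesis by simp
    qed
    have "cmod (\<psi> n x - ?L) \<le> cmod (\<psi> n x - \<psi> (r * p) x) + cmod (\<psi> (r * p) x - \<psi> p x ^ r)
      + cmod (\<psi> p x ^ r - complex_of_real (w n) ^ r) + cmod (complex_of_real (w n) ^ r - ?L)"
      using dist_triangle[of "\<psi> n x" ?L "\<psi> (r * p) x"] dist_triangle[of "\<psi> (r * p) x" ?L "\<psi> p x ^ r"]
        dist_triangle[of "\<psi> p x ^ r" ?L "complex_of_real (w n) ^ r"] unfolding dist_norm by linarith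
    also have "\<dots> < \<bar>x\<bar> * (B * real r) + real r * (4 * rate (Suc q) + 2 * B * real q * \<bar>x\<bar>) + e / 5 + 2 * (e / 5)"
      using d1 d2 d3 d4 r(2) by linarith
    also have "\<dots> = \<bar>t\<bar> * (B * real r + real r * (2 * B * real q)) / sqrt (real n)
        + 4 * real r * rate (Suc q) + e / 5 + 2 * (e / 5)"
      unfolding abs_x by (simp add: algebra_simps add_divide_distrib)
    also have "\<dots> < e" using n4 q by linarith
    finally show "dist (\<psi> n (t / sqrt (real n))) ?L < e"
      unfolding x_def \<theta>_def dist_norm .
  qed
qed

end

section \<open>Functionals of finite blocks\<close>

context rho_mixing_process
begin

definition block :: "nat \<Rightarrow> ((nat \<Rightarrow> real) \<Rightarrow> real) \<Rightarrow> nat \<Rightarrow> 'a \<Rightarrow> real" where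
  "block K G j = (\<lambda>\<omega>. G (\<lambda>k\<in>{0..K}. X (j + k) \<omega>))"

lemma block_sigma_gen:
  assumes G: "G \<in> borel_measurable (\<Pi>\<^sub>M k\<in>{0..K}. borel)" and I: "{j..j + K} \<subseteq> I"
  shows "block K G j \<in> borel_measurable (sigma_gen M X I)"
proof -
  have "(\<lambda>\<omega>. \<lambda>k\<in>{0..K}. X (j + k) \<omega>) \<in> measurable (sigma_gen M X I) (\<Pi>\<^sub>M k\<in>{0..K}. borel)"
    by (rule measurable_restrict, rule X_past) (use I in auto)
  then show ?thesis unfolding block_def by (rule measurable_compose[OF _ G])
qed

lemma block_measurable:
  assumes G: "G \<in> borel_measurable (\<Pi>\<^sub>M k\<in>{0..K}. borel)" and j: "1 \<le> j"
  shows "block K G j \<in> borel_measurable M"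
proof (rule borel_measurable_finer[OF block_sigma_gen[OF G subset_refl]])
  show "sets (sigma_gen M X {j..j + K}) \<subseteq> sets M" by (rule sets_past) (use j in auto)
qed simp

lemma block_stationary:
  assumes G: "G \<in> borel_measurable (\<Pi>\<^sub>M k\<in>{0..K}. borel)"
  shows "strictly_stationary M (block K G)"
  unfolding strictly_stationary_def
proof (intro allI)
  fix m h
  define \<Phi> where "\<Phi> x = (\<lambda>i\<in>{1..m}. G (\<lambda>k\<in>{0..K}. x (i + k)))" for x :: "nat \<Rightarrow> real"
  have \<Phi>: "\<Phi> \<in> measurable (\<Pi>\<^sub>M i\<in>{1..m + K}. borel) (\<Pi>\<^sub>M i\<in>{1..m}. borel)"
    unfolding \<Phi>_def[abs_def]
  proof (rule measurable_restrict)
    fix i assume i: "i \<in> {1..m}"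
    have "(\<lambda>x. \<lambda>k\<in>{0..K}. x (i + k)) \<in> measurable (\<Pi>\<^sub>M i\<in>{1..m + K}. borel) (\<Pi>\<^sub>M k\<in>{0..K}. (borel :: real measure))"
      by (rule measurable_restrict, rule measurable_component_singleton) (use i in auto)
    then show "(\<lambda>x. G (\<lambda>k\<in>{0..K}. x (i + k))) \<in> borel_measurable (\<Pi>\<^sub>M i\<in>{1..m + K}. borel)"
      by (rule measurable_compose[OF _ G])
  qed
  have eq: "(\<lambda>\<omega>. \<lambda>i\<in>{1..m}. block K G (i + h) \<omega>) = \<Phi> \<circ> (\<lambda>\<omega>. \<lambda>i\<in>{1..m + K}. X (i + h) \<omega>)" for h
  proof
    fix \<omega>
    have "(\<lambda>k\<in>{0..K}. X (i + h + k) \<omega>) = (\<lambda>k\<in>{0..K}. (\<lambda>i\<in>{1..m + K}. X (i + h) \<omega>) (i + k))"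
      if "i \<in> {1..m}" for i
      by (rule restrict_ext) (use that in \<open>simp add: add.commute add.left_commute\<close>)
    then show "(\<lambda>i\<in>{1..m}. block K G (i + h) \<omega>) = (\<Phi> \<circ> (\<lambda>\<omega>. \<lambda>i\<in>{1..m + K}. X (i + h) \<omega>)) \<omega>"
      unfolding \<Phi>_def block_def comp_def by (intro restrict_ext) (simp only:)
  qed
  have law: "distr M (\<Pi>\<^sub>M i\<in>{1..m}. borel) (\<lambda>\<omega>. \<lambda>i\<in>{1..m}. block K G (i + h) \<omega>)
      = distr (distr M (\<Pi>\<^sub>M i\<in>{1..m + K}. borel) (\<lambda>\<omega>. \<lambda>i\<in>{1..m + K}. X (i + h) \<omega>)) (\<Pi>\<^sub>M i\<in>{1..m}. borel) \<Phi>" for h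
    unfolding eq by (rule distr_distr[symmetric, OF \<Phi> measurable_block])
  have "distr M (\<Pi>\<^sub>M i\<in>{1..m + K}. borel) (\<lambda>\<omega>. \<lambda>i\<in>{1..m + K}. X (i + h) \<omega>)
      = distr M (\<Pi>\<^sub>M i\<in>{1..m + K}. borel) (\<lambda>\<omega>. \<lambda>i\<in>{1..m + K}. X (i + 0) \<omega>)"
    using stationary unfolding strictly_stationary_def by simp
  then show "distr M (\<Pi>\<^sub>M i\<in>{1..m}. borel) (\<lambda>\<omega>. \<lambda>i\<in>{1..m}. block K G (i + h) \<omega>)
      = distr M (\<Pi>\<^sub>M i\<in>{1..m}. borel) (\<lambda>\<omega>. \<lambda>i\<in>{1..m}. block K G i \<omega>)"
    using law[of h] law[of 0] by simp
qed

text \<open>The blocks starting at \<open>j \<le> m\<close> see the process up to time \<open>m + K\<close>, so a lag of \<open>k\<close> between blocks is a lag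
of \<open>k - K\<close> for the process. For shorter lags the blocks overlap and only the trivial bound remains.\<close>

definition block_rate :: "nat \<Rightarrow> nat \<Rightarrow> real" where
  "block_rate K k = (if k < K then 1 else rate (Suc (k - K)))"

lemma rho_mixing_block_le:
  assumes G: "G \<in> borel_measurable (\<Pi>\<^sub>M k\<in>{0..K}. borel)"
  shows "rho_mixing M (block K G) (Suc k) \<le> ennreal (block_rate K k)"
  unfolding rho_mixing_def
proof (rule SUP_least)
  fix m :: nat assume "m \<in> {1..}"
  then have m: "1 \<le> m" by simp
  have past: "sets (sigma_gen M (block K G) {1..m}) \<subseteq> sets (sigma_gen M X {1..m + K})"
    by (rule sets_sigma_gen_subset, rule block_sigma_gen[OF G]) auto
  have future: "sets (sigma_gen M (block K G) {m + Suc k..}) \<subseteq> sets (sigma_gen M X {m + Suc k..})"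
    by (rule sets_sigma_gen_subset, rule block_sigma_gen[OF G]) auto
  show "rho_coeff M (sigma_gen M (block K G) {1..m}) (sigma_gen M (block K G) {m + Suc k..}) \<le> ennreal (block_rate K k)"
  proof (cases "k < K")
    case True
    have "rho_coeff M (sigma_gen M (block K G) {1..m}) (sigma_gen M (block K G) {m + Suc k..}) \<le> 1"
    proof (rule rho_coeff_le_1)
      show "sets (sigma_gen M (block K G) {1..m}) \<subseteq> sets M"
        by (rule order_trans[OF past], rule sets_past) auto
      show "sets (sigma_gen M (block K G) {m + Suc k..}) \<subseteq> sets M"
        by (rule order_trans[OF future], rule sets_past) auto
    qed simp_all
    then show ?thesis using True by (simp add: block_rate_def)
  next
    case False
    then have shift: "m + Suc k = (m + K) + Suc (k - K)" by simp
    have "rho_coeff M (sigma_gen M (block K G) {1..m}) (sigma_gen M (block K G) {m + Suc k..})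
        \<le> rho_coeff M (sigma_gen M X {1..m + K}) (sigma_gen M X {(m + K) + Suc (k - K)..})"
      unfolding shift[symmetric] by (rule rho_coeff_mono[OF past _ future]) simp_all
    also have "\<dots> \<le> rho_mixing M X (Suc (k - K))"
      unfolding rho_mixing_def by (rule SUP_upper) (use m in simp)
    finally show ?thesis using False by (simp add: block_rate_def rho_mixing_eq_rate)
  qed
qed

lemma summable_block_rate: "summable (block_rate K)"
proof -
  have "(\<lambda>k. block_rate K (k + K)) = (\<lambda>k. rate (Suc k))" by (simp add: block_rate_def)
  then show ?thesis using summable_rate summable_iff_shift[of "block_rate K" K] by simp
qed

lemma suminf_block_rate: "suminf (block_rate K) = real K + total_rate"
proof -
  have "(\<lambda>k. block_rate K (k + K)) = (\<lambda>k. rate (Suc k))" by (simp add: block_rate_def)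
  moreover have "(\<Sum>k<K. block_rate K k) = real K" by (simp add: block_rate_def)
  ultimately show ?thesis
    using suminf_split_initial_segment[OF summable_block_rate, of K K] by (simp add: total_rate_def)
qed

lemma block_rho_mixing_process:
  assumes G: "G \<in> borel_measurable (\<Pi>\<^sub>M k\<in>{0..K}. borel)"
  shows "rho_mixing_process M (block K G)"
proof
  show "block K G i \<in> borel_measurable M" if "1 \<le> i" for i by (rule block_measurable[OF G that])
  show "strictly_stationary M (block K G)" by (rule block_stationary[OF G])
  have "(\<Sum>k. rho_mixing M (block K G) (Suc k)) \<le> (\<Sum>k. ennreal (block_rate K k))"
    by (rule suminf_le[OF rho_mixing_block_le[OF G] summableI summableI])
  also have "\<dots> = ennreal (suminf (block_rate K))"
    by (rule suminf_ennreal2[OF _ summable_block_rate]) (simp add: block_rate_def)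
  finally show "(\<Sum>k. rho_mixing M (block K G) (Suc k)) < \<infinity>"
    by (rule order_le_less_trans) simp
qed

text \<open>The total rate grows at most linearly with the length of the blocks; this is what a summation over all
exit times has to compensate.\<close>

lemma total_rate_block_le:
  assumes G: "G \<in> borel_measurable (\<Pi>\<^sub>M k\<in>{0..K}. borel)"
  shows "rho_mixing_process.total_rate M (block K G) \<le> real K + total_rate"
proof -
  interpret Y: rho_mixing_process M "block K G" by (rule block_rho_mixing_process[OF G])
  have "Y.rate (Suc k) \<le> block_rate K k" for k
    using rho_mixing_block_le[OF G, of k] unfolding Y.rho_mixing_eq_rate
    by (simp add: block_rate_def split: if_splits)
  then show ?thesis
    unfolding Y.total_rate_def suminf_block_rate[symmetric]
    by (intro suminf_le Y.summable_rate summable_block_rate)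
qed

end

context prob_space
begin

lemma centered_add:
  assumes "L2 U" "L2 V" shows "centered (\<lambda>\<omega>. U \<omega> + V \<omega>) = (\<lambda>\<omega>. centered U \<omega> + centered V \<omega>)"
  using L2_integrable[OF assms(1)] L2_integrable[OF assms(2)] by (auto simp: centered_def)

lemma centered_cmult: "centered (\<lambda>\<omega>. c * U \<omega>) = (\<lambda>\<omega>. c * centered U \<omega>)"
  by (auto simp: centered_def right_diff_distrib)

lemma centered_diff:
  assumes "L2 U" "L2 V" shows "centered (\<lambda>\<omega>. U \<omega> - V \<omega>) = (\<lambda>\<omega>. centered U \<omega> - centered V \<omega>)"
  using L2_integrable[OF assms(1)] L2_integrable[OF assms(2)] by (auto simp: centered_def)

lemma centered_sum:
  assumes "finite A" "\<And>a. a \<in> A \<Longrightarrow> L2 (U a)"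
  shows "centered (\<lambda>\<omega>. \<Sum>a\<in>A. U a \<omega>) = (\<lambda>\<omega>. \<Sum>a\<in>A. centered (U a) \<omega>)"
proof -
  have "expectation (\<lambda>\<omega>. \<Sum>a\<in>A. U a \<omega>) = (\<Sum>a\<in>A. expectation (U a))"
    by (rule Bochner_Integration.integral_sum) (rule L2_integrable[OF assms(2)])
  then show ?thesis by (simp add: centered_def sum_subtractf)
qed

lemma L2norm_diff_triangle:
  assumes "L2 U" "L2 V" shows "\<bar>L2norm U - L2norm V\<bar> \<le> L2norm (\<lambda>\<omega>. U \<omega> - V \<omega>)"
proof -
  have "L2norm U \<le> L2norm (\<lambda>\<omega>. U \<omega> - V \<omega>) + L2norm V"
    using L2norm_add_le[OF L2_diff[OF assms] assms(2)] by simp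
  moreover have "L2norm V \<le> L2norm (\<lambda>\<omega>. U \<omega> - V \<omega>) + L2norm U"
    using L2norm_add_le[OF L2_diff[OF assms(2,1)] assms(1)]
    by (simp add: L2norm_def power2_commute)
  ultimately show ?thesis by linarith
qed

text \<open>The standard deviations \<open>\<sigma> K\<close> of the approximations form a Cauchy sequence because the approximations are
close to each other in \<open>L\<^sup>2\<close>, so the Gaussian limits converge, and the diagonal
limit is the Gaussian with the limiting variance. The constant \<open>c\<close> absorbs errors that are bounded in \<open>n\<close>.\<close>

lemma chf_limit_by_approximation:
  fixes T :: "nat \<Rightarrow> 'a \<Rightarrow> real" and S :: "nat \<Rightarrow> nat \<Rightarrow> 'a \<Rightarrow> real" and \<sigma> \<epsilon> :: "nat \<Rightarrow> real"
  assumes T: "\<And>n. L2 (T n)" and S: "\<And>K n. L2 (S K n)"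
    and chf: "\<And>K t. (\<lambda>n. chf (S K n) (t / sqrt (real n))) \<longlonglongrightarrow> complex_of_real (exp (- (t\<^sup>2 * (\<sigma> K)\<^sup>2 / 2)))"
    and norm: "\<And>K. (\<lambda>n. L2norm (S K n) / sqrt (real n)) \<longlonglongrightarrow> \<sigma> K"
    and close: "\<And>K n. K \<le> n \<Longrightarrow> L2norm (\<lambda>\<omega>. T n \<omega> - S K n \<omega>) \<le> sqrt (real n) * \<epsilon> K + c"
    and \<epsilon>: "\<epsilon> \<longlonglongrightarrow> 0"
  shows "\<exists>v\<ge>0. \<forall>t. (\<lambda>n. chf (T n) (t / sqrt (real n))) \<longlonglongrightarrow> complex_of_real (exp (- (t\<^sup>2 * v / 2)))"
proof -
  have \<sigma>_dist: "\<bar>\<sigma> K - \<sigma> K'\<bar> \<le> \<epsilon> K + \<epsilon> K'" for K K'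
  proof (rule LIMSEQ_le)
    show "(\<lambda>n. \<bar>L2norm (S K n) / sqrt (real n) - L2norm (S K' n) / sqrt (real n)\<bar>) \<longlonglongrightarrow> \<bar>\<sigma> K - \<sigma> K'\<bar>"
      by (rule tendsto_rabs[OF tendsto_diff[OF norm norm]])
    have "(\<lambda>n. \<epsilon> K + \<epsilon> K' + (2 * c) / sqrt (real n)) \<longlonglongrightarrow> \<epsilon> K + \<epsilon> K' + 0"
      by (rule tendsto_add[OF tendsto_const tendsto_over_sqrt])
    then show "(\<lambda>n. \<epsilon> K + \<epsilon> K' + (2 * c) / sqrt (real n)) \<longlonglongrightarrow> \<epsilon> K + \<epsilon> K'" by simp
    have "\<bar>L2norm (S K n) / sqrt (real n) - L2norm (S K' n) / sqrt (real n)\<bar> \<le> \<epsilon> K + \<epsilon> K' + (2 * c) / sqrt (real n)"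
      if n: "max 1 (max K K') \<le> n" for n
    proof -
      have n0: "0 < sqrt (real n)" using n by simp
      have a: "\<bar>L2norm (T n) - L2norm (S K n)\<bar> \<le> sqrt (real n) * \<epsilon> K + c"
        using L2norm_diff_triangle[OF T S] close[of K n] n by (meson max.boundedE order_trans)
      have b: "\<bar>L2norm (T n) - L2norm (S K' n)\<bar> \<le> sqrt (real n) * \<epsilon> K' + c"
        using L2norm_diff_triangle[OF T S] close[of K' n] n by (meson max.boundedE order_trans)
      have "\<bar>L2norm (S K n) - L2norm (S K' n)\<bar> \<le> sqrt (real n) * (\<epsilon> K + \<epsilon> K') + 2 * c"
        using a b unfolding distrib_left by linarith
      then have "\<bar>L2norm (S K n) - L2norm (S K' n)\<bar> / sqrt (real n) \<le> (sqrt (real n) * (\<epsilon> K + \<epsilon> K') + 2 * c) / sqrt (real n)"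
        by (rule divide_right_mono) simp
      moreover have "\<bar>L2norm (S K n) / sqrt (real n) - L2norm (S K' n) / sqrt (real n)\<bar> = \<bar>L2norm (S K n) - L2norm (S K' n)\<bar> / sqrt (real n)"
        using n0 by (simp flip: diff_divide_distrib add: abs_divide)
      moreover have "(sqrt (real n) * (\<epsilon> K + \<epsilon> K') + 2 * c) / sqrt (real n) = \<epsilon> K + \<epsilon> K' + (2 * c) / sqrt (real n)"
        using n0 by (simp add: add_divide_distrib)
      ultimately show ?thesis by simp
    qed
    then show "\<exists>N. \<forall>n\<ge>N. \<bar>L2norm (S K n) / sqrt (real n) - L2norm (S K' n) / sqrt (real n)\<bar> \<le> \<epsilon> K + \<epsilon> K' + (2 * c) / sqrt (real n)"
      by blast
  qed
  have "Cauchy \<sigma>"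
  proof (rule metric_CauchyI)
    fix e :: real assume e: "0 < e"
    have "\<forall>\<^sub>F K in sequentially. \<epsilon> K < e / 2" by (rule order_tendstoD(2)[OF \<epsilon>]) (use e in simp)
    then obtain N where N: "\<And>K. N \<le> K \<Longrightarrow> \<epsilon> K < e / 2" unfolding eventually_sequentially by blast
    have "dist (\<sigma> K) (\<sigma> K') < e" if "N \<le> K" "N \<le> K'" for K K'
      using \<sigma>_dist[of K K'] N[OF that(1)] N[OF that(2)] by (simp add: dist_real_def)
    then show "\<exists>N. \<forall>m\<ge>N. \<forall>n\<ge>N. dist (\<sigma> m) (\<sigma> n) < e" by blast
  qed
  then obtain s where s: "\<sigma> \<longlonglongrightarrow> s" using real_Cauchy_convergent unfolding convergent_def by blast
  show ?thesis
  proof (intro exI[of _ "s\<^sup>2"] conjI allI)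
    fix t :: real
    let ?L = "\<lambda>a. complex_of_real (exp (- (t\<^sup>2 * a\<^sup>2 / 2)))"
    show "(\<lambda>n. chf (T n) (t / sqrt (real n))) \<longlonglongrightarrow> ?L s"
    proof (rule tendstoI)
      fix e :: real assume e: "0 < e"
      have "(\<lambda>K. \<bar>t\<bar> * \<epsilon> K) \<longlonglongrightarrow> \<bar>t\<bar> * 0" by (rule tendsto_mult[OF tendsto_const \<epsilon>])
      then have ev1: "\<forall>\<^sub>F K in sequentially. \<bar>t\<bar> * \<epsilon> K < e / 4" by (rule order_tendstoD(2)) (use e in simp)
      have "(\<lambda>K. ?L (\<sigma> K)) \<longlonglongrightarrow> ?L s"
        by (intro tendsto_of_real tendsto_exp tendsto_minus tendsto_divide tendsto_mult tendsto_power tendsto_const s) simp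
      then have ev2: "\<forall>\<^sub>F K in sequentially. dist (?L (\<sigma> K)) (?L s) < e / 4" by (rule tendstoD) (use e in simp)
      obtain K where K: "\<bar>t\<bar> * \<epsilon> K < e / 4" "dist (?L (\<sigma> K)) (?L s) < e / 4"
        using eventually_conj[OF ev1 ev2] unfolding eventually_sequentially by blast
      have ev3: "\<forall>\<^sub>F n in sequentially. dist (chf (S K n) (t / sqrt (real n))) (?L (\<sigma> K)) < e / 4"
        by (rule tendstoD[OF chf]) (use e in simp)
      have ev4: "\<forall>\<^sub>F n in sequentially. \<bar>t\<bar> * c / sqrt (real n) < e / 4"
        by (rule order_tendstoD(2)[OF tendsto_over_sqrt]) (use e in simp)
      show "\<forall>\<^sub>F n in sequentially. dist (chf (T n) (t / sqrt (real n))) (?L s) < e"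
        using ev3 ev4 eventually_ge_at_top[of "max 1 K"]
      proof eventually_elim
        fix n assume n3: "dist (chf (S K n) (t / sqrt (real n))) (?L (\<sigma> K)) < e / 4"
          and n4: "\<bar>t\<bar> * c / sqrt (real n) < e / 4" and n: "max 1 K \<le> n"
        have n0: "0 < sqrt (real n)" using n by simp
        have "dist (chf (T n) (t / sqrt (real n))) (chf (S K n) (t / sqrt (real n)))
            \<le> \<bar>t / sqrt (real n)\<bar> * L2norm (\<lambda>\<omega>. T n \<omega> - S K n \<omega>)"
          unfolding dist_norm by (rule chf_diff_le[OF T S])
        also have "\<dots> \<le> \<bar>t / sqrt (real n)\<bar> * (sqrt (real n) * \<epsilon> K + c)"
          by (rule mult_left_mono[OF close]) (use n in simp_all)
        also have "\<dots> = \<bar>t\<bar> * \<epsilon> K + \<bar>t\<bar> * c / sqrt (real n)"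
          using n0 by (simp add: abs_divide field_simps)
        finally have 1: "dist (chf (T n) (t / sqrt (real n))) (chf (S K n) (t / sqrt (real n))) < e / 4 + e / 4"
          using K(1) n4 by linarith
        have "dist (chf (T n) (t / sqrt (real n))) (?L s)
            \<le> dist (chf (T n) (t / sqrt (real n))) (chf (S K n) (t / sqrt (real n)))
              + (dist (chf (S K n) (t / sqrt (real n))) (?L (\<sigma> K)) + dist (?L (\<sigma> K)) (?L s))"
          by (rule order_trans[OF dist_triangle add_left_mono[OF dist_triangle]])
        then show "dist (chf (T n) (t / sqrt (real n))) (?L s) < e"
          using 1 n3 K(2) by linarith
      qed
    qed
  qed simp
qed

end

context rho_mixing_process
begin

lemma block_bounded: "(\<And>y. \<bar>G y\<bar> \<le> C) \<Longrightarrow> \<bar>block K G j \<omega>\<bar> \<le> C"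
  by (simp add: block_def)

lemma L2_block:
  assumes "G \<in> borel_measurable (\<Pi>\<^sub>M k\<in>{0..K}. borel)" "\<And>y. \<bar>G y\<bar> \<le> C" "1 \<le> j"
  shows "L2 (block K G j)"
  by (rule L2_bounded[OF block_measurable[OF assms(1,3)] block_bounded[OF assms(2)]])

lemma L2_block_sum:
  assumes "G \<in> borel_measurable (\<Pi>\<^sub>M k\<in>{0..K}. borel)" "\<And>y. \<bar>G y\<bar> \<le> C"
  shows "L2 (\<lambda>\<omega>. \<Sum>j\<in>{1..n}. block K G j \<omega>)"
  by (rule L2_sum) (auto intro: L2_block[OF assms])

text \<open>Subtracting the mean turns block functionals into a centered bounded mixing sequence, to which the previous
sections apply.\<close>

lemma block_sum_centered:
  assumes G: "G \<in> borel_measurable (\<Pi>\<^sub>M k\<in>{0..K}. borel)" and C: "\<And>y. \<bar>G y\<bar> \<le> C"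
  defines "G' \<equiv> (\<lambda>y. G y - expectation (block K G 1))"
  shows "bounded_rho_mixing M (block K G') (2 * C)"
    and "centered (\<lambda>\<omega>. \<Sum>j\<in>{1..n}. block K G j \<omega>) = rho_mixing_process.psum (block K G') 0 n"
    and "rho_mixing_process.total_rate M (block K G') \<le> real K + total_rate"
    and "bounded_rho_mixing.autocov M (block K G') 0 \<le> expectation (\<lambda>\<omega>. (block K G 1 \<omega>)\<^sup>2)"
proof -
  have C0: "0 \<le> C" using C[of "\<lambda>_. 0"] by linarith
  have G'_meas: "G' \<in> borel_measurable (\<Pi>\<^sub>M k\<in>{0..K}. borel)"
    unfolding G'_def by (rule borel_measurable_diff[OF G borel_measurable_const])
  have block': "block K G' j \<omega> = block K G j \<omega> - expectation (block K G 1)" for j \<omega>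
    by (simp add: block_def G'_def)
  interpret Y: rho_mixing_process M "block K G" by (rule block_rho_mixing_process[OF G])
  interpret Z: rho_mixing_process M "block K G'" by (rule block_rho_mixing_process[OF G'_meas])
  have mean: "\<bar>expectation (block K G 1)\<bar> \<le> C"
  proof -
    have "\<bar>expectation (block K G 1)\<bar> \<le> expectation (\<lambda>\<omega>. \<bar>block K G 1 \<omega>\<bar>)" by (rule integral_abs_bound)
    also have "\<dots> \<le> L2norm (block K G 1)" by (rule abs_expectation_le_L2norm[OF L2_block[OF G C]]) simp
    also have "\<dots> \<le> C" by (rule L2norm_bounded[OF block_measurable[OF G] block_bounded[OF C] C0]) simp
    finally show ?thesis .
  qed
  have cent1: "block K G' 1 = centered (block K G 1)" by (auto simp: block' centered_def)
  interpret B: bounded_rho_mixing M "block K G'" "2 * C"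
  proof
    fix i :: nat and \<omega>
    show "\<bar>block K G' i \<omega>\<bar> \<le> 2 * C" unfolding block' using block_bounded[where G = G and K = K and j = i and \<omega> = \<omega>, OF C] mean by linarith
  next
    show "expectation (block K G' 1) = 0"
      unfolding cent1 by (rule expectation_centered[OF L2_block[OF G C]]) simp
  qed
  show "bounded_rho_mixing M (block K G') (2 * C)" by (rule B.bounded_rho_mixing_axioms)
  show "rho_mixing_process.total_rate M (block K G') \<le> real K + total_rate"
    by (rule total_rate_block_le[OF G'_meas])
  have "expectation (block K G j) = expectation (block K G 1)" if "1 \<le> j" for j
    using Y.psum_stationary[of "\<lambda>x. x" "j - 1" 1] that by (simp add: Y.psum_def)
  then show "centered (\<lambda>\<omega>. \<Sum>j\<in>{1..n}. block K G j \<omega>) = rho_mixing_process.psum (block K G') 0 n"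
  proof -
    assume mean: "\<And>j. 1 \<le> j \<Longrightarrow> expectation (block K G j) = expectation (block K G 1)"
    have "centered (\<lambda>\<omega>. \<Sum>j\<in>{1..n}. block K G j \<omega>) = (\<lambda>\<omega>. \<Sum>j\<in>{1..n}. centered (block K G j) \<omega>)"
      by (rule centered_sum) (simp_all add: L2_block[OF G C])
    also have "\<dots> = Z.psum 0 n"
      unfolding Z.psum_def
    proof (rule ext, rule sum.cong[OF refl])
      fix j \<omega> assume "j \<in> {1..n}"
      then have "expectation (block K G j) = expectation (block K G 1)" by (intro mean) simp
      then show "centered (block K G j) \<omega> = block K G' (j + 0) \<omega>"
        by (simp only: centered_def block' add_0_right)
    qed
    finally show ?thesis .
  qed
  have "B.autocov 0 = (L2norm (centered (block K G 1)))\<^sup>2"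
    unfolding B.autocov_def L2norm_power2 cent1[symmetric] by (simp add: power2_eq_square)
  also have "\<dots> \<le> (L2norm (block K G 1))\<^sup>2"
    by (intro power_mono L2norm_centered_le L2_block[OF G C] L2norm_nonneg) simp
  finally show "bounded_rho_mixing.autocov M (block K G') 0 \<le> expectation (\<lambda>\<omega>. (block K G 1 \<omega>)\<^sup>2)"
    unfolding L2norm_power2 .
qed

lemma L2norm_block_sum_le:
  assumes G: "G \<in> borel_measurable (\<Pi>\<^sub>M k\<in>{0..K}. borel)" and C: "\<And>y. \<bar>G y\<bar> \<le> C"
  shows "L2norm (centered (\<lambda>\<omega>. \<Sum>j\<in>{1..n}. block K G j \<omega>))
    \<le> sqrt (real n * (expectation (\<lambda>\<omega>. (block K G 1 \<omega>)\<^sup>2) * (1 + 2 * (real K + total_rate))))"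
proof -
  define G' where "G' = (\<lambda>y. G y - expectation (block K G 1))"
  note Z = block_sum_centered[OF G C, folded G'_def]
  interpret B: bounded_rho_mixing M "block K G'" "2 * C" by (rule Z(1))
  have "L2norm (centered (\<lambda>\<omega>. \<Sum>j\<in>{1..n}. block K G j \<omega>)) = sqrt (B.var_sum n)"
    unfolding Z(2) by (rule B.L2norm_psum)
  also have "\<dots> \<le> sqrt (real n * (B.autocov 0 * (1 + 2 * B.total_rate)))"
    by (rule real_sqrt_le_mono[OF B.var_sum_le])
  also have "\<dots> \<le> sqrt (real n * (expectation (\<lambda>\<omega>. (block K G 1 \<omega>)\<^sup>2) * (1 + 2 * (real K + total_rate))))"
    using Z(3,4) B.autocov_0_nonneg B.total_rate_nonneg
    by (intro real_sqrt_le_mono mult_left_mono mult_mono) simp_all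
  finally show ?thesis .
qed

lemma block_sum_clt:
  assumes G: "G \<in> borel_measurable (\<Pi>\<^sub>M k\<in>{0..K}. borel)" and C: "\<And>y. \<bar>G y\<bar> \<le> C"
  shows "\<exists>\<sigma>. (\<forall>t. (\<lambda>n. chf (centered (\<lambda>\<omega>. \<Sum>j\<in>{1..n}. block K G j \<omega>)) (t / sqrt (real n)))
        \<longlonglongrightarrow> complex_of_real (exp (- (t\<^sup>2 * \<sigma>\<^sup>2 / 2))))
    \<and> (\<lambda>n. L2norm (centered (\<lambda>\<omega>. \<Sum>j\<in>{1..n}. block K G j \<omega>)) / sqrt (real n)) \<longlonglongrightarrow> \<sigma>"
proof -
  define G' where "G' = (\<lambda>y. G y - expectation (block K G 1))"
  note Z = block_sum_centered[OF G C, folded G'_def]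
  interpret B: bounded_rho_mixing M "block K G'" "2 * C" by (rule Z(1))
  have "(\<lambda>n. sqrt (B.var_sum n / real n)) \<longlonglongrightarrow> sqrt B.long_run_variance"
    by (rule tendsto_real_sqrt[OF B.var_sum_tendsto])
  then have "(\<lambda>n. L2norm (B.psum 0 n) / sqrt (real n)) \<longlonglongrightarrow> sqrt B.long_run_variance"
    by (simp only: B.L2norm_psum real_sqrt_divide)
  moreover have "(sqrt B.long_run_variance)\<^sup>2 = B.long_run_variance" using B.long_run_variance_nonneg by simp
  ultimately show ?thesis
    unfolding Z(2) using B.chf_psum_tendsto by (intro exI[of _ "sqrt B.long_run_variance"]) simp
qed

end

lemma real_distribution_normal_law: "0 \<le> v \<Longrightarrow> real_distribution (normal_law \<mu> v)"
proof -
  assume "0 \<le> v"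
  then have "v \<noteq> 0 \<Longrightarrow> 0 < sqrt v" by simp
  then show ?thesis
    unfolding real_distribution_def real_distribution_axioms_def normal_law_def
    by (auto intro: prob_space_return prob_space_normal_density)
qed

lemma char_normal_law:
  assumes "0 \<le> v"
  shows "char (normal_law 0 v) t = complex_of_real (exp (- (t\<^sup>2 * v / 2)))"
proof (cases "v = 0")
  case True
  have "char (return borel 0) t = 1"
    unfolding char_def by (subst integral_return) simp_all
  then show ?thesis using True by (simp add: normal_law_def)
next
  case False
  define s where "s = sqrt v"
  have s: "0 < s" "s\<^sup>2 = v" using False assms by (simp_all add: s_def)
  interpret N: real_distribution std_normal_distribution by (rule real_dist_normal_dist)
  have "distributed std_normal_distribution lborel (\<lambda>x. x) std_normal_density"
    unfolding distributed_def
  proof (intro conjI)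
    show "distr std_normal_distribution lborel (\<lambda>x. x) = std_normal_distribution"
      by (rule distr_id2) simp
  qed simp_all
  from N.normal_density_affine[OF this, of s 0] s(1)
  have "distributed std_normal_distribution lborel (\<lambda>x. 0 + s * x) (normal_density (0 + s * 0) (\<bar>s\<bar> * 1))"
    by simp
  then have D: "distr std_normal_distribution lborel (\<lambda>x. s * x) = density lborel (\<lambda>x. ennreal (normal_density 0 s x))"
    using s(1) by (simp add: distributed_def)
  have "normal_law 0 v = distr std_normal_distribution borel (\<lambda>x. s * x)"
  proof -
    have "distr std_normal_distribution borel (\<lambda>x. s * x) = distr std_normal_distribution lborel (\<lambda>x. s * x)"
      by (rule distr_cong) simp_all
    then show ?thesis using False D by (simp only: normal_law_def s_def if_False)
  qed
  then have "char (normal_law 0 v) t = integral\<^sup>L (distr std_normal_distribution borel (\<lambda>x. s * x)) (\<lambda>x. iexp (t * x))"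
    by (simp only: char_def)
  also have "\<dots> = integral\<^sup>L std_normal_distribution (\<lambda>x. iexp (t * (s * x)))"
    by (rule integral_distr) measurable
  also have "\<dots> = char std_normal_distribution (t * s)"
    by (simp only: char_def mult.assoc)
  also have "\<dots> = complex_of_real (exp (- ((t * s)\<^sup>2) / 2))" by (simp only: char_std_normal_distribution)
  finally show ?thesis by (simp add: power_mult_distrib s(2))
qed

section \<open>The central limit theorem for persistent Betti numbers\<close>

lemma exit_ind_eq_prod:
  "exit_ind s t i y = indicator {..s} (y 0) * (\<Prod>k\<in>{1..<i}. indicator {s<..t} (y k)) * indicator {t<..} (y i)"
proof (cases "\<forall>k\<in>{1..<i}. s < y k \<and> y k \<le> t")
  case True
  then have "(\<Prod>k\<in>{1..<i}. indicator {s<..t} (y k)) = (1::real)" by (intro prod.neutral) simp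
  then show ?thesis using True by (simp add: exit_ind_def indicator_def)
next
  case False
  then have "(\<Prod>k\<in>{1..<i}. indicator {s<..t} (y k)) = (0::real)" by (intro prod_zero) (auto simp: indicator_def)
  then show ?thesis using False by (simp only: exit_ind_def if_False simp_thms mult_zero_left mult_zero_right)
qed

lemma exit_ind_measurable:
  assumes "i \<le> K"
  shows "exit_ind s t i \<in> borel_measurable (\<Pi>\<^sub>M k\<in>{0..K}. borel)"
proof -
  have ind: "(\<lambda>y. indicator A (y k) :: real) \<in> borel_measurable (\<Pi>\<^sub>M k\<in>{0..K}. borel)"
    if "k \<in> {0..K}" "A \<in> sets borel" for A and k :: nat
    by (rule measurable_compose[OF measurable_component_singleton[OF that(1)] borel_measurable_indicator[OF that(2)]])
  have "(\<lambda>y. indicator {..s} (y 0) * (\<Prod>k\<in>{1..<i}. indicator {s<..t} (y k)) * indicator {t<..} (y i) :: real)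
      \<in> borel_measurable (\<Pi>\<^sub>M k\<in>{0..K}. borel)"
    by (intro borel_measurable_times borel_measurable_prod ind) (use assms in auto)
  then show ?thesis by (simp only: exit_ind_eq_prod[abs_def])
qed

lemma exit_ind_bounds: "0 \<le> exit_ind s t i y" "exit_ind s t i y \<le> 1"
  by (simp_all add: exit_ind_def)

lemma (in prob_space) converges_from_chf:
  assumes L2: "\<And>n. L2 (Y n)" and v: "0 \<le> v"
    and lim: "\<And>t. (\<lambda>n. chf (centered (Y n)) (t / sqrt (real n))) \<longlonglongrightarrow> complex_of_real (exp (- (t\<^sup>2 * v / 2)))"
  shows "converges_in_distribution M (normalized M Y) (normal_law 0 v)"
  unfolding converges_in_distribution_def
proof (rule levy_continuity)
  have norm: "normalized M Y n = (\<lambda>\<omega>. centered (Y n) \<omega> / sqrt (real n))" for n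
    by (auto simp: normalized_def centered_def)
  have meas: "normalized M Y n \<in> borel_measurable M" for n
    unfolding norm using L2_measurable[OF L2_centered[OF L2[of n]]] by measurable
  show "real_distribution (distr M borel (normalized M Y n))" for n
    by (rule real_distribution_distr[OF meas])
  show "real_distribution (normal_law 0 v)" by (rule real_distribution_normal_law[OF v])
  have "chf (normalized M Y n) t = chf (centered (Y n)) (t / sqrt (real n))" for n t
    unfolding chf_def norm by (simp add: mult.commute)
  then show "(\<lambda>n. char (distr M borel (normalized M Y n)) t) \<longlonglongrightarrow> char (normal_law 0 v) t" for t
    using lim[of t] by (simp only: chf_char[OF meas] char_normal_law[OF v])
qed

context rho_mixing_process
begin

abbreviation path :: "'a \<Rightarrow> nat \<Rightarrow> real" where
  "path \<omega> \<equiv> (\<lambda>i. X i \<omega>)"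

definition run_prob :: "real \<Rightarrow> nat \<Rightarrow> real" where
  "run_prob t i = prob {\<omega> \<in> space M. \<forall>j\<in>{1..i}. X j \<omega> \<le> t}"

lemma block_exit_ind:
  assumes "i \<le> K"
  shows "block K (exit_ind s t i) j \<omega> = exit_ind s t i (\<lambda>k. X (j + k) \<omega>)"
  using assms by (simp add: block_def exit_ind_def)

text \<open>An exit at step \<open>i\<close> above \<open>t\<close> needs a run of \<open>i\<close> values not exceeding \<open>t\<close>.\<close>

lemma exit_second_moment:
  assumes st: "s \<le> t" and i: "1 \<le> i"
  shows "expectation (\<lambda>\<omega>. (block i (exit_ind s t i) 1 \<omega>)\<^sup>2) \<le> run_prob t i"
proof -
  let ?A = "{\<omega> \<in> space M. \<forall>j\<in>{1..i}. X j \<omega> \<le> t}"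
  have A: "?A \<in> events"
  proof (rule sets.sets_Collect_finite_All)
    fix j assume "j \<in> {1..i}"
    then show "{\<omega> \<in> space M. X j \<omega> \<le> t} \<in> events"
      using borel_measurable_le[OF X_measurable borel_measurable_const] by simp
  qed simp
  have "expectation (\<lambda>\<omega>. (block i (exit_ind s t i) 1 \<omega>)\<^sup>2) \<le> expectation (indicator ?A)"
  proof (rule integral_mono')
    show "integrable M (indicator ?A :: 'a \<Rightarrow> real)"
      by (rule integrable_real_indicator[OF A]) (simp add: less_top[symmetric])
    fix \<omega> assume \<omega>: "\<omega> \<in> space M"
    show "(block i (exit_ind s t i) 1 \<omega>)\<^sup>2 \<le> (indicator ?A \<omega> :: real)"
    proof (cases "block i (exit_ind s t i) 1 \<omega> = 0")
      case False
      then have ex: "X 1 \<omega> \<le> s" "\<forall>k\<in>{1..<i}. s < X (1 + k) \<omega> \<and> X (1 + k) \<omega> \<le> t"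
        unfolding block_exit_ind[OF order_refl] by (simp_all add: exit_ind_def split: if_splits)
      have "X j \<omega> \<le> t" if j: "j \<in> {1..i}" for j
      proof (cases "j = 1")
        case True then show ?thesis using ex(1) st by simp
      next
        case False
        then have "j - 1 \<in> {1..<i}" "1 + (j - 1) = j" using j by auto
        then show ?thesis using ex(2) by metis
      qed
      then have "\<omega> \<in> ?A" using \<omega> by blast
      moreover have "block i (exit_ind s t i) 1 \<omega> = 1"
        using False exit_ind_cases unfolding block_exit_ind[OF order_refl] by blast
      ultimately show ?thesis by simp
    qed (simp add: indicator_def)
    show "0 \<le> (indicator ?A \<omega> :: real)" by simp
  qed
  also have "\<dots> = run_prob t i" using A by (simp add: run_prob_def)
  finally show ?thesis .
qed

text \<open>The range of dependence of the indicators contributes a factor of order \<open>i\<^sup>1\<^sup>/\<^sup>2\<close>, which is estimated by \<open>i\<close>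
to meet the summability condition.\<close>

lemma L2norm_exit_sum_le:
  assumes st: "s \<le> t" and i: "1 \<le> i"
  shows "L2norm (centered (\<lambda>\<omega>. \<Sum>j\<in>{1..n}. block i (exit_ind s t i) j \<omega>))
    \<le> sqrt (real n) * (sqrt (3 + 2 * total_rate) * (real i * sqrt (run_prob t i)))"
proof -
  let ?e = "expectation (\<lambda>\<omega>. (block i (exit_ind s t i) 1 \<omega>)\<^sup>2)"
  have q: "0 \<le> run_prob t i" by (simp add: run_prob_def)
  have R: "0 \<le> total_rate" by (rule total_rate_nonneg)
  have i1: "1 \<le> real i" using i by simp
  have i2: "1 \<le> (real i)\<^sup>2" by (rule one_le_power[OF i1])
  have i3: "real i \<le> (real i)\<^sup>2"
    using mult_left_mono[OF i1, of "real i"] unfolding power2_eq_square by simp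
  have "(real i)\<^sup>2 * (3 + 2 * total_rate) = 3 * (real i)\<^sup>2 + 2 * ((real i)\<^sup>2 * total_rate)"
    by (simp only: distrib_left mult.left_commute mult.commute)
  moreover have "1 + 2 * (x + r) \<le> 3 * A + 2 * B" if "1 \<le> A" "x \<le> A" "r \<le> B" for x r A B :: real
  proof -
    have "1 + (2 * x + 2 * r) \<le> A + (2 * A + 2 * B)"
      by (intro add_mono mult_left_mono that) simp_all
    then show ?thesis by simp
  qed
  note this[OF i2 i3 mult_right_mono[OF i2 R, unfolded mult_1_left]]
  ultimately have "1 + 2 * (real i + total_rate) \<le> (real i)\<^sup>2 * (3 + 2 * total_rate)"
    by (simp only:)
  then have le: "?e * (1 + 2 * (real i + total_rate)) \<le> run_prob t i * ((real i)\<^sup>2 * (3 + 2 * total_rate))"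
    using exit_second_moment[OF st i] q R by (intro mult_mono) simp_all
  have "L2norm (centered (\<lambda>\<omega>. \<Sum>j\<in>{1..n}. block i (exit_ind s t i) j \<omega>))
      \<le> sqrt (real n * (?e * (1 + 2 * (real i + total_rate))))"
    by (rule L2norm_block_sum_le[where C = 1, OF exit_ind_measurable[OF order_refl]])
      (use exit_ind_bounds in simp)
  also have "\<dots> \<le> sqrt (real n * (run_prob t i * ((real i)\<^sup>2 * (3 + 2 * total_rate))))"
    by (intro real_sqrt_le_mono mult_left_mono le) simp
  also have "\<dots> = sqrt (real n) * (sqrt (3 + 2 * total_rate) * (real i * sqrt (run_prob t i)))"
    by (simp add: real_sqrt_mult)
  finally show ?thesis .
qed

lemma last_low_measurable:
  assumes "1 \<le> j"
  shows "{\<omega> \<in> space M. last_low n (path \<omega>) s t j} \<in> events"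
proof -
  \<comment> \<open>The value of \<open>X\<close> at index \<open>0\<close> is unspecified and need not be measurable.\<close>
  define X' where "X' i = (if 1 \<le> i then X i else (\<lambda>_. 0))" for i
  have [measurable]: "X' i \<in> borel_measurable M" for i
    by (simp add: X'_def X_measurable)
  have "{\<omega> \<in> space M. X' j \<omega> \<le> s \<and> (\<forall>r\<in>{j<..n}. X' r \<omega> \<le> s \<longrightarrow> (\<exists>k\<in>{j<..<r}. t < X' k \<omega>))} \<in> events"
    by measurable
  moreover have "last_low n (path \<omega>) s t j
      \<longleftrightarrow> X' j \<omega> \<le> s \<and> (\<forall>r\<in>{j<..n}. X' r \<omega> \<le> s \<longrightarrow> (\<exists>k\<in>{j<..<r}. t < X' k \<omega>))" for \<omega>
    using assms by (auto simp: last_low_def X'_def)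
  ultimately show ?thesis by simp
qed

lemma L2_persistent_betti:
  assumes st: "s \<le> t"
  shows "L2 (\<lambda>\<omega>. real (persistent_betti n (path \<omega>) s t))"
proof -
  have eq: "real (persistent_betti n x s t) = (\<Sum>j\<in>{1..n}. if last_low n x s t j then 1 else 0)" for x
    unfolding persistent_betti_eq_card_last_low[OF st] by (simp add: sum.If_cases Int_def)
  have "(\<lambda>\<omega>. if last_low n (path \<omega>) s t j then 1 else 0 :: real) \<in> borel_measurable M" if "j \<in> {1..n}" for j
    by (rule measurable_If) (use last_low_measurable[of j n s t] that in simp_all)
  then have "(\<lambda>\<omega>. real (persistent_betti n (path \<omega>) s t)) \<in> borel_measurable M"
    unfolding eq by (rule borel_measurable_sum)
  moreover have "\<bar>real (persistent_betti n (path \<omega>) s t)\<bar> \<le> real n" for \<omega>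
  proof -
    have "card {j \<in> {1..n}. last_low n (path \<omega>) s t j} \<le> card {1..n}" by (rule card_mono) auto
    then show ?thesis unfolding persistent_betti_eq_card_last_low[OF st] by simp
  qed
  ultimately show ?thesis by (rule L2_bounded)
qed

text \<open>The truncation of the exit times at \<open>K = n\<close> is exact up to the constant \<open>C\<close>, so the approximation at
level \<open>K\<close> differs from the Betti numbers by exit times in \<open>(K, n]\<close> and a bounded term. The former are summed in
\<open>L\<^sup>2\<close> term by term, which turns max-root summability into smallness of \<open>\<epsilon> K\<close>.\<close>

theorem persistent_betti_clt:
  fixes c s t :: "'i \<Rightarrow> real"
  assumes L: "finite L" and st: "\<And>l. l \<in> L \<Longrightarrow> s l \<le> t l"
    and summable: "\<And>l. l \<in> L \<Longrightarrow> summable (\<lambda>i. real i * sqrt (run_prob (t l) i))"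
  defines "Y \<equiv> (\<lambda>n \<omega>. \<Sum>l\<in>L. c l * real (persistent_betti n (path \<omega>) (s l) (t l)))"
  shows "\<exists>v\<ge>0. converges_in_distribution M (normalized M Y) (normal_law 0 v)"
proof -
  define E where "E l i n \<omega> = (\<Sum>j\<in>{1..n}. block i (exit_ind (s l) (t l) i) j \<omega>)" for l i n \<omega>
  define G where "G K y = (\<Sum>l\<in>L. c l * (\<Sum>i\<in>{1..K}. exit_ind (s l) (t l) i y))" for K y
  define P where "P K n \<omega> = (\<Sum>j\<in>{1..n}. block K (G K) j \<omega>)" for K n \<omega>
  define f where "f l i = real i * sqrt (run_prob (t l) i)" for l i
  define tail where "tail l K = suminf (f l) - (\<Sum>i<Suc K. f l i)" for l K
  define \<epsilon> where "\<epsilon> K = (\<Sum>l\<in>L. \<bar>c l\<bar> * (sqrt (3 + 2 * total_rate) * tail l K))" for K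
  define C where "C = (\<Sum>l\<in>L. \<bar>c l\<bar>)"
  have C0: "0 \<le> C" by (simp add: C_def sum_nonneg)
  have G_meas: "G K \<in> borel_measurable (\<Pi>\<^sub>M k\<in>{0..K}. borel)" for K
    unfolding G_def[abs_def]
    by (intro borel_measurable_sum borel_measurable_times borel_measurable_const exit_ind_measurable) simp
  have G_bound: "\<bar>G K y\<bar> \<le> (\<Sum>l\<in>L. \<bar>c l\<bar> * real K)" for K y
    unfolding G_def
  proof (rule order_trans[OF sum_abs sum_mono])
    fix l
    have "\<bar>\<Sum>i\<in>{1..K}. exit_ind (s l) (t l) i y\<bar> \<le> (\<Sum>i\<in>{1..K}. 1)"
      by (rule order_trans[OF sum_abs sum_mono]) (use exit_ind_bounds in simp)
    then show "\<bar>c l * (\<Sum>i\<in>{1..K}. exit_ind (s l) (t l) i y)\<bar> \<le> \<bar>c l\<bar> * real K"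
      unfolding abs_mult by (intro mult_left_mono) simp_all
  qed
  have L2_Y: "L2 (Y n)" for n
    unfolding Y_def by (rule L2_sum[OF L], rule L2_cmult, rule L2_persistent_betti[OF st])
  have L2_P: "L2 (P K n)" for K n
    unfolding P_def[abs_def] by (rule L2_block_sum[OF G_meas G_bound])
  have L2_E: "L2 (E l i n)" for l i n
    unfolding E_def[abs_def]
    by (rule L2_block_sum[where C = 1, OF exit_ind_measurable[OF order_refl]]) (use exit_ind_bounds in simp)
  have P_eq: "P K n \<omega> = (\<Sum>l\<in>L. c l * (\<Sum>i\<in>{1..K}. E l i n \<omega>))" for K n \<omega>
  proof -
    have blk: "block K (G K) j \<omega> = (\<Sum>l\<in>L. c l * (\<Sum>i\<in>{1..K}. block i (exit_ind (s l) (t l) i) j \<omega>))" for j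
    proof -
      have "block K (G K) j \<omega> = (\<Sum>l\<in>L. c l * (\<Sum>i\<in>{1..K}. block K (exit_ind (s l) (t l) i) j \<omega>))"
        by (simp add: block_def G_def)
      also have "\<dots> = (\<Sum>l\<in>L. c l * (\<Sum>i\<in>{1..K}. block i (exit_ind (s l) (t l) i) j \<omega>))"
        by (intro sum.cong refl arg_cong2[where f = "(*)"]) (simp add: block_exit_ind)
      finally show ?thesis .
    qed
    have "P K n \<omega> = (\<Sum>l\<in>L. \<Sum>j\<in>{1..n}. c l * (\<Sum>i\<in>{1..K}. block i (exit_ind (s l) (t l) i) j \<omega>))"
      unfolding P_def blk by (rule sum.swap)
    also have "\<dots> = (\<Sum>l\<in>L. c l * (\<Sum>i\<in>{1..K}. E l i n \<omega>))"
    proof (rule sum.cong[OF refl])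
      fix l
      have "(\<Sum>j\<in>{1..n}. \<Sum>i\<in>{1..K}. block i (exit_ind (s l) (t l) i) j \<omega>) = (\<Sum>i\<in>{1..K}. E l i n \<omega>)"
        unfolding E_def by (rule sum.swap)
      then show "(\<Sum>j\<in>{1..n}. c l * (\<Sum>i\<in>{1..K}. block i (exit_ind (s l) (t l) i) j \<omega>)) = c l * (\<Sum>i\<in>{1..K}. E l i n \<omega>)"
        by (simp only: sum_distrib_left[symmetric])
    qed
    finally show ?thesis .
  qed
  have Y_P: "\<bar>Y n \<omega> - P n n \<omega>\<bar> \<le> C" for n \<omega>
  proof -
    have "Y n \<omega> - P n n \<omega> = (\<Sum>l\<in>L. c l * (real (persistent_betti n (path \<omega>) (s l) (t l)) - (\<Sum>i\<in>{1..n}. E l i n \<omega>)))"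
      unfolding Y_def P_eq by (simp only: right_diff_distrib sum_subtractf)
    also have "\<bar>\<dots>\<bar> \<le> (\<Sum>l\<in>L. \<bar>c l\<bar> * 1)"
    proof (rule order_trans[OF sum_abs sum_mono])
      fix l assume l: "l \<in> L"
      have "(\<Sum>i\<in>{1..n}. E l i n \<omega>) = (\<Sum>j\<in>{1..n}. \<Sum>i\<in>{1..n}. exit_ind (s l) (t l) i (\<lambda>k. X (j + k) \<omega>))"
        unfolding E_def block_exit_ind[OF order_refl] by (rule sum.swap)
      then have "\<bar>real (persistent_betti n (path \<omega>) (s l) (t l)) - (\<Sum>i\<in>{1..n}. E l i n \<omega>)\<bar> \<le> 1"
        using persistent_betti_approx[OF st[OF l], of n "path \<omega>"] by (simp only:)
      then show "\<bar>c l * (real (persistent_betti n (path \<omega>) (s l) (t l)) - (\<Sum>i\<in>{1..n}. E l i n \<omega>))\<bar> \<le> \<bar>c l\<bar> * 1"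
        unfolding abs_mult by (rule mult_left_mono) simp
    qed
    finally show ?thesis by (simp add: C_def)
  qed
  have f_nonneg: "0 \<le> f l i" for l i by (simp add: f_def run_prob_def)
  have f_summable: "summable (f l)" if "l \<in> L" for l using summable[OF that] by (simp add: f_def[abs_def])
  have tail_ge: "(\<Sum>i\<in>{Suc K..n}. f l i) \<le> tail l K" if l: "l \<in> L" and K: "K \<le> n" for l K n
  proof -
    have "(\<Sum>i<Suc n. f l i) \<le> suminf (f l)" by (rule sum_le_suminf[OF f_summable[OF l]]) (simp_all add: f_nonneg)
    moreover have "(\<Sum>i<Suc n. f l i) = (\<Sum>i<Suc K. f l i) + (\<Sum>i\<in>{Suc K..n}. f l i)"
      using sum.atLeastLessThan_concat[of 0 "Suc K" "Suc n" "f l"] K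
      by (simp add: lessThan_atLeast0 atLeastLessThanSuc_atLeastAtMost del: sum.op_ivl_Suc sum.lessThan_Suc)
    ultimately show ?thesis by (simp add: tail_def)
  qed
  have close: "L2norm (\<lambda>\<omega>. centered (Y n) \<omega> - centered (P K n) \<omega>) \<le> sqrt (real n) * \<epsilon> K + C" if K: "K \<le> n" for K n
  proof -
    define V where "V l = (\<lambda>\<omega>. \<Sum>i\<in>{Suc K..n}. E l i n \<omega>)" for l
    have L2_V: "L2 (V l)" for l unfolding V_def by (rule L2_sum) (simp_all add: L2_E)
    have PP: "P n n \<omega> - P K n \<omega> = (\<Sum>l\<in>L. c l * V l \<omega>)" for \<omega>
    proof -
      have "(\<Sum>i\<in>{1..n}. E l i n \<omega>) - (\<Sum>i\<in>{1..K}. E l i n \<omega>) = V l \<omega>" for l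
        using sum.ub_add_nat[of 1 K "\<lambda>i. E l i n \<omega>" "n - K"] K by (simp add: V_def)
      then show ?thesis
        unfolding P_eq sum_subtractf[symmetric] right_diff_distrib[symmetric] by simp
    qed
    have split: "(\<lambda>\<omega>. Y n \<omega> - P K n \<omega>) = (\<lambda>\<omega>. (Y n \<omega> - P n n \<omega>) + (P n n \<omega> - P K n \<omega>))" by simp
    have "(\<lambda>\<omega>. centered (Y n) \<omega> - centered (P K n) \<omega>)
        = (\<lambda>\<omega>. centered (\<lambda>\<omega>. Y n \<omega> - P n n \<omega>) \<omega> + centered (\<lambda>\<omega>. P n n \<omega> - P K n \<omega>) \<omega>)"
      unfolding centered_diff[OF L2_Y L2_P, symmetric] split
      by (rule centered_add[OF L2_diff[OF L2_Y L2_P] L2_diff[OF L2_P L2_P]])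
    then have "L2norm (\<lambda>\<omega>. centered (Y n) \<omega> - centered (P K n) \<omega>)
        \<le> L2norm (centered (\<lambda>\<omega>. Y n \<omega> - P n n \<omega>)) + L2norm (centered (\<lambda>\<omega>. P n n \<omega> - P K n \<omega>))"
      using L2norm_add_le[OF L2_centered[OF L2_diff[OF L2_Y L2_P]] L2_centered[OF L2_diff[OF L2_P L2_P]]]
      by (simp only:)
    moreover have "L2norm (centered (\<lambda>\<omega>. Y n \<omega> - P n n \<omega>)) \<le> C"
      by (rule order_trans[OF L2norm_centered_le[OF L2_diff[OF L2_Y L2_P]]
            L2norm_bounded[OF L2_measurable[OF L2_diff[OF L2_Y L2_P]] Y_P C0]])
    moreover have "L2norm (centered (\<lambda>\<omega>. P n n \<omega> - P K n \<omega>)) \<le> sqrt (real n) * \<epsilon> K"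
    proof -
      have "centered (\<lambda>\<omega>. P n n \<omega> - P K n \<omega>) = (\<lambda>\<omega>. \<Sum>l\<in>L. c l * centered (V l) \<omega>)"
        unfolding PP centered_sum[OF L L2_cmult[OF L2_V]] centered_cmult ..
      then have "L2norm (centered (\<lambda>\<omega>. P n n \<omega> - P K n \<omega>)) \<le> (\<Sum>l\<in>L. L2norm (\<lambda>\<omega>. c l * centered (V l) \<omega>))"
        using L2norm_sum_le[OF L L2_cmult[OF L2_centered[OF L2_V]]] by (simp only:)
      also have "\<dots> \<le> (\<Sum>l\<in>L. sqrt (real n) * (\<bar>c l\<bar> * (sqrt (3 + 2 * total_rate) * tail l K)))"
      proof (rule sum_mono)
        fix l assume l: "l \<in> L"
        have "L2norm (centered (V l)) \<le> (\<Sum>i\<in>{Suc K..n}. L2norm (centered (E l i n)))"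
        proof -
          have "centered (V l) = (\<lambda>\<omega>. \<Sum>i\<in>{Suc K..n}. centered (E l i n) \<omega>)"
            unfolding V_def by (rule centered_sum) (simp_all add: L2_E)
          then show ?thesis
            using L2norm_sum_le[of "{Suc K..n}" "\<lambda>i. centered (E l i n)"] L2_centered[OF L2_E] by simp
        qed
        also have "\<dots> \<le> (\<Sum>i\<in>{Suc K..n}. sqrt (real n) * (sqrt (3 + 2 * total_rate) * f l i))"
          unfolding E_def[abs_def] f_def
          by (rule sum_mono, rule L2norm_exit_sum_le[OF st[OF l]]) simp
        also have "\<dots> = sqrt (real n) * (sqrt (3 + 2 * total_rate) * (\<Sum>i\<in>{Suc K..n}. f l i))"
          by (simp only: sum_distrib_left)
        also have "\<dots> \<le> sqrt (real n) * (sqrt (3 + 2 * total_rate) * tail l K)"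
          using total_rate_nonneg by (intro mult_left_mono tail_ge[OF l K]) simp_all
        finally have "\<bar>c l\<bar> * L2norm (centered (V l)) \<le> \<bar>c l\<bar> * (sqrt (real n) * (sqrt (3 + 2 * total_rate) * tail l K))"
          by (rule mult_left_mono) simp
        then show "L2norm (\<lambda>\<omega>. c l * centered (V l) \<omega>) \<le> sqrt (real n) * (\<bar>c l\<bar> * (sqrt (3 + 2 * total_rate) * tail l K))"
          unfolding L2norm_cmult by (simp only: mult.left_commute)
      qed
      also have "\<dots> = sqrt (real n) * \<epsilon> K" by (simp only: \<epsilon>_def sum_distrib_left)
      finally show ?thesis .
    qed
    ultimately show ?thesis by linarith
  qed
  have \<epsilon>_lim: "\<epsilon> \<longlonglongrightarrow> 0"
  proof -
    have "tail l \<longlonglongrightarrow> 0" if l: "l \<in> L" for l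
    proof -
      have "(\<lambda>K. suminf (f l) - (\<Sum>i<Suc K. f l i)) \<longlonglongrightarrow> suminf (f l) - suminf (f l)"
        by (rule tendsto_diff[OF tendsto_const LIMSEQ_Suc[OF summable_LIMSEQ[OF f_summable[OF l]]]])
      then show ?thesis by (simp add: tail_def[abs_def])
    qed
    then have "(\<lambda>K. \<Sum>l\<in>L. \<bar>c l\<bar> * (sqrt (3 + 2 * total_rate) * tail l K))
        \<longlonglongrightarrow> (\<Sum>l\<in>L. \<bar>c l\<bar> * (sqrt (3 + 2 * total_rate) * 0))"
      by (intro tendsto_sum tendsto_mult_left)
    then show ?thesis by (simp add: \<epsilon>_def[abs_def])
  qed
  have "\<forall>K. \<exists>\<sigma>. (\<forall>u. (\<lambda>n. chf (centered (P K n)) (u / sqrt (real n))) \<longlonglongrightarrow> complex_of_real (exp (- (u\<^sup>2 * \<sigma>\<^sup>2 / 2))))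
    \<and> (\<lambda>n. L2norm (centered (P K n)) / sqrt (real n)) \<longlonglongrightarrow> \<sigma>"
    unfolding P_def[abs_def] by (rule allI) (rule block_sum_clt[OF G_meas G_bound])
  from choice[OF this] obtain \<sigma> where \<sigma>_all: "\<forall>K. (\<forall>u. (\<lambda>n. chf (centered (P K n)) (u / sqrt (real n)))
        \<longlonglongrightarrow> complex_of_real (exp (- (u\<^sup>2 * (\<sigma> K)\<^sup>2 / 2))))
    \<and> (\<lambda>n. L2norm (centered (P K n)) / sqrt (real n)) \<longlonglongrightarrow> \<sigma> K"
    by (rule exE)
  have \<sigma>: "(\<lambda>n. chf (centered (P K n)) (u / sqrt (real n))) \<longlonglongrightarrow> complex_of_real (exp (- (u\<^sup>2 * (\<sigma> K)\<^sup>2 / 2)))"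
    "(\<lambda>n. L2norm (centered (P K n)) / sqrt (real n)) \<longlonglongrightarrow> \<sigma> K" for K u
    using \<sigma>_all by simp_all
  have "\<exists>v\<ge>0. \<forall>u. (\<lambda>n. chf (centered (Y n)) (u / sqrt (real n))) \<longlonglongrightarrow> complex_of_real (exp (- (u\<^sup>2 * v / 2)))"
    by (rule chf_limit_by_approximation[OF L2_centered[OF L2_Y] L2_centered[OF L2_P] \<sigma> close \<epsilon>_lim])
  then obtain v where v: "0 \<le> v"
    "\<forall>u. (\<lambda>n. chf (centered (Y n)) (u / sqrt (real n))) \<longlonglongrightarrow> complex_of_real (exp (- (u\<^sup>2 * v / 2)))"
    by (elim exE conjE)
  have "converges_in_distribution M (normalized M Y) (normal_law 0 v)"
    by (rule converges_from_chf[OF L2_Y v(1) v(2)[rule_format]])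
  then show ?thesis using v(1) by (intro exI[of _ v] conjI)
qed

end

theorem theorem4p6:
  fixes M :: "'a measure"
    and X :: "nat \<Rightarrow> 'a \<Rightarrow> real"
    and m :: nat
    and a :: "nat \<Rightarrow> real"
    and s1 s2 t1 t2 :: "nat \<Rightarrow> ereal"
    and R :: "nat \<Rightarrow> (ereal \<times> ereal) set"
    and f :: "ereal \<times> ereal \<Rightarrow> real"
  assumes "prob_space M"
    and "\<And>i. i \<ge> 1 \<Longrightarrow> X i \<in> borel_measurable M"
    and "strictly_stationary M X"
    and "max_root_summable M X"
    and "(\<Sum>k. rho_mixing M X (Suc k)) < \<infinity>"
    and "continuous_on UNIV (marginal_cdf M X)"
    and "\<And>l. l \<in> {1..m} \<Longrightarrow>
           -\<infinity> < s1 l \<and> s1 l \<le> s2 l \<and> s2 l \<le> t1 l \<and> t1 l \<le> t2 l \<and> t2 l \<le> \<infinity>"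
    and "\<And>l. l \<in> {1..m} \<Longrightarrow> R l = {s1 l<..s2 l} \<times> {t1 l<..t2 l}"
    and "f = (\<lambda>p. \<Sum>l\<in>{1..m}. a l * indicator (R l) p)"
    and "\<And>l s t. l \<in> {1..m} \<Longrightarrow> s \<in> {s1 l, s2 l} \<Longrightarrow> t \<in> {t1 l, t2 l} \<Longrightarrow>
           marginal_cdf_ext M X s > 0 \<and> marginal_cdf_ext M X t < 1"
  shows "\<exists>I\<^sub>f \<ge> 0.
     converges_in_distribution M
       (normalized M (\<lambda>n \<omega>. \<integral>p. f p \<partial>xi0 n (\<lambda>i. X i \<omega>))) (normal_law 0 I\<^sub>f) \<and>
     ((\<forall>l\<in>{1..m}. {s1 l, s2 l, t1 l, t2 l} \<subseteq> range ereal) \<longrightarrow>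
      converges_in_distribution M
        (normalized M (\<lambda>n \<omega>. \<integral>p. f p \<partial>xi0_finite n (\<lambda>i. X i \<omega>))) (normal_law 0 I\<^sub>f))"
proof -
  interpret rho_mixing_process M X
    by (intro rho_mixing_process.intro rho_mixing_process_axioms.intro assms(1-3,5))
  have order: "-\<infinity> < s1 l" "s1 l \<le> s2 l" "s2 l \<le> t1 l" "t1 l \<le> t2 l" if "l \<in> {1..m}" for l
    using assms(7)[OF that] by blast+
  have t_cdf: "marginal_cdf_ext M X (t1 l) < 1" "marginal_cdf_ext M X (t2 l) < 1" if "l \<in> {1..m}" for l
    using assms(10)[OF that, of "s1 l" "t1 l"] assms(10)[OF that, of "s1 l" "t2 l"] by simp_all
  have t2_fin: "t2 l < \<infinity>" if "l \<in> {1..m}" for l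
    using t_cdf(2)[OF that] by (cases "t2 l") (simp_all add: marginal_cdf_ext_def)
  define \<sigma>1 where "\<sigma>1 l = real_of_ereal (s1 l)" for l
  define \<sigma>2 where "\<sigma>2 l = real_of_ereal (s2 l)" for l
  define \<tau>1 where "\<tau>1 l = real_of_ereal (t1 l)" for l
  define \<tau>2 where "\<tau>2 l = real_of_ereal (t2 l)" for l
  have real: "s1 l = ereal (\<sigma>1 l)" "s2 l = ereal (\<sigma>2 l)" "t1 l = ereal (\<tau>1 l)" "t2 l = ereal (\<tau>2 l)"
    if l: "l \<in> {1..m}" for l
  proof -
    have "s1 l = ereal (\<sigma>1 l) \<and> s2 l = ereal (\<sigma>2 l) \<and> t1 l = ereal (\<tau>1 l) \<and> t2 l = ereal (\<tau>2 l)"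
      using order[OF l] t2_fin[OF l] unfolding \<sigma>1_def \<sigma>2_def \<tau>1_def \<tau>2_def
      by (cases "s1 l"; cases "s2 l"; cases "t1 l"; cases "t2 l") simp_all
    then show "s1 l = ereal (\<sigma>1 l)" "s2 l = ereal (\<sigma>2 l)" "t1 l = ereal (\<tau>1 l)" "t2 l = ereal (\<tau>2 l)"
      by simp_all
  qed
  have \<sigma>\<tau>: "\<sigma>1 l \<le> \<sigma>2 l" "\<sigma>2 l \<le> \<tau>1 l" "\<tau>1 l \<le> \<tau>2 l" if l: "l \<in> {1..m}" for l
    using order(2-4)[OF l] unfolding real[OF l] by simp_all
  \<comment> \<open>One index for each corner of each rectangle: \<open>k = 0, 1, 2, 3\<close> stand for
\<open>(s\<^sub>2, t\<^sub>1), (s\<^sub>2, t\<^sub>2), (s\<^sub>1, t\<^sub>1), (s\<^sub>1, t\<^sub>2)\<close>, with signs \<open>+, -, -, +\<close>.\<close>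
  define L where "L = {1..m} \<times> {0, 1, 2, 3 :: nat}"
  define c :: "nat \<times> nat \<Rightarrow> real" where "c = (\<lambda>(l, k). if k = 0 \<or> k = 3 then a l else - a l)"
  define s :: "nat \<times> nat \<Rightarrow> real" where "s = (\<lambda>(l, k). if k < 2 then \<sigma>2 l else \<sigma>1 l)"
  define t :: "nat \<times> nat \<Rightarrow> real" where "t = (\<lambda>(l, k). if k = 0 \<or> k = 2 then \<tau>1 l else \<tau>2 l)"
  define Y where "Y = (\<lambda>n \<omega>. \<Sum>l\<in>L. c l * real (persistent_betti n (\<lambda>i. X i \<omega>) (s l) (t l)))"
  have st: "s l \<le> t l" if l: "l \<in> L" for l
  proof -
    obtain l' k where lk: "l = (l', k)" "l' \<in> {1..m}" using l by (auto simp: L_def)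
    show ?thesis using \<sigma>\<tau>[OF lk(2)] by (simp add: lk(1) s_def t_def)
  qed
  have root: "summable (\<lambda>i. real i * sqrt (run_prob (t l) i))" if l: "l \<in> L" for l
  proof -
    obtain l' k where lk: "l = (l', k)" "l' \<in> {1..m}" using l by (auto simp: L_def)
    have "marginal_cdf M X (\<tau>1 l') < 1" "marginal_cdf M X (\<tau>2 l') < 1"
      using t_cdf[OF lk(2)] unfolding real[OF lk(2)] by (simp_all add: marginal_cdf_ext_def)
    then have "marginal_cdf M X (t l) < 1" by (simp add: t_def lk(1))
    then show ?thesis using assms(4) unfolding max_root_summable_def run_prob_def by blast
  qed
  have "finite L" by (simp add: L_def)
  have "\<exists>v\<ge>0. converges_in_distribution M (normalized M Y) (normal_law 0 v)"
    unfolding Y_def by (rule persistent_betti_clt[OF \<open>finite L\<close> st root])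
  then obtain v where v: "0 \<le> v" "converges_in_distribution M (normalized M Y) (normal_law 0 v)"
    by (elim exE conjE)
  have borel: "R l \<in> sets borel" if "l \<in> {1..m}" for l
    unfolding assms(8)[OF that] by (rule rectangle_borel)
  have integral: "(\<integral>p. f p \<partial>xi0 n (\<lambda>i. X i \<omega>)) = Y n \<omega>" for n \<omega>
  proof -
    let ?b = "\<lambda>u w. real (persistent_betti n (\<lambda>i. X i \<omega>) u w)"
    have "(\<integral>p. f p \<partial>xi0 n (\<lambda>i. X i \<omega>)) = (\<Sum>l\<in>{1..m}. a l * real (size {#p \<in># PD0 n (\<lambda>i. X i \<omega>). p \<in> R l#}))"
      unfolding assms(9) xi0_def by (rule integral_dirac_sum_rectangles[OF borel]) simp_all
    also have "\<dots> = (\<Sum>l\<in>{1..m}. \<Sum>k\<in>{0, 1, 2, 3 :: nat}. c (l, k) * ?b (s (l, k)) (t (l, k)))"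
    proof (rule sum.cong[OF refl])
      fix l assume l: "l \<in> {1..m}"
      have sz: "real (size {#p \<in># PD0 n (\<lambda>i. X i \<omega>). p \<in> R l#})
          = ?b (\<sigma>2 l) (\<tau>1 l) - ?b (\<sigma>2 l) (\<tau>2 l) - ?b (\<sigma>1 l) (\<tau>1 l) + ?b (\<sigma>1 l) (\<tau>2 l)"
        unfolding assms(8)[OF l] real[OF l] persistent_betti_def by (rule size_rectangle[OF \<sigma>\<tau>(1,3)[OF l]])
      show "a l * real (size {#p \<in># PD0 n (\<lambda>i. X i \<omega>). p \<in> R l#})
          = (\<Sum>k\<in>{0, 1, 2, 3 :: nat}. c (l, k) * ?b (s (l, k)) (t (l, k)))"
        unfolding sz by (simp add: c_def s_def t_def algebra_simps)
    qed
    also have "\<dots> = Y n \<omega>" unfolding Y_def L_def by (simp only: sum.cartesian_product case_prod_unfold prod.collapse)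
    finally show ?thesis .
  qed
  have outside: "f p = 0" if p: "p \<notin> Delta_finite" for p
    unfolding assms(9)
  proof (rule sum.neutral, rule ballI)
    fix l assume l: "l \<in> {1..m}"
    have "p \<notin> R l"
    proof
      assume "p \<in> R l"
      then obtain x y where xy: "p = (x, y)" "ereal (\<sigma>1 l) < x" "x \<le> ereal (\<sigma>2 l)" "ereal (\<tau>1 l) < y" "y \<le> ereal (\<tau>2 l)"
        unfolding assms(8)[OF l] real[OF l] by auto
      then obtain x' y' where x': "x = ereal x'" "y = ereal y'" by (cases x; cases y) auto
      then have "x' < y'" using xy \<sigma>\<tau>(2)[OF l] by simp
      then show False using p by (simp add: xy(1) x' Delta_finite_def Delta_def)
    qed
    then show "a l * indicator (R l) p = 0" by simp
  qed
  have "(\<integral>p. f p \<partial>xi0_finite n (\<lambda>i. X i \<omega>)) = Y n \<omega>" for n \<omega>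
    unfolding integral[symmetric] by (rule integral_xi0_finite) (rule outside)
  then have "(\<lambda>n \<omega>. \<integral>p. f p \<partial>xi0_finite n (\<lambda>i. X i \<omega>)) = Y" by (intro ext)
  moreover have "(\<lambda>n \<omega>. \<integral>p. f p \<partial>xi0 n (\<lambda>i. X i \<omega>)) = Y" by (intro ext integral)
  ultimately show ?thesis using v by (intro exI[of _ v]) simp
qed

end
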